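(* Let $n\ge 4$ and let $\Gamma$ be a type IV quiver of mutation type $D_n$ with central cycle of length $m$ and $r$ spikes, where $0\le r<m$, labelled by the type IV (Case 1) labelling procedure. Let $\Phi$ be the root system of type $D_n$ with simple system $\Pi=\{\alpha_1,\ldots,\alpha_n\}$, and identify vertices with their labels. Then the set $\{\beta_i : i\in\Gamma_0\}\subseteq\Phi$ given by $$\beta_i=\begin{cases}\alpha_i+\ldots+\alpha_{i+a} & \text{if } i \text{ is a primary vertex and } i+a \text{ is the complementary vertex corresponding to } i,\\ \alpha_{p_j}+\ldots+\alpha_{p_j+a_j} & \text{if } i=p_j \text{ for some } 1\le j\le r,\\ \alpha_1+\ldots+\alpha_{n-2}+\alpha_n & \text{if } i=n,\\ \alpha_i & \text{otherwise}\end{cases}$$ is a companion basis for $\Gamma$.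
   Context: **Mutation type.** For a simply-laced Dynkin diagram $\Delta$, a quiver is of mutation type $\Delta$ if it is obtained by a finite sequence of (Fomin--Zelevinsky) quiver mutations from a quiver whose underlying graph is $\Delta$. $\Gamma_0$ denotes the vertex set of $\Gamma$. **Root system.** $\Phi$ is the root system of type $D_n$, with inner product $(\cdot,\cdot)$ normalized so that $(\alpha,\alpha)=2$ for all roots $\alpha$; the simple roots are numbered so that the Dynkin diagram is the chain $1 - 2 - \cdots - (n-2)$ with $n-2$ additionally joined to both $n-1$ and $n$. **Companion basis.** A companion basis for a quiver $\Gamma$ of mutation type $\Delta$ is a subset $\{\gamma_x : x\in\Gamma_0\}\subseteq\Phi$ (with $\Phi$ the root system of type $\Delta$) whose elements form a $\mathbb{Z}$-basis of the root lattice $\mathbb{Z}\Phi$ and such that for all distinct $x,y\in\Gamma_0$, $|(\gamma_x,\gamma_y)|$ equals the number of edges joining $x$ and $y$ in the underlying unoriented graph of $\Gamma$. **Structure of type $A$ quivers (known facts making the definitions below meaningful).** A quiver $Q$ of mutation type $A_k$ is connected; the only cycles in its underlying graph are 3-cycles, each of which is cyclically oriented in $Q$; every vertex has valency at most four and lies on at most two 3-cycles. An end vertex is a vertex that has valency zero, or valency one, or has valency two and belongs to a cyclically oriented 3-cycle; if $k\ge 2$ there are at least two end vertices. A string in $Q$ is a reduced walk in $Q$ that does not contain two consecutive arrows of any given 3-cycle; for any two vertices $i,j$ there is a unique string from $i$ to $j$ (trivial if $i=j$), and it visits no vertex twice. Let $p$ be a string from $i$ to $j$. For a 3-cycle with two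 vertices appearing in $p$, the first of these met when moving along $p$ from $i$ to $j$ is a primary vertex relative to $p$, the second is the secondary vertex corresponding to it relative to $p$, and the vertex of the 3-cycle not on $p$ is the complementary vertex corresponding to it relative to $p$. If $x,y,z$ are the vertices of a 3-cycle, the subquiver of $Q$ rooted at $x$ is the full subquiver on all vertices that can be reached on strings starting at $x$ which do not pass through $y$ or $z$; it is again a quiver of mutation type $A$, and $x$ is an end vertex of it. **Type $A$ labelling procedure.** The input is a quiver $Q$ of mutation type $A_k$ and an ordered pair of end vertices of $Q$, distinct if $k\ge 2$. If $k=1$, label the vertex $1$. If $k\ge 2$ with pair $(e,f)$, label $e$ by $1$ and let $p$ be the string from $e$ to $f$; move along $p$ from $e$ to $f$. If the current vertex has label $\ell$ and is not a primary vertex relative to $p$, label the next vertex of $p$ by $\ell+1$. If the current vertex has label $\ell$ and is a primary vertex relative to $p$ with corresponding complementary vertex $z$, let $Q'$ be the subquiver of $Q$ rooted at $z$ and let $a$ be its number of vertices; choose an end vertex $z'$ of $Q'$, distinct from $z$ if $a>1$; recursively label $Q'$ with $1,\ldots,a$ using the ordered pair $(z',z)$; add $\ell$ to each of these labels and assign the results to the corresponding vertices of $Q$; then label the next vertex on $p$ (the corresponding secondary vertex) by $\ell+a+1$. Continue until $f$ is labelled; it gets the label $k$. **Type IV quivers.** Let $m\ge 3$ and $0\le r\le m$, with $r>0$ if $m=3$. The skeleton $\Gamma^{(0)}$ consists of an oriented $m$-cycle (the central cycle, drawn so that its arrows point clockwise), together with $r$ additional vertices $c_1,\ldots,c_r$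 corresponding to $r$ distinct arrows $p_1\to s_1,\ldots,p_r\to s_r$ of the central cycle, listed in clockwise order; for each $i$ there are arrows $s_i\to c_i$ and $c_i\to p_i$, so that $p_i\to s_i\to c_i\to p_i$ is an oriented 3-cycle, called the spike $S_i$. There are no other arrows. (It can happen that $s_i=p_{i+1}$, or $s_r=p_1$.) $\Gamma$ is of type IV if it is obtained from a disjoint union $\Gamma^{(0)}\sqcup\Gamma^{(1)}\sqcup\cdots\sqcup\Gamma^{(r)}$, where each $\Gamma^{(i)}$ ($1\le i\le r$) is a quiver of mutation type $A_{a_i}$ (so it has $a_i$ vertices), by identifying an end vertex $v_i$ of $\Gamma^{(i)}$ with $c_i$ for each $i$. (If $r=0$, $\Gamma=\Gamma^{(0)}$ is an oriented $n$-cycle.) One has $n=m+\sum_{i=1}^r a_i$. **Labelling in Case 1 ($0\le r<m$).** If $r=0$: label an arbitrary vertex of the oriented $n$-cycle $\Gamma$ by $1$, and then label successive vertices clockwise (in the direction of the arrows) $2,3,\ldots,n$. If $0<r<m$: renumber the spikes cyclically if necessary so that $p_1\ne s_r$. Label $p_1$ by $1$ and then, travelling clockwise around the central cycle, label successive vertices in increments of $1$, except that for each $1\le i\le r$ the vertex $s_i$ following $p_i$ is labelled $p_i+a_i+1$ (vertex names $p_i,s_i$ are identified with their labels). Then for each $1\le i\le r$: choose an ordered pair of end vertices (distinct if possible) of $\Gamma^{(i)}$ with $v_i$ the second vertex in the pair, apply the type $A$ labelling procedure to $\Gamma^{(i)}$, add $p_i$ to each label (giving labels $p_i+1,\ldots,p_i+a_i$,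 with $v_i$ labelled $p_i+a_i$), and assign these labels to the corresponding vertices of $\Gamma$. **Vertex types in the labelled quiver.** If the vertices of a 3-cycle of some $\Gamma^{(t)}$, $1\le t\le r$, have labels $i<j<k$, then $i$ is called a primary vertex, $j$ a complementary vertex (the complementary vertex corresponding to $i$), and $k$ a secondary vertex. A vertex of $\Gamma$ is primary (resp. complementary, secondary) if it is so in $\Gamma^{(t)}$ for some $1\le t\le r$. *)

theory Defs
  imports "HOL-Analysis.Analysis"
begin

section \<open>Quivers and mutation\<close>

text \<open>\<open>arrs Q x y\<close> is the number of arrows from \<open>x\<close> to \<open>y\<close>.\<close>

record 'a quiver =
  verts :: "'a set"
  arrs :: "'a \<Rightarrow> 'a \<Rightarrow> nat"

definition wf_quiver :: "'a quiver \<Rightarrow> bool" where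
  "wf_quiver Q \<longleftrightarrow>
     finite (verts Q) \<and>
     (\<forall>x y. arrs Q x y > 0 \<longrightarrow> x \<in> verts Q \<and> y \<in> verts Q) \<and>
     (\<forall>x. arrs Q x x = 0) \<and>
     (\<forall>x y. arrs Q x y > 0 \<longrightarrow> arrs Q y x = 0)"

definition edges :: "'a quiver \<Rightarrow> 'a \<Rightarrow> 'a \<Rightarrow> nat" where
  "edges Q x y = arrs Q x y + arrs Q y x"

definition full_subquiver :: "'a quiver \<Rightarrow> 'a set \<Rightarrow> 'a quiver" where
  "full_subquiver Q W =
     \<lparr>verts = verts Q \<inter> W, arrs = (\<lambda>x y. if x \<in> W \<and> y \<in> W then arrs Q x y else 0)\<rparr>"

text \<open>The truncated subtraction on \<^typ>\<open>nat\<close> cancels a maximal set of 2-cycles after the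
  composite arrows through \<open>k\<close> have been added.\<close>

definition mutate :: "'a \<Rightarrow> 'a quiver \<Rightarrow> 'a quiver" where
  "mutate k Q =
     \<lparr>verts = verts Q,
      arrs = (\<lambda>x y. if x = k \<or> y = k then arrs Q y x
                    else (arrs Q x y + arrs Q x k * arrs Q k y)
                         - (arrs Q y x + arrs Q y k * arrs Q k x))\<rparr>"

inductive mutation_reachable :: "'a quiver \<Rightarrow> 'a quiver \<Rightarrow> bool" for Q where
  start: "mutation_reachable Q Q"
| mutate: "mutation_reachable Q R \<Longrightarrow> k \<in> verts R \<Longrightarrow> mutation_reachable Q (mutate k R)"

text \<open>Simply-laced Dynkin diagrams on the vertex set \<open>{1..n}\<close>, given by adjacency. In type \<open>D\<close> the
  chain is \<open>1 - \<dots> - (n-2)\<close>, and \<open>n-2\<close> is joined to \<open>n-1\<close> and to \<open>n\<close>.\<close>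

definition dynkin_A :: "nat \<Rightarrow> nat \<Rightarrow> nat \<Rightarrow> bool" where
  "dynkin_A n i j \<longleftrightarrow> i \<in> {1..n} \<and> j \<in> {1..n} \<and> (j = i + 1 \<or> i = j + 1)"

definition dynkin_D :: "nat \<Rightarrow> nat \<Rightarrow> nat \<Rightarrow> bool" where
  "dynkin_D n i j \<longleftrightarrow> i \<in> {1..n} \<and> j \<in> {1..n} \<and>
     (j = i + 1 \<and> j < n \<or> i = j + 1 \<and> i < n \<or> i + 2 = n \<and> j = n \<or> j + 2 = n \<and> i = n)"

definition has_underlying_graph :: "'a quiver \<Rightarrow> nat \<Rightarrow> (nat \<Rightarrow> nat \<Rightarrow> bool) \<Rightarrow> bool" where
  "has_underlying_graph Q n adj \<longleftrightarrow>
     (\<exists>\<phi>. bij_betw \<phi> (verts Q) {1..n} \<and>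
        (\<forall>x\<in>verts Q. \<forall>y\<in>verts Q. edges Q x y = (if adj (\<phi> x) (\<phi> y) then 1 else 0)))"

definition has_mutation_type :: "'a quiver \<Rightarrow> nat \<Rightarrow> (nat \<Rightarrow> nat \<Rightarrow> bool) \<Rightarrow> bool" where
  "has_mutation_type Q n adj \<longleftrightarrow>
     (\<exists>Q0. wf_quiver Q0 \<and> has_underlying_graph Q0 n adj \<and> mutation_reachable Q0 Q)"

definition mutation_type_A :: "nat \<Rightarrow> 'a quiver \<Rightarrow> bool" where
  "mutation_type_A k Q \<longleftrightarrow> k \<ge> 1 \<and> has_mutation_type Q k (dynkin_A k)"

definition mutation_type_D :: "nat \<Rightarrow> 'a quiver \<Rightarrow> bool" where
  "mutation_type_D n Q \<longleftrightarrow> n \<ge> 4 \<and> has_mutation_type Q n (dynkin_D n)"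


section \<open>Strings and the type \<open>A\<close> labelling procedure\<close>

definition oriented_3cycle :: "'a quiver \<Rightarrow> 'a \<Rightarrow> 'a \<Rightarrow> 'a \<Rightarrow> bool" where
  "oriented_3cycle Q x y z \<longleftrightarrow> arrs Q x y > 0 \<and> arrs Q y z > 0 \<and> arrs Q z x > 0"

text \<open>\<open>x\<close>, \<open>y\<close>, \<open>z\<close>, in any order, are the vertices of a (cyclically oriented) 3-cycle.\<close>

definition three_cycle :: "'a quiver \<Rightarrow> 'a \<Rightarrow> 'a \<Rightarrow> 'a \<Rightarrow> bool" where
  "three_cycle Q x y z \<longleftrightarrow> oriented_3cycle Q x y z \<or> oriented_3cycle Q x z y"

definition valency :: "'a quiver \<Rightarrow> 'a \<Rightarrow> nat" where
  "valency Q x = (\<Sum>y\<in>verts Q. edges Q x y)"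

definition end_vertex :: "'a quiver \<Rightarrow> 'a \<Rightarrow> bool" where
  "end_vertex Q x \<longleftrightarrow> x \<in> verts Q \<and>
     (valency Q x = 0 \<or> valency Q x = 1 \<or>
      valency Q x = 2 \<and> (\<exists>y z. oriented_3cycle Q x y z))"

text \<open>Quivers of mutation type \<open>A\<close> have no multiple arrows, so a walk, which may traverse arrows in
  either direction, is given by the nonempty list of the vertices it visits.\<close>

definition is_string :: "'a quiver \<Rightarrow> 'a list \<Rightarrow> bool" where
  "is_string Q p \<longleftrightarrow> p \<noteq> [] \<and> set p \<subseteq> verts Q \<and>
     (\<forall>i. Suc i < length p \<longrightarrow> edges Q (p ! i) (p ! Suc i) > 0) \<and>
     (\<forall>i. Suc (Suc i) < length p \<longrightarrow>
        p ! i \<noteq> p ! Suc (Suc i) \<and> \<not> three_cycle Q (p ! i) (p ! Suc i) (p ! Suc (Suc i)))"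

definition string_from_to :: "'a quiver \<Rightarrow> 'a \<Rightarrow> 'a \<Rightarrow> 'a list \<Rightarrow> bool" where
  "string_from_to Q x y p \<longleftrightarrow> is_string Q p \<and> hd p = x \<and> last p = y"

text \<open>For a 3-cycle with vertices \<open>x\<close>, \<open>y\<close>, \<open>z\<close>, the subquiver of \<open>Q\<close> rooted at \<open>x\<close>; it
  depends on the 3-cycle, as \<open>x\<close> may lie on two of them.\<close>

definition rooted_subquiver :: "'a quiver \<Rightarrow> 'a \<Rightarrow> 'a \<Rightarrow> 'a \<Rightarrow> 'a quiver" where
  "rooted_subquiver Q x y z =
     full_subquiver Q {v. \<exists>p. string_from_to Q x v p \<and> y \<notin> set p \<and> z \<notin> set p}"

text \<open>\<open>x\<close> is a primary vertex relative to the string \<open>p\<close>, with corresponding secondary vertex \<open>y\<close>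
  and complementary vertex \<open>z\<close>.\<close>

definition primary_rel :: "'a quiver \<Rightarrow> 'a list \<Rightarrow> 'a \<Rightarrow> 'a \<Rightarrow> 'a \<Rightarrow> bool" where
  "primary_rel Q p x y z \<longleftrightarrow> three_cycle Q x y z \<and> z \<notin> set p \<and>
     (\<exists>i j. i < j \<and> j < length p \<and> p ! i = x \<and> p ! j = y)"

text \<open>\<open>type_A_labelling Q e f L\<close>: the restriction of \<open>L\<close> to the vertices of \<open>Q\<close> is a possible
  outcome of the type \<open>A\<close> labelling procedure with input \<open>Q\<close> and \<open>(e, f)\<close>. The procedure involves
  choices (the vertex \<open>z'\<close> below, and recursively), so it is a relation.\<close>

inductive type_A_labelling :: "'a quiver \<Rightarrow> 'a \<Rightarrow> 'a \<Rightarrow> ('a \<Rightarrow> nat) \<Rightarrow> bool" where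
  single:
    "mutation_type_A 1 Q \<Longrightarrow> verts Q = {e} \<Longrightarrow> L e = 1 \<Longrightarrow> type_A_labelling Q e e L"
| walk:
    "\<lbrakk>mutation_type_A k Q; k \<ge> 2; end_vertex Q e; end_vertex Q f; e \<noteq> f;
      string_from_to Q e f p;
      L e = 1;
      \<forall>i. Suc i < length p \<and> (\<nexists>y z. primary_rel Q p (p ! i) y z) \<longrightarrow>
        L (p ! Suc i) = L (p ! i) + 1;
      \<forall>i y z Q'. Suc i < length p \<and> primary_rel Q p (p ! i) y z \<and>
          Q' = rooted_subquiver Q z (p ! i) y \<longrightarrow>
        (\<exists>z' L'. end_vertex Q' z' \<and> (card (verts Q') > 1 \<longrightarrow> z' \<noteq> z) \<and>
           type_A_labelling Q' z' z L' \<and> (\<forall>v\<in>verts Q'. L v = L (p ! i) + L' v)) \<and>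
        L (p ! Suc i) = L (p ! i) + card (verts Q') + 1\<rbrakk>
     \<Longrightarrow> type_A_labelling Q e f L"


section \<open>Type IV quivers and their labelling\<close>

text \<open>The central cycle is \<open>w 0 \<rightarrow> w 1 \<rightarrow> \<dots> \<rightarrow> w (m - 1) \<rightarrow> w 0\<close> (clockwise). For \<open>1 \<le> i \<le> r\<close> the
  spike \<open>S\<^sub>i\<close> has \<open>p\<^sub>i = w (q i)\<close> and apex \<open>c i\<close>; listing the spikes clockwise means that \<open>q\<close> is
  increasing.\<close>

definition spike_p :: "(nat \<Rightarrow> 'a) \<Rightarrow> (nat \<Rightarrow> nat) \<Rightarrow> nat \<Rightarrow> 'a" where
  "spike_p w q i = w (q i)"

definition spike_s :: "nat \<Rightarrow> (nat \<Rightarrow> 'a) \<Rightarrow> (nat \<Rightarrow> nat) \<Rightarrow> nat \<Rightarrow> 'a" where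
  "spike_s m w q i = w (Suc (q i) mod m)"

definition skeleton_data ::
  "nat \<Rightarrow> nat \<Rightarrow> (nat \<Rightarrow> 'a) \<Rightarrow> (nat \<Rightarrow> nat) \<Rightarrow> (nat \<Rightarrow> 'a) \<Rightarrow> bool" where
  "skeleton_data m r w q c \<longleftrightarrow>
     m \<ge> 3 \<and> r \<le> m \<and> (m = 3 \<longrightarrow> r > 0) \<and>
     inj_on w {..<m} \<and> inj_on c {1..r} \<and> w ` {..<m} \<inter> c ` {1..r} = {} \<and>
     strict_mono_on {1..r} q \<and> (\<forall>i\<in>{1..r}. q i < m)"

definition skeleton ::
  "nat \<Rightarrow> nat \<Rightarrow> (nat \<Rightarrow> 'a) \<Rightarrow> (nat \<Rightarrow> nat) \<Rightarrow> (nat \<Rightarrow> 'a) \<Rightarrow> 'a quiver" where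
  "skeleton m r w q c =
     \<lparr>verts = w ` {..<m} \<union> c ` {1..r},
      arrs = (\<lambda>x y.
        if (\<exists>j<m. x = w j \<and> y = w (Suc j mod m)) \<or>
           (\<exists>i\<in>{1..r}. x = spike_s m w q i \<and> y = c i \<or> x = c i \<and> y = spike_p w q i)
        then 1 else 0)\<rparr>"

text \<open>\<open>G i\<close> is \<open>\<Gamma>\<^sup>(\<^sup>i\<^sup>)\<close>, and \<open>a\<^sub>i = card (verts (G i))\<close>. The identification of the end vertex
  \<open>v\<^sub>i\<close> of \<open>G i\<close> with \<open>c i\<close> is expressed inside the vertex type: \<open>v\<^sub>i = c i\<close> is the only vertex that
  \<open>G i\<close> shares with the skeleton, and the \<open>G i\<close> are pairwise disjoint.\<close>

definition type_IV ::
  "'a quiver \<Rightarrow> nat \<Rightarrow> nat \<Rightarrow> (nat \<Rightarrow> 'a) \<Rightarrow> (nat \<Rightarrow> nat) \<Rightarrow> (nat \<Rightarrow> 'a) \<Rightarrow> (nat \<Rightarrow> 'a quiver) \<Rightarrow> bool"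
where
  "type_IV \<Gamma> m r w q c G \<longleftrightarrow>
     skeleton_data m r w q c \<and>
     (\<forall>i\<in>{1..r}. mutation_type_A (card (verts (G i))) (G i) \<and> end_vertex (G i) (c i) \<and>
        verts (G i) \<inter> verts (skeleton m r w q c) = {c i}) \<and>
     (\<forall>i\<in>{1..r}. \<forall>j\<in>{1..r}. i \<noteq> j \<longrightarrow> verts (G i) \<inter> verts (G j) = {}) \<and>
     verts \<Gamma> = verts (skeleton m r w q c) \<union> (\<Union>i\<in>{1..r}. verts (G i)) \<and>
     (\<forall>x y. arrs \<Gamma> x y = arrs (skeleton m r w q c) x y + (\<Sum>i\<in>{1..r}. arrs (G i) x y))"

text \<open>The labelling for \<open>r < m\<close>. The enumeration \<open>w\<close> of the central cycle is taken to start at the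
  vertex labelled \<open>1\<close>: an arbitrary vertex if \<open>r = 0\<close>, and \<open>p\<^sub>1\<close> (that is, \<open>q 1 = 0\<close>) if \<open>r > 0\<close>,
  where the spikes are numbered so that \<open>p\<^sub>1 \<noteq> s\<^sub>r\<close>.\<close>

definition type_IV_labelling ::
  "nat \<Rightarrow> nat \<Rightarrow> (nat \<Rightarrow> 'a) \<Rightarrow> (nat \<Rightarrow> nat) \<Rightarrow> (nat \<Rightarrow> 'a) \<Rightarrow> (nat \<Rightarrow> 'a quiver) \<Rightarrow> ('a \<Rightarrow> nat) \<Rightarrow> bool"
where
  "type_IV_labelling m r w q c G lab \<longleftrightarrow>
     (r > 0 \<longrightarrow> q 1 = 0 \<and> spike_p w q 1 \<noteq> spike_s m w q r) \<and>
     lab (w 0) = 1 \<and>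
     (\<forall>j. Suc j < m \<and> j \<notin> q ` {1..r} \<longrightarrow> lab (w (Suc j)) = lab (w j) + 1) \<and>
     (\<forall>i\<in>{1..r}. lab (spike_s m w q i) = lab (spike_p w q i) + card (verts (G i)) + 1) \<and>
     (\<forall>i\<in>{1..r}. \<exists>e L. type_A_labelling (G i) e (c i) L \<and>
        (\<forall>x\<in>verts (G i). lab x = lab (spike_p w q i) + L x))"

text \<open>\<open>x\<close> is a primary vertex of the labelled quiver with corresponding complementary vertex \<open>y\<close>.\<close>

definition primary_complementary ::
  "nat \<Rightarrow> (nat \<Rightarrow> 'a quiver) \<Rightarrow> ('a \<Rightarrow> nat) \<Rightarrow> 'a \<Rightarrow> 'a \<Rightarrow> bool" where
  "primary_complementary r G lab x y \<longleftrightarrow>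
     (\<exists>t\<in>{1..r}. \<exists>z. three_cycle (G t) x y z \<and> lab x < lab y \<and> lab y < lab z)"


section \<open>Root systems and companion bases\<close>

text \<open>As usual for reflection groups, a root system need not span the ambient inner product space.\<close>

definition root_system :: "'v::real_inner set \<Rightarrow> bool" where
  "root_system \<Phi> \<longleftrightarrow>
     finite \<Phi> \<and> 0 \<notin> \<Phi> \<and>
     (\<forall>a\<in>\<Phi>. \<Phi> \<inter> span {a} = {a, - a}) \<and>
     (\<forall>a\<in>\<Phi>. \<forall>b\<in>\<Phi>. b - (2 * (a \<bullet> b) / (a \<bullet> a)) *\<^sub>R a \<in> \<Phi>) \<and>
     (\<forall>a\<in>\<Phi>. \<forall>b\<in>\<Phi>. 2 * (a \<bullet> b) / (a \<bullet> a) \<in> \<int>)"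

definition simple_system :: "'v::real_inner set \<Rightarrow> nat \<Rightarrow> (nat \<Rightarrow> 'v) \<Rightarrow> bool" where
  "simple_system \<Phi> n \<alpha> \<longleftrightarrow>
     \<alpha> ` {1..n} \<subseteq> \<Phi> \<and> inj_on \<alpha> {1..n} \<and> independent (\<alpha> ` {1..n}) \<and>
     (\<forall>b\<in>\<Phi>. \<exists>k::nat \<Rightarrow> nat. b = (\<Sum>i=1..n. real (k i) *\<^sub>R \<alpha> i) \<or>
                             b = - (\<Sum>i=1..n. real (k i) *\<^sub>R \<alpha> i))"

text \<open>\<open>\<Phi>\<close> is the root system of type \<open>D\<^sub>n\<close>, normalized so that all roots have square length 2, and
  \<open>\<alpha> 1, \<dots>, \<alpha> n\<close> are its simple roots, numbered as in \<^const>\<open>dynkin_D\<close>.\<close>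

definition root_system_D :: "nat \<Rightarrow> 'v::real_inner set \<Rightarrow> (nat \<Rightarrow> 'v) \<Rightarrow> bool" where
  "root_system_D n \<Phi> \<alpha> \<longleftrightarrow>
     root_system \<Phi> \<and> (\<forall>a\<in>\<Phi>. a \<bullet> a = 2) \<and> simple_system \<Phi> n \<alpha> \<and>
     (\<forall>i\<in>{1..n}. \<forall>j\<in>{1..n}. i \<noteq> j \<longrightarrow> \<alpha> i \<bullet> \<alpha> j = (if dynkin_D n i j then -1 else 0))"

definition root_lattice :: "'v::real_inner set \<Rightarrow> 'v set" where
  "root_lattice \<Phi> = {v. \<exists>k::'v \<Rightarrow> int. v = (\<Sum>a\<in>\<Phi>. real_of_int (k a) *\<^sub>R a)}"

definition int_basis :: "'v::real_inner set \<Rightarrow> 'a set \<Rightarrow> ('a \<Rightarrow> 'v) \<Rightarrow> bool" where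
  "int_basis \<Lambda> X \<gamma> \<longleftrightarrow>
     (\<forall>k::'a \<Rightarrow> int. (\<Sum>x\<in>X. real_of_int (k x) *\<^sub>R \<gamma> x) = 0 \<longrightarrow> (\<forall>x\<in>X. k x = 0)) \<and>
     \<Lambda> = {v. \<exists>k::'a \<Rightarrow> int. v = (\<Sum>x\<in>X. real_of_int (k x) *\<^sub>R \<gamma> x)}"

definition companion_basis :: "'v::real_inner set \<Rightarrow> 'a quiver \<Rightarrow> ('a \<Rightarrow> 'v) \<Rightarrow> bool" where
  "companion_basis \<Phi> \<Gamma> \<gamma> \<longleftrightarrow>
     \<gamma> ` verts \<Gamma> \<subseteq> \<Phi> \<and>
     int_basis (root_lattice \<Phi>) (verts \<Gamma>) \<gamma> \<and>
     (\<forall>x\<in>verts \<Gamma>. \<forall>y\<in>verts \<Gamma>. x \<noteq> y \<longrightarrow> \<bar>\<gamma> x \<bullet> \<gamma> y\<bar> = real (edges \<Gamma> x y))"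

text \<open>The family \<open>\<beta>\<close>, indexed by the vertices \<open>x\<close> of \<open>\<Gamma>\<close> rather than by their labels \<open>lab x\<close>.\<close>

definition beta_IV ::
  "nat \<Rightarrow> nat \<Rightarrow> (nat \<Rightarrow> 'a) \<Rightarrow> (nat \<Rightarrow> nat) \<Rightarrow> (nat \<Rightarrow> 'a quiver) \<Rightarrow> ('a \<Rightarrow> nat) \<Rightarrow>
   (nat \<Rightarrow> 'v::real_inner) \<Rightarrow> 'a \<Rightarrow> 'v" where
  "beta_IV n r w q G lab \<alpha> x =
     (if \<exists>y. primary_complementary r G lab x y then
        (\<Sum>k = lab x..lab (THE y. primary_complementary r G lab x y). \<alpha> k)
      else if \<exists>j\<in>{1..r}. x = spike_p w q j then
        (\<Sum>k = lab x..lab x + card (verts (G (THE j. j \<in> {1..r} \<and> x = spike_p w q j))). \<alpha> k)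
      else if lab x = n then (\<Sum>k = 1..n - 2. \<alpha> k) + \<alpha> n
      else \<alpha> (lab x))"

end

theory Submission
  imports Defs "HOL-Library.Tree"
begin

text \<open>
  A quiver of mutation type \<open>A\<close> is encoded by a binary tree: its vertices are the nodes, and a node \<open>x\<close>
  with subtrees \<open>l\<close> and \<open>r\<close> contributes the arrows of the 3-cycle \<open>root l \<rightarrow> x \<rightarrow> root r \<rightarrow> root l\<close>
  (only those that exist if a subtree is empty). Seen from any vertex \<open>x\<close>, such a quiver consists
  of \<open>x\<close> and four subtrees \<open>l, r, l', r'\<close>, two for each of the two blocks at \<open>x\<close>, and mutation at \<open>x\<close>
  merely permutes them to \<open>r', l, r, l'\<close>; changing the vertex from which the quiver is seen is a tree
  rotation. Hence the class of tree quivers is mutation invariant, and an end vertex is one that can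
  be taken as the root of the tree.

  Strings from the root are descending paths, so the type \<open>A\<close> labelling procedure labels the
  tree in postorder, in an order of the siblings dictated by the string. For a postorder
  labelling the prescribed root of a vertex labelled \<open>i\<close> is \<open>\<epsilon> i - \<epsilon> j\<close>, where \<open>j\<close> is the label of its
  parent, and two vertices are joined iff one is the parent of the other or they are siblings, that is,
  iff these roots have exactly one index in common.

  A labelled type IV quiver is, apart from the arrow of the central cycle that ends in the vertex
  labelled \<open>1\<close>, again a tree quiver labelled in postorder, with root labelled \<open>n\<close>. The root vector
  \<open>\<epsilon> 1 + \<epsilon> n\<close> of the vertex labelled \<open>n\<close> accounts for its children and for the additional arrow.
\<close>

section \<open>Quivers of mutation type \<open>A\<close> as binary trees\<close>

text \<open>A set with at most one element instead of an option: products such as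
  \<open>roots l \<times> {x}\<close> vanish by themselves when a subtree is empty.\<close>

fun roots :: "'a tree \<Rightarrow> 'a set" where
  "roots Leaf = {}"
| "roots (Node l x r) = {x}"

fun tree_arrows :: "'a tree \<Rightarrow> ('a \<times> 'a) set" where
  "tree_arrows Leaf = {}"
| "tree_arrows (Node l x r) =
     roots l \<times> {x} \<union> {x} \<times> roots r \<union> roots r \<times> roots l \<union> tree_arrows l \<union> tree_arrows r"

definition quiver_of :: "'a set \<Rightarrow> ('a \<times> 'a) set \<Rightarrow> 'a quiver" where
  "quiver_of V A = \<lparr>verts = V, arrs = (\<lambda>u v. of_bool ((u, v) \<in> A))\<rparr>"

abbreviation tree_quiver :: "'a tree \<Rightarrow> 'a quiver" where
  "tree_quiver t \<equiv> quiver_of (set_tree t) (tree_arrows t)"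

abbreviation distinct_tree :: "'a tree \<Rightarrow> bool" where
  "distinct_tree t \<equiv> distinct (inorder t)"

lemma verts_quiver_of [simp]: "verts (quiver_of V A) = V"
  and arrs_quiver_of [simp]: "arrs (quiver_of V A) u v = of_bool ((u, v) \<in> A)"
  by (simp_all add: quiver_of_def)

lemma quiver_eqI:
  fixes Q R :: "'a quiver"
  assumes "verts Q = verts R" "\<And>u v. arrs Q u v = arrs R u v"
  shows "Q = R"
  using assms by (cases Q; cases R) (auto simp: fun_eq_iff)

lemma roots_subset: "roots t \<subseteq> set_tree t"
  by (cases t) auto

lemma roots_unique: "u \<in> roots t \<Longrightarrow> v \<in> roots t \<Longrightarrow> u = v"
  by (cases t) auto

lemma tree_arrows_subset: "tree_arrows t \<subseteq> set_tree t \<times> set_tree t"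
proof (induction t)
  case (Node l x r)
  then show ?case using roots_subset[of l] roots_subset[of r] by auto
qed simp

lemma tree_arrows_in: "(u, v) \<in> tree_arrows t \<Longrightarrow> u \<in> set_tree t \<and> v \<in> set_tree t"
  using tree_arrows_subset[of t] by auto

lemma tree_arrows_notin:
  assumes "u \<notin> set_tree t"
  shows "(u, v) \<notin> tree_arrows t" "(v, u) \<notin> tree_arrows t"
  using assms tree_arrows_in by fast+

lemma roots_notin: "u \<notin> set_tree t \<Longrightarrow> u \<notin> roots t"
  using roots_subset by fast

text \<open>By distinctness each endpoint lies in exactly one of left subtree, root and right
  subtree, and between two different ones of these all arrows point the same way.\<close>

lemma tree_arrows_asym: "distinct_tree t \<Longrightarrow> (u, v) \<in> tree_arrows t \<Longrightarrow> (v, u) \<notin> tree_arrows t"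
proof (induction t)
  case (Node l x r)
  have "s \<notin> set_tree r \<and> s \<noteq> x" if "s \<in> set_tree l" for s using Node.prems that by auto
  moreover have "s \<notin> set_tree l \<and> s \<noteq> x" if "s \<in> set_tree r" for s using Node.prems that by auto
  moreover have "x \<notin> set_tree l" "x \<notin> set_tree r" using Node.prems by auto
  moreover have "u \<in> set_tree l \<or> u = x \<or> u \<in> set_tree r" "v \<in> set_tree l \<or> v = x \<or> v \<in> set_tree r"
    using tree_arrows_in[OF Node.prems(2)] by auto
  ultimately show ?case using Node by (elim disjE) (simp_all add: tree_arrows_notin roots_notin)
qed simp

lemma tree_arrows_irrefl: "distinct_tree t \<Longrightarrow> (u, u) \<notin> tree_arrows t"
  using tree_arrows_asym by metis

section \<open>Change of viewpoint and mutation\<close>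

text \<open>The quiver seen from a vertex \<open>x\<close> at which the blocks \<open>l, x, r\<close> and \<open>l', x, r'\<close> meet.\<close>

definition branch_quiver :: "'a \<Rightarrow> 'a tree \<Rightarrow> 'a tree \<Rightarrow> 'a tree \<Rightarrow> 'a tree \<Rightarrow> 'a quiver" where
  "branch_quiver x l r l' r' =
     quiver_of (set_tree \<langle>l, x, r\<rangle> \<union> set_tree \<langle>l', x, r'\<rangle>)
       (tree_arrows \<langle>l, x, r\<rangle> \<union> tree_arrows \<langle>l', x, r'\<rangle>)"

abbreviation distinct_branches :: "'a \<Rightarrow> 'a tree \<Rightarrow> 'a tree \<Rightarrow> 'a tree \<Rightarrow> 'a tree \<Rightarrow> bool" where
  "distinct_branches x l r l' r' \<equiv>
     distinct (x # inorder l @ inorder r @ inorder l' @ inorder r')"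

lemma branch_quiver_swap: "branch_quiver x l r l' r' = branch_quiver x l' r' l r"
  by (simp add: branch_quiver_def Un_commute)

lemma branch_quiver_Leaf: "branch_quiver x l r Leaf Leaf = tree_quiver \<langle>l, x, r\<rangle>"
  by (auto simp add: branch_quiver_def intro!: quiver_eqI)

text \<open>The block at \<open>x\<close> consists of those arrows of
  \<open>y -> x -> root r -> y\<close> that exist. Read from \<open>y\<close>, the subtree
  \<open>r\<close> takes the left place, and \<open>x\<close> together with its other block hangs on
  the right.\<close>

lemma branch_quiver_rotate_left:
  "branch_quiver x \<langle>a, y, b\<rangle> r l' r' = branch_quiver y a b r \<langle>l', x, r'\<rangle>"
  unfolding branch_quiver_def by (rule arg_cong2[where f = quiver_of]) (simp add: insert_commute
      Un_ac, simp add: Un_ac)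

text \<open>Mirror image of the left rotation: the block \<open>root l -> x -> y -> root l\<close>,
  read from \<open>y\<close>, has \<open>x\<close> with its other block on the left and
  \<open>l\<close> on the right.\<close>

lemma branch_quiver_rotate_right:
  "branch_quiver x l \<langle>a, y, b\<rangle> l' r' = branch_quiver y a b \<langle>l', x, r'\<rangle> l"
  unfolding branch_quiver_def by (rule arg_cong2[where f = quiver_of]) (simp add: insert_commute
      Un_ac, simp add: Un_ac)

text \<open>The left-hand side is the arrow count of \<open>mutate\<close> between two vertices
  other than the mutated one. By the first hypothesis a composite arrow never duplicates an existing
  one, so that no double arrow arises.\<close>

lemma of_bool_cancel:
  assumes "\<not> (A \<and> B \<and> C)" and "P \<longleftrightarrow> (A \<or> B \<and> C) \<and> \<not> D \<and> \<not> (E \<and> F)"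
  shows "(of_bool A + of_bool B * of_bool C) - (of_bool D + of_bool E * of_bool F) = (of_bool P ::
      nat)"
  using assms by (cases A; cases B; cases C; cases D; cases E; cases F) simp_all

text \<open>Mutation reverses the arrows at \<open>x\<close>. The composites
  \<open>root l -> x -> root r\<close> and \<open>root l' -> x -> root r'\<close> cancel the
  existing arrows \<open>root r -> root l\<close> and \<open>root r' -> root l'\<close>, while the
  composites \<open>root l -> root r'\<close> and \<open>root l' -> root r\<close> survive and close
  the two new blocks.\<close>

lemma mutate_branch_quiver:
  assumes "distinct_branches x l r l' r'"
  shows "mutate x (branch_quiver x l r l' r') = branch_quiver x r' l r l'"
proof (rule quiver_eqI)
  fix u v :: 'a
  \<comment> \<open>The arrow relation spelled out over the four branches, so that it can be
    simplified once the branches of both endpoints are known.\<close>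
  define arrow where "arrow l r l' r' s t \<longleftrightarrow>
      s \<in> roots l \<and> t = x \<or> s \<in> roots l' \<and> t = x \<or> s = x \<and> t \<in> roots r \<or> s = x \<and> t \<in> roots r' \<or>
      s \<in> roots r \<and> t \<in> roots l \<or> s \<in> roots r' \<and> t \<in> roots l' \<or>
     (s, t) \<in> tree_arrows l \<or> (s, t) \<in> tree_arrows r \<or> (s, t) \<in> tree_arrows l'
         \<or> (s, t) \<in> tree_arrows r'"
    for s t l r l' r'
  have ar: "arrs (branch_quiver x l r l' r') s t = of_bool (arrow l r l' r' s t)" for s t l r l' r'
    unfolding branch_quiver_def arrs_quiver_of arrow_def
    by (rule arg_cong[where f = of_bool]) (simp, argo)
  have nx: "x \<notin> set_tree l" "x \<notin> set_tree r" "x \<notin> set_tree l'" "x \<notin> set_tree r'"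
    and dt: "distinct_tree l" "distinct_tree r" "distinct_tree l'" "distinct_tree r'"
    and dj: "\<And>t. t \<in> set_tree l \<Longrightarrow> t \<notin> set_tree r \<and> t \<notin> set_tree l' \<and> t \<notin> set_tree r'"
     "\<And>t. t \<in> set_tree r \<Longrightarrow> t \<notin> set_tree l \<and> t \<notin> set_tree l' \<and> t \<notin> set_tree r'"
     "\<And>t. t \<in> set_tree l' \<Longrightarrow> t \<notin> set_tree r \<and> t \<notin> set_tree l \<and> t \<notin> set_tree r'"
     "\<And>t. t \<in> set_tree r' \<Longrightarrow> t \<notin> set_tree r \<and> t \<notin> set_tree l' \<and> t \<notin> set_tree l"
    using assms by auto
  note ta = tree_arrows_notin
  note nr = roots_notin
  have as: "(u, v) \<notin> tree_arrows t \<or> (v, u) \<notin> tree_arrows t" if "distinct_tree t" for t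
    using tree_arrows_asym[OF that] by blast
  have "u = x \<or> v = x \<or> u \<noteq> x \<and> v \<noteq> x" by argo
  then show "arrs (mutate x (branch_quiver x l r l' r')) u v = arrs (branch_quiver x r' l r l') u v"
  proof (elim disjE)
    assume "u = x"
    then have "arrow l r l' r' v u \<longleftrightarrow> arrow r' l r l' u v"
      unfolding arrow_def using nx by (simp add: nr ta)
    with \<open>u = x\<close> show ?thesis by (simp add: mutate_def ar)
  next
    assume "v = x"
    then have "arrow l r l' r' v u \<longleftrightarrow> arrow r' l r l' u v"
      unfolding arrow_def using nx by (auto simp add: nr ta)
    with \<open>v = x\<close> show ?thesis by (simp add: mutate_def ar)
  next
    assume n: "u \<noteq> x \<and> v \<noteq> x"
    let ?a = "arrow l r l' r'"
    have x1: "?a s x \<longleftrightarrow> s \<in> roots l \<or> s \<in> roots l'" "?a x s \<longleftrightarrow> s \<in> roots r \<or> s \<in> roots r'" for s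
      unfolding arrow_def using nx by (simp_all add: nr ta)
    have "\<not> (?a u v \<and> ?a u x \<and> ?a x v) \<and>
      (arrow r' l r l' u v \<longleftrightarrow> (?a u v \<or> ?a u x \<and> ?a x v) \<and> \<not> ?a v u \<and> \<not> (?a v x \<and> ?a x u))"
    proof (cases "u \<in> set_tree l \<union> set_tree r \<union> set_tree l' \<union> set_tree r'
        \<and> v \<in> set_tree l \<union> set_tree r \<union> set_tree l' \<union> set_tree r'")
      case False
      then have "u \<notin> set_tree l \<and> u \<notin> set_tree r \<and> u \<notin> set_tree l' \<and> u \<notin> set_tree r' \<or>
        v \<notin> set_tree l \<and> v \<notin> set_tree r \<and> v \<notin> set_tree l' \<and> v \<notin> set_tree r'" by simp
      then show ?thesis using n unfolding x1 by (elim disjE) (simp_all add: arrow_def nr ta)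
    next
      case True
      \<comment> \<open>Each of \<open>u\<close> and \<open>v\<close> lies in exactly one branch. In
        the sixteen cases most disjuncts of \<open>arrow\<close> vanish; for a common branch the
        asymmetry of its arrows is what is needed.\<close>
      let ?in = "\<lambda>s a b c d. s \<in> set_tree a \<and> s \<notin> set_tree b \<and> s \<notin> set_tree c \<and> s \<notin> set_tree d"
      let ?pos = "\<lambda>s. ?in s l r l' r' \<or> ?in s r l l' r' \<or> ?in s l' l r r' \<or> ?in s r' l r l'"
      have "?pos u" "?pos v" using True dj[of u] dj[of v] by blast+
      then show ?thesis using n as[OF dt(1)] as[OF dt(2)] as[OF dt(3)] as[OF dt(4)] unfolding x1
        by (elim disjE[of "_ \<and> _"] conjE) (simp_all add: arrow_def nr ta, blast+)
    qed
    then show ?thesis using n by (auto simp: mutate_def ar intro!: of_bool_cancel)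
  qed
qed (auto simp: mutate_def branch_quiver_def)

text \<open>One rotation per level moves the centre down the path to \<open>y\<close>.
  \<open>Q\<close> has two forms because the descent may enter a left or a right subtree. The other
  block at \<open>y\<close> contains the previous centre, hence is not empty.\<close>

lemma branch_quiver_reroot:
  assumes "\<langle>a, y, b\<rangle> \<in> subtrees t" and "distinct_branches x t s l r"
    and "Q = branch_quiver x t s l r \<or> Q = branch_quiver x s t l r"
  shows "\<exists>c d. distinct_branches y a b c d \<and> Q = branch_quiver y a b c d \<and> (c \<noteq> Leaf \<or> d \<noteq> Leaf)"
  using assms
proof (induction t arbitrary: x s l r)
  case (Node a' z b')
  define c d where "c = (if Q = branch_quiver x \<langle>a', z, b'\<rangle> s l r then s else \<langle>l, x, r\<rangle>)"
    and "d = (if Q = branch_quiver x \<langle>a', z, b'\<rangle> s l r then \<langle>l, x, r\<rangle> else s)"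
  note cd = c_def d_def
  have Q: "Q = branch_quiver z a' b' c d"
    using Node.prems(3) branch_quiver_rotate_left[of x a' z b' s l r]
        branch_quiver_rotate_right[of x s a' z b' l r]
    unfolding cd by (auto split: if_splits)
  have ne: "c \<noteq> Leaf \<or> d \<noteq> Leaf" by (simp add: cd)
  have dl: "distinct_branches z a' b' c d"
    using Node.prems(2) by (auto simp: cd Int_Un_distrib Int_Un_distrib2 Int_commute)
  then have dr: "distinct_branches z b' a' c d"
    by (auto simp: Int_Un_distrib Int_Un_distrib2 Int_commute)
  from Node.prems(1) consider "a = a'" "y = z" "b = b'" | "\<langle>a, y, b\<rangle> \<in> subtrees a'" |
      "\<langle>a, y, b\<rangle> \<in> subtrees b'" by auto
  then show ?case
  proof cases
    case 1
    then show ?thesis using dl Q ne by blast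
  next
    case 2
    show ?thesis by (rule Node.IH(1)[OF 2 dl]) (use Q in blast)
  next
    case 3
    show ?thesis by (rule Node.IH(2)[OF 3 dr]) (use Q in blast)
  qed
qed simp

lemma subtree_of_vertex: "y \<in> set_tree t \<Longrightarrow> \<exists>a b. \<langle>a, y, b\<rangle> \<in> subtrees t"
  by (induction t) auto

text \<open>Rerooting descends into either subtree of the first block; a vertex of the second block
  is reached after swapping the blocks.\<close>

lemma branch_quiver_at_vertex:
  assumes d: "distinct_branches x l r l' r'" and y: "y \<in> verts (branch_quiver x l r l' r')"
  shows "\<exists>a b c d. distinct_branches y a b c d \<and> branch_quiver x l r l' r' = branch_quiver y a b c
      d"
proof -
  have d': "distinct_branches x r l l' r'" "distinct_branches x l' r' l r"
      "distinct_branches x r' l' l r"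
    using d by (auto simp: Int_Un_distrib Int_Un_distrib2 Int_commute)
  note reroot = branch_quiver_reroot[of _ y _ _ _ _ _ _ "branch_quiver x l r l' r'"]
  consider "y = x" | "y \<in> set_tree l" | "y \<in> set_tree r" | "y \<in> set_tree l'" | "y \<in> set_tree r'"
    using y by (auto simp: branch_quiver_def)
  then show ?thesis
  proof cases
    case 1 then show ?thesis using d by blast
  next
    case 2 with reroot[OF _ d] subtree_of_vertex show ?thesis by metis
  next
    case 3 with reroot[OF _ d'(1)] subtree_of_vertex show ?thesis by metis
  next
    case 4 with reroot[OF _ d'(2)] subtree_of_vertex branch_quiver_swap show ?thesis by metis
  next
    case 5 with reroot[OF _ d'(3)] subtree_of_vertex branch_quiver_swap show ?thesis by metis
  qed
qed

section \<open>The mutation class of a linear quiver\<close>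

lemma mutation_reachable_branch_quiver:
  assumes "mutation_reachable Q R"
    and "\<exists>x l r l' r'. distinct_branches x l r l' r' \<and> Q = branch_quiver x l r l' r'"
  shows "\<exists>x l r l' r'. distinct_branches x l r l' r' \<and> R = branch_quiver x l r l' r'"
  using assms
proof induction
  case (mutate R k)
  \<comment> \<open>The quiver is recentred at the vertex \<open>k\<close> to be mutated, where the
    explicit formula applies.\<close>
  then obtain l r l' r' where d: "distinct_branches k l r l' r'" and R: "R = branch_quiver k l r
      l' r'"
    using branch_quiver_at_vertex by metis
  have "distinct_branches k r' l r l'" using d by auto
  then show ?case using mutate_branch_quiver[OF d] R by blast
qed

text \<open>The path, with whatever orientation, is built up as a tree with at most one child per
  node: the vertex numbered \<open>j\<close> becomes the only child of the vertex numbered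
  \<open>j + 1\<close>, on the left or on the right according to the direction of the arrow between
  them.\<close>

lemma dynkin_A_tree_quiver:
  assumes wf: "wf_quiver Q" and k: "k \<ge> 1" and g: "has_underlying_graph Q k (dynkin_A k)"
  shows "\<exists>t. distinct_tree t \<and> t \<noteq> Leaf \<and> Q = tree_quiver t"
proof -
  obtain \<phi> where bij: "bij_betw \<phi> (verts Q) {1..k}"
    and ed: "\<And>x y. x \<in> verts Q \<Longrightarrow> y \<in> verts Q \<Longrightarrow> edges Q x y = (if dynkin_A k (\<phi> x) (\<phi> y) then 1
        else 0)"
    using g unfolding has_underlying_graph_def by blast
  define X where "X = the_inv_into (verts Q) \<phi>"
  have X: "X i \<in> verts Q" "\<phi> (X i) = i" if "i \<in> {1..k}" for i
    using bij that f_the_inv_into_f_bij_betw[OF bij] bij_betwE[OF bij_betw_the_inv_into[OF bij]]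
    unfolding X_def by auto
  have Xphi: "X (\<phi> v) = v" if "v \<in> verts Q" for v
    using bij that unfolding X_def by (simp add: bij_betw_def the_inv_into_f_f)
  have inV: "x \<in> verts Q \<and> y \<in> verts Q" if "arrs Q x y > 0" for x y
    using wf that unfolding wf_quiver_def by blast
  have Xe: "edges Q (X i) (X j) = (if i = Suc j \<or> j = Suc i then 1 else 0)"
    if "i \<in> {1..k}" "j \<in> {1..k}" for i j
    using ed[of "X i" "X j"] X that by (auto simp: dynkin_A_def)
  \<comment> \<open>The invariant describes only the arrows among the first \<open>j\<close>
    vertices and records \<open>X j\<close> as the root, the place where the next vertex is
    attached.\<close>
  have "j \<ge> 1 \<Longrightarrow> j \<le> k \<Longrightarrow> \<exists>t. distinct_tree t \<and> set_tree t = X ` {1..j} \<and> roots t = {X j} \<and>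
     (\<forall>u\<in>X ` {1..j}. \<forall>v\<in>X ` {1..j}. arrs Q u v = of_bool ((u, v) \<in> tree_arrows t))" for j
  proof (induction j rule: nat_induct_at_least)
    case base
    have "edges Q (X 1) (X 1) = 0" using Xe[of 1 1] base by auto
    then show ?case by (intro exI[of _ "\<langle>Leaf, X 1, Leaf\<rangle>"]) (auto simp: edges_def)
  next
    case (Suc j)
    from Suc.IH[OF Suc_leD[OF Suc.prems]] obtain t
      where t: "distinct_tree t" "set_tree t = X ` {1..j}" "roots t = {X j}"
      and a: "\<forall>u\<in>X ` {1..j}. \<forall>v\<in>X ` {1..j}. arrs Q u v = of_bool ((u, v) \<in> tree_arrows t)"
      by (elim exE conjE)
    note a = a[THEN bspec, THEN bspec]
    let ?x = "X (Suc j)"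
    have ins: "X ` {1..Suc j} = insert ?x (X ` {1..j})" by (simp add: atLeastAtMostSuc_conv)
    have nx: "?x \<notin> X ` {1..j}"
    proof
      assume "?x \<in> X ` {1..j}"
      then obtain i where "i \<in> {1..j}" "X i = ?x" by auto
      then have "i = Suc j" using X(2)[of i] X(2)[of "Suc j"] Suc.prems by auto
      then show False using \<open>i \<in> {1..j}\<close> by auto
    qed
    have z: "arrs Q ?x ?x = 0" using Xe[of "Suc j" "Suc j"] Suc.prems by (auto simp: edges_def)
    have e1: "arrs Q ?x (X j) + arrs Q (X j) ?x = 1" using Xe[of "Suc j" j] Suc.hyps Suc.prems
        by (auto simp: edges_def)
    have e0: "arrs Q ?x v = 0" "arrs Q v ?x = 0" if v: "v \<in> X ` {1..j}" "v \<noteq> X j" for v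
    proof -
      obtain i where i: "i \<in> {1..j}" "v = X i" "i \<noteq> j" using v by blast
      have "edges Q ?x (X i) = 0" using Xe[of "Suc j" i] i Suc.prems by auto
      then show "arrs Q ?x v = 0" "arrs Q v ?x = 0" using i by (auto simp: edges_def)
    qed
    have ta: "\<And>s s'. s \<notin> X ` {1..j} \<Longrightarrow> (s, s') \<notin> tree_arrows t" "\<And>s s'. s \<notin> X ` {1..j}
        \<Longrightarrow> (s', s) \<notin> tree_arrows t"
      using tree_arrows_in[of _ _ t] t(2) by fastforce+
    have xj: "X j \<in> X ` {1..j}" using Suc.hyps by auto
    then have xj': "X j \<noteq> ?x" using nx by auto
    have arr: "arrs Q u v = of_bool ((u, v) \<in> B \<union> tree_arrows t)"
      if uv: "u \<in> X ` {1..Suc j}" "v \<in> X ` {1..Suc j}"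
        and B: "B = (if arrs Q (X j) ?x = 1 then {(X j, ?x)} else {(?x, X j)})" for u v B
    proof -
      consider "u = ?x" "v = ?x" | "u = ?x" "v \<noteq> ?x" "v = X j" | "u = X j" "u \<noteq> ?x" "v = ?x"
        | "u = ?x" "v \<in> X ` {1..j}" "v \<noteq> X j" | "u \<in> X ` {1..j}" "u \<noteq> X j" "v = ?x"
        | "u \<noteq> ?x" "v \<noteq> ?x" "u \<in> X ` {1..j}" "v \<in> X ` {1..j}"
        using uv unfolding ins by blast
      then show ?thesis
      proof cases
        case 1 with z xj' show ?thesis by (simp add: B ta(1)[OF nx])
      next
        case 2 with e1 xj' show ?thesis by (simp add: B ta(1)[OF nx])
      next
        case 3 with e1 xj' show ?thesis by (simp add: B ta(2)[OF nx])
      next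
        case 4 with e0[of v] xj' show ?thesis by (simp add: B ta(1)[OF nx])
      next
        case 5 with e0[of u] xj' show ?thesis by (simp add: B ta(2)[OF nx])
      next
        case 6 with a[of u v] show ?thesis by (simp add: B)
      qed
    qed
    show ?case
    proof (cases "arrs Q (X j) ?x = 1")
      case True
      have "distinct_tree \<langle>t, ?x, Leaf\<rangle>" "set_tree \<langle>t, ?x, Leaf\<rangle> = X ` {1..Suc j}"
        "roots \<langle>t, ?x, Leaf\<rangle> = {?x}" "tree_arrows \<langle>t, ?x, Leaf\<rangle> = {(X j, ?x)} \<union> tree_arrows t"
        using t nx ins by auto
      with arr[OF _ _ refl] True show ?thesis by (intro exI[of _ "\<langle>t, ?x, Leaf\<rangle>"]) (simp del:
          tree_arrows.simps roots.simps)
    next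
      case False
      have "distinct_tree \<langle>Leaf, ?x, t\<rangle>" "set_tree \<langle>Leaf, ?x, t\<rangle> = X ` {1..Suc j}"
        "roots \<langle>Leaf, ?x, t\<rangle> = {?x}" "tree_arrows \<langle>Leaf, ?x, t\<rangle> = {(?x, X j)} \<union> tree_arrows t"
        using t nx ins by auto
      with arr[OF _ _ refl] False show ?thesis by (intro exI[of _ "\<langle>Leaf, ?x, t\<rangle>"]) (simp del:
          tree_arrows.simps roots.simps)
    qed
  qed
  then obtain t where t: "distinct_tree t" "set_tree t = X ` {1..k}" "roots t = {X k}"
    and a: "\<forall>u\<in>X ` {1..k}. \<forall>v\<in>X ` {1..k}. arrs Q u v = of_bool ((u, v) \<in> tree_arrows t)"
    using k by (metis order_refl)
  note a = a[THEN bspec, THEN bspec]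
  have V: "verts Q = X ` {1..k}"
  proof
    show "verts Q \<subseteq> X ` {1..k}"
    proof
      fix v assume "v \<in> verts Q"
      then show "v \<in> X ` {1..k}" using Xphi[of v] bij_betwE[OF bij] by (metis image_eqI)
    qed
  qed (use X in blast)
  have "Q = tree_quiver t"
  proof (rule quiver_eqI)
    show "verts Q = verts (tree_quiver t)" using V t by simp
    fix u v :: 'a
    show "arrs Q u v = arrs (tree_quiver t) u v"
    proof (cases "u \<in> verts Q \<and> v \<in> verts Q")
      case True
      then show ?thesis using a[of u v] V by simp
    next
      case False
      then show ?thesis using inV[of u v] tree_arrows_in[of u v t] t(2) V by auto
    qed
  qed
  then show ?thesis using t by auto
qed

lemma mutation_type_A_branch_quiver:
  assumes "mutation_type_A k Q"
  shows "\<exists>x l r l' r'. distinct_branches x l r l' r' \<and> Q = branch_quiver x l r l' r'"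
proof -
  obtain Q0 where "k \<ge> 1" and Q0: "wf_quiver Q0" "has_underlying_graph Q0 k (dynkin_A k)"
      "mutation_reachable Q0 Q"
    using assms unfolding mutation_type_A_def has_mutation_type_def by blast
  then obtain t where t: "distinct_tree t" "t \<noteq> Leaf" "Q0 = tree_quiver t"
    using dynkin_A_tree_quiver by blast
  then obtain l x r where "t = \<langle>l, x, r\<rangle>" by (cases t) auto
  then have "distinct_branches x l r Leaf Leaf \<and> Q0 = branch_quiver x l r Leaf Leaf"
    using t by (auto simp: branch_quiver_Leaf)
  then show ?thesis using mutation_reachable_branch_quiver[OF Q0(3)] by blast
qed

section \<open>End vertices as roots of trees\<close>

lemma arrs_branch_quiver_centre:
  assumes "distinct_branches x l r l' r'"
  shows "arrs (branch_quiver x l r l' r') x y = of_bool (y \<in> roots r \<union> roots r')"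
    and "arrs (branch_quiver x l r l' r') y x = of_bool (y \<in> roots l \<union> roots l')"
  using assms by (simp_all add: branch_quiver_def tree_arrows_notin roots_notin)

lemma finite_roots: "finite (roots t)"
  by (cases t) auto

lemma valency_branch_quiver:
  assumes "distinct_branches x l r l' r'"
  shows "valency (branch_quiver x l r l' r') x = card (roots l \<union> roots r \<union> roots l' \<union> roots r')"
proof -
  let ?Q = "branch_quiver x l r l' r'"
  let ?N = "roots l \<union> roots r \<union> roots l' \<union> roots r'"
  have sub: "?N \<subseteq> verts ?Q"
    using roots_subset[of l] roots_subset[of r] roots_subset[of l'] roots_subset[of r']
    by (simp add: branch_quiver_def) blast
  have "(roots l \<union> roots l') \<inter> (roots r \<union> roots r') = {}"
    using assms roots_subset[of l] roots_subset[of r] roots_subset[of l'] roots_subset[of r']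
    by simp blast
  then have "edges ?Q x y = of_bool (y \<in> ?N)" for y
    by (auto simp: edges_def arrs_branch_quiver_centre[OF assms])
  then have "valency ?Q x = (\<Sum>y\<in>verts ?Q. of_bool (y \<in> ?N))"
    by (simp add: valency_def)
  also have "\<dots> = of_nat (card (verts ?Q \<inter> Collect (\<lambda>y. y \<in> ?N)))"
    by (rule sum_of_bool_eq) (simp_all add: branch_quiver_def)
  finally show ?thesis using sub by (simp only: Collect_mem_eq Int_absorb1 of_nat_id)
qed

text \<open>With both blocks nonempty the valency is at least two, so an end vertex would have
  valency exactly two and lie on a 3-cycle. Its two neighbours would then come from different
  blocks, between which there is no arrow.\<close>

lemma end_vertex_branch_quiver:
  assumes d: "distinct_branches x l r l' r'" and e: "end_vertex (branch_quiver x l r l' r') x"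
  shows "l = Leaf \<and> r = Leaf \<or> l' = Leaf \<and> r' = Leaf"
proof (rule ccontr)
  assume "\<not> ?thesis"
  then obtain u v where u: "u \<in> roots l \<union> roots r" and v: "v \<in> roots l' \<union> roots r'"
    by (metis UnI1 UnI2 insertI1 roots.simps(2) tree.exhaust)
  let ?Q = "branch_quiver x l r l' r'"
  let ?N = "roots l \<union> roots r \<union> roots l' \<union> roots r'"
  have u': "u \<in> set_tree l \<union> set_tree r" and v': "v \<in> set_tree l' \<union> set_tree r'"
    using u v roots_subset[of l] roots_subset[of r] roots_subset[of l'] roots_subset[of r']
        by blast+
  have "u \<noteq> x" "v \<noteq> x" using u' v' d by auto
  have dj: "(set_tree l \<union> set_tree r) \<inter> (set_tree l' \<union> set_tree r') = {}" using d by auto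
  have uv: "u \<noteq> v" using u' v' dj by blast
  have fin: "finite ?N" by (simp add: finite_roots)
  have val: "valency ?Q x = card ?N" by (rule valency_branch_quiver[OF d])
  have "card {u, v} \<le> card ?N" by (rule card_mono[OF fin]) (use u v in blast)
  then have "card ?N \<ge> 2" using uv by simp
  then obtain y z where c: "card ?N = 2" and yz: "oriented_3cycle ?Q x y z"
    using e val unfolding end_vertex_def by auto
  have N: "?N = {u, v}"
    by (rule card_subset_eq[symmetric]) (use fin u v uv c in auto)
  have "y \<in> ?N" "z \<in> ?N"
    using yz by (auto simp: oriented_3cycle_def arrs_branch_quiver_centre[OF d])
  then have yzN: "y \<in> {u, v}" "z \<in> {u, v}" unfolding N by simp_all
  have "u \<notin> set_tree l' \<union> set_tree r'" "v \<notin> set_tree l \<union> set_tree r" using u' v' dj by blast+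
  then have "arrs ?Q u v = 0" "arrs ?Q v u = 0"
    using \<open>u \<noteq> x\<close> \<open>v \<noteq> x\<close> by (simp_all add: branch_quiver_def tree_arrows_notin roots_notin)
  moreover have "distinct_tree \<langle>l, x, r\<rangle>" "distinct_tree \<langle>l', x, r'\<rangle>" using d by auto
  then have "arrs ?Q s s = 0" for s
    by (simp add: branch_quiver_def tree_arrows_irrefl del: tree_arrows.simps inorder.simps)
  ultimately show False using yz yzN by (auto simp: oriented_3cycle_def)
qed

text \<open>Recentre at \<open>f\<close>: one of the two blocks there is empty, and the other one is
  a tree with root \<open>f\<close>.\<close>

lemma mutation_type_A_end_vertex:
  assumes "mutation_type_A k Q" and e: "end_vertex Q f"
  shows "\<exists>t. distinct_tree t \<and> roots t = {f} \<and> Q = tree_quiver t"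
proof -
  have "f \<in> verts Q" using e by (simp add: end_vertex_def)
  then obtain l r l' r' where d: "distinct_branches f l r l' r'" and Q: "Q = branch_quiver f l r
      l' r'"
    using mutation_type_A_branch_quiver[OF assms(1)] branch_quiver_at_vertex by metis
  from end_vertex_branch_quiver[OF d] e Q consider "l = Leaf" "r = Leaf" | "l' = Leaf" "r' = Leaf"
      by auto
  then show ?thesis
  proof cases
    case 1
    then show ?thesis using d Q
      by (intro exI[of _ "\<langle>l', f, r'\<rangle>"]) (simp add: branch_quiver_swap[of f Leaf]
          branch_quiver_Leaf)
  next
    case 2
    then show ?thesis using d Q
      by (intro exI[of _ "\<langle>l, f, r\<rangle>"]) (simp add: branch_quiver_Leaf)
  qed
qed

text \<open>Away from the root, the block joining \<open>e\<close> to its parent is nonempty, so the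
  block formed by its children must be empty.\<close>

lemma end_vertex_tree_quiver:
  assumes d: "distinct_tree t" and st: "\<langle>a, e, b\<rangle> \<in> subtrees t" and e: "end_vertex (tree_quiver t)
      e" "roots t \<noteq> {e}"
  shows "a = Leaf \<and> b = Leaf"
proof -
  obtain l x r where t: "t = \<langle>l, x, r\<rangle>" using st by (cases t) auto
  have d': "distinct_branches x l r Leaf Leaf" "distinct_branches x r l Leaf Leaf" using d t by auto
  have "\<langle>a, e, b\<rangle> \<in> subtrees l \<or> \<langle>a, e, b\<rangle> \<in> subtrees r" using st e t by auto
  then obtain c d where "distinct_branches e a b c d" "branch_quiver x l r Leaf Leaf =
      branch_quiver e a b c d" "c \<noteq> Leaf \<or> d \<noteq> Leaf"
    using branch_quiver_reroot[OF _ d'(1)] branch_quiver_reroot[OF _ d'(2)] by metis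
  then show ?thesis using end_vertex_branch_quiver e(1) t branch_quiver_Leaf by metis
qed

section \<open>Strings and the type \<open>A\<close> labelling procedure\<close>

lemma roots_in: "x \<in> roots t \<Longrightarrow> x \<in> set_tree t"
  by (rule subsetD[OF roots_subset])

lemma edges_quiver_of: "edges (quiver_of V A) u v > 0 \<longleftrightarrow> (u, v) \<in> A \<or> (v, u) \<in> A"
  by (auto simp: edges_def)

lemma edges_commute: "edges Q u v = edges Q v u"
  by (simp add: edges_def)

lemma three_cycle_rev: "three_cycle Q x y z \<Longrightarrow> three_cycle Q z y x"
  by (auto simp: three_cycle_def oriented_3cycle_def)

lemma three_cycle_edges:
  "three_cycle Q x y z \<Longrightarrow> edges Q x y > 0 \<and> edges Q y z > 0 \<and> edges Q x z > 0"
  by (auto simp: three_cycle_def oriented_3cycle_def edges_def)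

section \<open>Subtrees and how they are attached\<close>

lemma subtrees_self: "t \<in> subtrees t"
  by (cases t) auto

lemma subtrees_trans: "s \<in> subtrees t \<Longrightarrow> t \<in> subtrees u \<Longrightarrow> s \<in> subtrees u"
  by (induction u) auto

lemma set_tree_subtree: "s \<in> subtrees t \<Longrightarrow> set_tree s \<subseteq> set_tree t"
  by (induction t) auto

lemma distinct_subtree: "s \<in> subtrees t \<Longrightarrow> distinct_tree t \<Longrightarrow> distinct_tree s"
  by (induction t) auto

lemma subtree_with_root:
  assumes "s \<in> subtrees t" "distinct_tree t" "u \<in> roots t" "u \<in> set_tree s"
  shows "s = t"
proof (cases t)
  case (Node l x r)
  have "s \<notin> subtrees l" "s \<notin> subtrees r"
    using assms(2-4) Node set_tree_subtree[of s l] set_tree_subtree[of s r] by auto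
  then show ?thesis using assms(1) Node by auto
qed (use assms in auto)

lemma tree_arrows_child:
  assumes "distinct_tree \<langle>l, x, r\<rangle>"
  shows "u \<in> set_tree l \<Longrightarrow> (u, v) \<in> tree_arrows \<langle>l, x, r\<rangle> \<longleftrightarrow> u \<in> roots l \<and> v = x
      \<or> (u, v) \<in> tree_arrows l"
    and "u \<in> set_tree l \<Longrightarrow> (v, u) \<in> tree_arrows \<langle>l, x, r\<rangle> \<longleftrightarrow> u \<in> roots l \<and> v \<in> roots r
        \<or> (v, u) \<in> tree_arrows l"
    and "u \<in> set_tree r \<Longrightarrow> (u, v) \<in> tree_arrows \<langle>l, x, r\<rangle> \<longleftrightarrow> u \<in> roots r \<and> v \<in> roots l
        \<or> (u, v) \<in> tree_arrows r"
    and "u \<in> set_tree r \<Longrightarrow> (v, u) \<in> tree_arrows \<langle>l, x, r\<rangle> \<longleftrightarrow> u \<in> roots r \<and> v = x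
        \<or> (v, u) \<in> tree_arrows r"
proof -
  have L: "u \<notin> set_tree r \<and> u \<noteq> x" if "u \<in> set_tree l" using assms that by auto
  have R: "u \<notin> set_tree l \<and> u \<noteq> x" if "u \<in> set_tree r" using assms that by auto
  show "u \<in> set_tree l \<Longrightarrow> (u, v) \<in> tree_arrows \<langle>l, x, r\<rangle> \<longleftrightarrow> u \<in> roots l \<and> v = x
      \<or> (u, v) \<in> tree_arrows l"
    and "u \<in> set_tree l \<Longrightarrow> (v, u) \<in> tree_arrows \<langle>l, x, r\<rangle> \<longleftrightarrow> u \<in> roots l \<and> v \<in> roots r
        \<or> (v, u) \<in> tree_arrows l"
    using L by (simp_all add: tree_arrows_notin roots_notin conj_commute)
  show "u \<in> set_tree r \<Longrightarrow> (u, v) \<in> tree_arrows \<langle>l, x, r\<rangle> \<longleftrightarrow> u \<in> roots r \<and> v \<in> roots l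
      \<or> (u, v) \<in> tree_arrows r"
    and "u \<in> set_tree r \<Longrightarrow> (v, u) \<in> tree_arrows \<langle>l, x, r\<rangle> \<longleftrightarrow> u \<in> roots r \<and> v = x
        \<or> (v, u) \<in> tree_arrows r"
    using R by (simp_all add: tree_arrows_notin roots_notin conj_commute)
qed

lemma tree_arrows_subtree:
  assumes "s \<in> subtrees t" "distinct_tree t" "u \<in> set_tree s" "v \<in> set_tree s"
  shows "(u, v) \<in> tree_arrows t \<longleftrightarrow> (u, v) \<in> tree_arrows s"
  using assms
proof (induction t)
  case (Node l x r)
  from Node.prems(1) consider "s = \<langle>l, x, r\<rangle>" | "s \<in> subtrees l" | "s \<in> subtrees r" by auto
  then show ?case
  proof cases
    case 2
    then have uv: "u \<in> set_tree l" "v \<in> set_tree l" using Node.prems set_tree_subtree by blast+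
    have "v \<noteq> x" using uv Node.prems(2) by auto
    then show ?thesis
      using Node.IH(1)[OF 2] tree_arrows_child(1)[OF Node.prems(2) uv(1)] Node.prems by auto
  next
    case 3
    then have uv: "u \<in> set_tree r" "v \<in> set_tree r" using Node.prems set_tree_subtree by blast+
    have "v \<notin> roots l" using uv Node.prems(2) roots_subset[of l] by auto
    then show ?thesis
      using Node.IH(2)[OF 3] tree_arrows_child(3)[OF Node.prems(2) uv(1)] Node.prems by auto
  qed simp
qed simp

text \<open>Of a subtree only the root is joined to its parent and its sibling; this is what
  confines strings to subtrees.\<close>

lemma tree_arrows_leave_subtree:
  assumes "s \<in> subtrees t" "distinct_tree t" "u \<in> set_tree s" "v \<notin> set_tree s"
    and "(u, v) \<in> tree_arrows t \<or> (v, u) \<in> tree_arrows t"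
  shows "u \<in> roots s"
  using assms
proof (induction t)
  case (Node l x r)
  from Node.prems(1) consider "s = \<langle>l, x, r\<rangle>" | "s \<in> subtrees l" | "s \<in> subtrees r" by auto
  then show ?case
  proof cases
    case 1
    then show ?thesis using Node.prems(4,5) tree_arrows_in[of _ _ s] by blast
  next
    case 2
    then have u: "u \<in> set_tree l" using Node.prems set_tree_subtree by blast
    have d: "distinct_tree l" using Node.prems(2) by simp
    from Node.prems(5) have "u \<in> roots l \<or> (u, v) \<in> tree_arrows l \<or> (v, u) \<in> tree_arrows l"
      using tree_arrows_child(1,2)[OF Node.prems(2) u] by blast
    then show ?thesis
      using Node.IH(1)[OF 2 d Node.prems(3,4)] subtree_with_root[OF 2 d _ Node.prems(3)] by blast
  next
    case 3
    then have u: "u \<in> set_tree r" using Node.prems set_tree_subtree by blast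
    have d: "distinct_tree r" using Node.prems(2) by simp
    from Node.prems(5) have "u \<in> roots r \<or> (u, v) \<in> tree_arrows r \<or> (v, u) \<in> tree_arrows r"
      using tree_arrows_child(3,4)[OF Node.prems(2) u] by blast
    then show ?thesis
      using Node.IH(2)[OF 3 d Node.prems(3,4)] subtree_with_root[OF 3 d _ Node.prems(3)] by blast
  qed
qed simp

text \<open>Leaves open which child is on the left: with \<open>s\<close> one child and
  \<open>s'\<close> its sibling, one argument serves both sides.\<close>

definition node_of :: "'a \<Rightarrow> 'a tree \<Rightarrow> 'a tree \<Rightarrow> 'a tree \<Rightarrow> bool" where
  "node_of x s s' t \<longleftrightarrow> t = \<langle>s, x, s'\<rangle> \<or> t = \<langle>s', x, s\<rangle>"

lemma node_of_swap: "node_of x s s' t \<Longrightarrow> node_of x s' s t"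
  by (auto simp: node_of_def)

lemma node_of_simps:
  assumes "node_of x s s' t"
  shows "set_tree t = insert x (set_tree s \<union> set_tree s')" "roots t = {x}"
    "s \<in> subtrees t" "size t = size s + size s' + 1"
  using assms by (auto simp: node_of_def subtrees_self)

lemma node_of_distinct:
  assumes "node_of x s s' t" "distinct_tree t"
  shows "x \<notin> set_tree s" "set_tree s \<inter> set_tree s' = {}" "distinct_tree s"
  using assms by (auto simp: node_of_def)

lemma node_of_triangle:
  assumes "node_of x s s' t" "t \<in> subtrees T" "distinct_tree T" "y \<in> roots s" "z \<in> roots s'"
  shows "three_cycle (tree_quiver T) x y z" "three_cycle (tree_quiver T) y x z"
proof -
  have "x \<in> set_tree t" "y \<in> set_tree t" "z \<in> set_tree t"
    using assms(4,5) roots_subset[of s] roots_subset[of s'] node_of_simps[OF assms(1)] by auto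
  then have "(u, v) \<in> tree_arrows T \<longleftrightarrow> (u, v) \<in> tree_arrows t" if "u \<in> {x, y, z}" "v \<in> {x, y, z}"
      for u v
    using that tree_arrows_subtree[OF assms(2,3)] by blast
  moreover from assms(1) have "(y, x) \<in> tree_arrows t \<and> (x, z) \<in> tree_arrows t
      \<and> (z, y) \<in> tree_arrows t \<or>
    (z, x) \<in> tree_arrows t \<and> (x, y) \<in> tree_arrows t \<and> (y, z) \<in> tree_arrows t"
    using assms(4,5) unfolding node_of_def by (elim disjE) simp_all
  ultimately show "three_cycle (tree_quiver T) x y z" "three_cycle (tree_quiver T) y x z"
    by (auto simp: three_cycle_def oriented_3cycle_def)
qed

lemma node_of_leave_child:
  assumes n: "node_of x s s' t" and t: "t \<in> subtrees T" "distinct_tree T"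
    and u: "u \<in> set_tree s" and v: "v \<notin> set_tree s" and e: "edges (tree_quiver T) u v > 0"
  shows "u \<in> roots s" "v = x \<or> v \<in> roots s'"
proof -
  have dt: "distinct_tree t" using distinct_subtree t by blast
  have e': "(u, v) \<in> tree_arrows T \<or> (v, u) \<in> tree_arrows T" using e by (simp add: edges_quiver_of)
  have "s \<in> subtrees T" using node_of_simps(3)[OF n] subtrees_trans t by blast
  then show ur: "u \<in> roots s" using tree_arrows_leave_subtree[OF _ t(2) u v e'] by blast
  have ut: "u \<in> set_tree t" using u node_of_simps(1)[OF n] by blast
  have "v \<in> set_tree t"
  proof (rule ccontr)
    assume "v \<notin> set_tree t"
    then have "u = x" using tree_arrows_leave_subtree[OF t ut _ e'] node_of_simps(2)[OF n] by simp
    then show False using u node_of_distinct(1)[OF n dt] by simp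
  qed
  then have "(u, v) \<in> tree_arrows t \<or> (v, u) \<in> tree_arrows t"
    using tree_arrows_subtree[OF t] ut e' by blast
  with n show "v = x \<or> v \<in> roots s'"
    using tree_arrows_child[of s x s' u v] tree_arrows_child[of s' x s u v] u v dt
        tree_arrows_in[of _ _ s]
    unfolding node_of_def by blast
qed

lemma node_of_root_edge:
  assumes n: "node_of x s s' t" and t: "t \<in> subtrees T" "distinct_tree T"
    and v: "v \<in> set_tree t" and e: "edges (tree_quiver T) x v > 0"
  shows "v \<in> roots s \<union> roots s'"
proof -
  have dt: "distinct_tree t" using distinct_subtree t by blast
  have e': "(x, v) \<in> tree_arrows T \<or> (v, x) \<in> tree_arrows T" using e by (simp add: edges_quiver_of)
  then have "v \<noteq> x" using tree_arrows_irrefl[OF t(2)] by blast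
  then consider "v \<in> set_tree s" | "v \<in> set_tree s'" using v node_of_simps(1)[OF n] by blast
  then show ?thesis
  proof cases
    case 1
    then show ?thesis
      using node_of_leave_child(1)[OF n t 1 _ e[unfolded edges_commute[of _ x]]]
          node_of_distinct(1)[OF n dt] by blast
  next
    case 2
    note n' = node_of_swap[OF n]
    show ?thesis
      using node_of_leave_child(1)[OF n' t 2 _ e[unfolded edges_commute[of _ x]]]
          node_of_distinct(1)[OF n' dt] by blast
  qed
qed

section \<open>Strings as descending paths\<close>

lemma is_string_single: "is_string Q [x] \<longleftrightarrow> x \<in> verts Q"
  by (simp add: is_string_def)

lemma is_string_Cons_Cons:
  "is_string Q (x # y # p) \<longleftrightarrow> x \<in> verts Q \<and> edges Q x y > 0 \<and>
     (p \<noteq> [] \<longrightarrow> x \<noteq> hd p \<and> \<not> three_cycle Q x y (hd p)) \<and> is_string Q (y # p)"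
  by (cases p) (auto simp: is_string_def All_less_Suc2)

lemma is_string_rev:
  assumes "is_string Q p"
  shows "is_string Q (rev p)"
proof -
  let ?n = "length p"
  have 1: "edges Q (p ! i) (p ! Suc i) > 0" if "Suc i < ?n" for i using assms that
      by (auto simp: is_string_def)
  have 2: "p ! i \<noteq> p ! Suc (Suc i) \<and> \<not> three_cycle Q (p ! i) (p ! Suc i) (p ! Suc (Suc i))" if
      "Suc (Suc i) < ?n" for i
    using assms that by (auto simp: is_string_def)
  have "edges Q (rev p ! i) (rev p ! Suc i) > 0" if i: "Suc i < ?n" for i
  proof -
    have "rev p ! Suc i = p ! (?n - Suc (Suc i))" "rev p ! i = p ! Suc (?n - Suc (Suc i))"
      using i by (simp_all add: rev_nth Suc_diff_Suc)
    then show ?thesis using 1[of "?n - Suc (Suc i)"] i by (simp add: edges_commute)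
  qed
  moreover have "rev p ! i \<noteq> rev p ! Suc (Suc i) \<and> \<not> three_cycle Q (rev p ! i) (rev p ! Suc i)
      (rev p ! Suc (Suc i))"
    if i: "Suc (Suc i) < ?n" for i
  proof -
    let ?j = "?n - Suc (Suc (Suc i))"
    have "rev p ! Suc (Suc i) = p ! ?j" "rev p ! Suc i = p ! Suc ?j" "rev p ! i = p ! Suc (Suc ?j)"
      using i by (simp_all add: rev_nth Suc_diff_Suc)
    then show ?thesis using 2[of ?j] i three_cycle_rev by fastforce
  qed
  ultimately show ?thesis using assms by (auto simp: is_string_def)
qed

text \<open>Induction on this predicate runs along the path from its lower end upwards, the
  direction in which labels are assigned.\<close>

inductive descends :: "'a tree \<Rightarrow> 'a list \<Rightarrow> bool" where
  descends_root: "x \<in> roots t \<Longrightarrow> descends t [x]"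
| descends_child: "node_of x s s' t \<Longrightarrow> descends s ps \<Longrightarrow> descends t (x # ps)"

lemma descends_props:
  "descends t ps \<Longrightarrow> ps \<noteq> [] \<and> hd ps \<in> roots t \<and> set ps \<subseteq> set_tree t"
proof (induction rule: descends.induct)
  case (descends_root x t)
  then show ?case by (simp add: roots_in)
next
  case (descends_child x s s' t ps)
  then show ?case using node_of_simps[OF descends_child(1)] by auto
qed

lemma descends_distinct: "descends t ps \<Longrightarrow> distinct_tree t \<Longrightarrow> distinct ps"
proof (induction rule: descends.induct)
  case (descends_child x s s' t ps)
  then show ?case
    using node_of_distinct[OF descends_child(1)] descends_props[OF descends_child(2)] by auto
qed simp

text \<open>A string leaving the root of a subtree downwards can never turn: going back up is either
  backtracking or two consecutive arrows of a 3-cycle.\<close>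

lemma string_descends:
  assumes "distinct_tree T" "is_string (tree_quiver T) ps" "t \<in> subtrees T" "ps \<noteq> []"
      "hd ps \<in> roots t"
    and "tl ps \<noteq> [] \<Longrightarrow> hd (tl ps) \<in> set_tree t"
  shows "descends t ps"
  using assms(2-)
proof (induction ps arbitrary: t)
  case (Cons x ps t)
  show ?case
  proof (cases ps)
    case Nil
    then show ?thesis using Cons.prems by (auto intro: descends_root)
  next
    case (Cons y ps')
    note st = Cons.prems(1)[unfolded Cons is_string_Cons_Cons]
    obtain l r where t: "t = \<langle>l, x, r\<rangle>" using Cons.prems(4) by (cases t) auto
    have "node_of x l r t" by (simp add: node_of_def t)
    then have "y \<in> roots l \<union> roots r"
      using node_of_root_edge[OF _ Cons.prems(2) assms(1)] st Cons.prems(5) Cons by auto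
    then obtain s s' where n: "node_of x s s' t" and y: "y \<in> roots s" by (auto simp: node_of_def t)
    have "hd ps' \<in> set_tree s" if "ps' \<noteq> []"
    proof (rule ccontr)
      assume "hd ps' \<notin> set_tree s"
      moreover have "y \<in> set_tree s" using y by (rule roots_in)
      moreover have "edges (tree_quiver T) y (hd ps') > 0"
        using st that by (cases ps') (auto simp: is_string_Cons_Cons)
      ultimately have "hd ps' = x \<or> hd ps' \<in> roots s'"
        using node_of_leave_child(2)[OF n Cons.prems(2) assms(1)] by blast
      then show False using st that node_of_triangle(1)[OF n Cons.prems(2) assms(1) y] by metis
    qed
    moreover have "s \<in> subtrees T" using subtrees_trans[OF node_of_simps(3)[OF n] Cons.prems(2)] .
    ultimately have "descends s ps" using Cons.IH[of s] st y Cons by auto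
    then show ?thesis using n by (rule descends_child[rotated])
  qed
qed simp

text \<open>Straight descent never backtracks, by distinctness, and never uses two arrows of one
  3-cycle, since a node is not joined to its grandchildren.\<close>

lemma string_from_root_exists:
  assumes "distinct_tree T" "t \<in> subtrees T" "v \<in> set_tree t" "z \<in> roots t"
  shows "\<exists>p. string_from_to (tree_quiver T) z v p \<and> set p \<subseteq> set_tree t"
  using assms(2-)
proof (induction t arbitrary: z)
  case (Node l x r)
  have zx: "z = x" using Node.prems by simp
  have dt: "distinct_tree \<langle>l, x, r\<rangle>" using distinct_subtree Node.prems(1) assms(1) by blast
  have xT: "x \<in> set_tree T" using set_tree_subtree[OF Node.prems(1)] by simp
  have ext: "\<exists>p. string_from_to (tree_quiver T) z v p \<and> set p \<subseteq> set_tree \<langle>l, x, r\<rangle>"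
    if n: "node_of x s s' \<langle>l, x, r\<rangle>" and y: "y \<in> roots s"
      and p: "string_from_to (tree_quiver T) y v p" "set p \<subseteq> set_tree s" for s s' y p
  proof -
    obtain p' where p': "p = y # p'" using p(1) by (cases p) (auto simp: string_from_to_def
        is_string_def)
    have sx: "s \<in> subtrees \<langle>l, x, r\<rangle>" by (rule node_of_simps(3)[OF n])
    have yx: "y \<in> set_tree s" using y by (rule roots_in)
    have "(x, y) \<in> tree_arrows \<langle>l, x, r\<rangle> \<or> (y, x) \<in> tree_arrows \<langle>l, x, r\<rangle>"
      using n y by (auto simp: node_of_def)
    moreover have "x \<in> set_tree \<langle>l, x, r\<rangle>" "y \<in> set_tree \<langle>l, x, r\<rangle>" using yx set_tree_subtree[OF
        sx] by auto
    ultimately have e: "edges (tree_quiver T) x y > 0"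
      using tree_arrows_subtree[OF Node.prems(1) assms(1)] by (simp add: edges_quiver_of)
    have "x \<noteq> hd p' \<and> \<not> three_cycle (tree_quiver T) x y (hd p')" if "p' \<noteq> []"
    proof -
      have h: "hd p' \<in> set_tree s" using p(2) p' that by (auto simp: in_mono)
      then have "x \<noteq> hd p'" using node_of_distinct(1)[OF n dt] by blast
      moreover have "\<not> three_cycle (tree_quiver T) x y (hd p')"
      proof
        assume "three_cycle (tree_quiver T) x y (hd p')"
        then have e2: "edges (tree_quiver T) (hd p') x > 0" "edges (tree_quiver T) y (hd p') > 0"
          using three_cycle_edges edges_commute by metis+
        then have "hd p' \<in> roots s"
          using node_of_leave_child(1)[OF n Node.prems(1) assms(1) h] node_of_distinct(1)[OF n dt]
              by blast
        then have "hd p' = y" using y roots_unique by metis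
        then show False using e2(2) tree_arrows_irrefl[OF assms(1)] by (simp add: edges_quiver_of)
      qed
      ultimately show ?thesis by blast
    qed
    then have "string_from_to (tree_quiver T) z v (x # p)"
      using p(1) e xT zx unfolding string_from_to_def p' is_string_Cons_Cons by auto
    moreover have "set (x # p) \<subseteq> set_tree \<langle>l, x, r\<rangle>" using p(2) set_tree_subtree[OF sx] by auto
    ultimately show ?thesis by blast
  qed
  have sub: "l \<in> subtrees T" "r \<in> subtrees T"
    using subtrees_trans[OF _ Node.prems(1)] subtrees_self by auto
  have n: "node_of x l r \<langle>l, x, r\<rangle>" "node_of x r l \<langle>l, x, r\<rangle>" by (auto simp: node_of_def)
  have root: "\<exists>y. y \<in> roots s" if "v \<in> set_tree s" for s using that by (cases s) auto
  from Node.prems(2) consider "v = x" | "v \<in> set_tree l" | "v \<in> set_tree r" by auto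
  then show ?case
  proof cases
    case 1
    then have "string_from_to (tree_quiver T) z v [x]"
      using xT zx by (simp add: string_from_to_def is_string_single)
    then show ?thesis by (intro exI[of _ "[x]"]) simp
  next
    case 2
    then show ?thesis using root[OF 2] Node.IH(1)[OF sub(1) 2] ext[OF n(1)] by blast
  next
    case 3
    then show ?thesis using root[OF 3] Node.IH(2)[OF sub(2) 3] ext[OF n(2)] by blast
  qed
qed simp

text \<open>A string from \<open>z\<close> that avoids \<open>y\<close> and \<open>x\<close> cannot
  leave \<open>s'\<close>, since the only exits lead from \<open>z\<close> to the sibling
  \<open>y\<close> and the parent \<open>x\<close>; conversely the descending strings inside
  \<open>s'\<close> reach all of it.\<close>

lemma rooted_subquiver_sibling:
  assumes n: "node_of x s s' t" and t: "t \<in> subtrees T" "distinct_tree T" and y: "y \<in> roots s"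
      and z: "z \<in> roots s'"
  shows "rooted_subquiver (tree_quiver T) z y x = tree_quiver s'"
proof -
  note n' = node_of_swap[OF n]
  have dt: "distinct_tree t" using distinct_subtree t by blast
  have s': "s' \<in> subtrees T" using subtrees_trans[OF node_of_simps(3)[OF n'] t(1)] .
  have xs: "x \<notin> set_tree s'" "y \<notin> set_tree s'"
    using node_of_distinct[OF n' dt] y roots_subset[of s] by auto
  have "{v. \<exists>p. string_from_to (tree_quiver T) z v p \<and> y \<notin> set p \<and> x \<notin> set p} = set_tree s'"
  proof (intro equalityI subsetI)
    fix v assume "v \<in> {v. \<exists>p. string_from_to (tree_quiver T) z v p \<and> y \<notin> set p \<and> x \<notin> set p}"
    then obtain p where p: "string_from_to (tree_quiver T) z v p" "y \<notin> set p" "x \<notin> set p" by blast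
    then obtain p' where p': "p = z # p'" by (cases p) (auto simp: string_from_to_def is_string_def)
    have "hd p' \<in> set_tree s'" if ne: "p' \<noteq> []"
    proof (rule ccontr)
      assume h: "hd p' \<notin> set_tree s'"
      have "edges (tree_quiver T) z (hd p') > 0"
        using p(1) p' ne by (cases p') (auto simp: string_from_to_def is_string_Cons_Cons)
      then have "hd p' = x \<or> hd p' \<in> roots s"
        using node_of_leave_child(2)[OF n' t roots_in[OF z] h] by blast
      then have "hd p' = x \<or> hd p' = y" using y roots_unique by metis
      moreover have "hd p' \<in> set p" using p' ne by simp
      ultimately show False using p(2,3) by metis
    qed
    then have "descends s' p"
      using string_descends[OF t(2) _ s', of p] p(1) p' z by (auto simp: string_from_to_def)
    moreover have "v \<in> set p" using p(1) p' by (auto simp: string_from_to_def)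
    ultimately show "v \<in> set_tree s'" using descends_props by blast
  next
    fix v assume "v \<in> set_tree s'"
    then show "v \<in> {v. \<exists>p. string_from_to (tree_quiver T) z v p \<and> y \<notin> set p \<and> x \<notin> set p}"
      using string_from_root_exists[OF t(2) s' _ z] xs by blast
  qed
  then have "rooted_subquiver (tree_quiver T) z y x = full_subquiver (tree_quiver T) (set_tree s')"
    by (simp only: rooted_subquiver_def)
  also have "\<dots> = tree_quiver s'"
  proof (rule quiver_eqI)
    show "verts (full_subquiver (tree_quiver T) (set_tree s')) = verts (tree_quiver s')"
      using set_tree_subtree[OF s'] by (auto simp: full_subquiver_def)
    show "arrs (full_subquiver (tree_quiver T) (set_tree s')) u v = arrs (tree_quiver s') u v"
        for u v
      using tree_arrows_subtree[OF s' t(2), of u v] tree_arrows_in[of u v s']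
      by (cases "u \<in> set_tree s' \<and> v \<in> set_tree s'") (auto simp: full_subquiver_def)
  qed
  finally show ?thesis .
qed

section \<open>Postorder labellings\<close>

text \<open>The offset \<open>d\<close> is the number of labels already used: the labels in
  \<open>t\<close> are \<open>d + 1\<close> up to \<open>d + size t\<close>, the root receiving the
  largest. Either child may come first, since the procedure follows the string and not the
  left-right order.\<close>

fun postorder_labelled :: "'a tree \<Rightarrow> nat \<Rightarrow> ('a \<Rightarrow> nat) \<Rightarrow> bool" where
  "postorder_labelled Leaf d L \<longleftrightarrow> True"
| "postorder_labelled (Node l x r) d L \<longleftrightarrow> L x = d + size l + size r + 1 \<and>
     (postorder_labelled l d L \<and> postorder_labelled r (d + size l) L \<or>
      postorder_labelled r d L \<and> postorder_labelled l (d + size r) L)"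

lemma postorder_labelled_node_of:
  assumes "node_of x s s' t" "postorder_labelled s d L" "postorder_labelled s' (d + size s) L"
    "L x = d + size s + size s' + 1"
  shows "postorder_labelled t d L"
  using assms by (auto simp: node_of_def)

lemma postorder_labelled_root: "postorder_labelled t d L \<Longrightarrow> x \<in> roots t \<Longrightarrow> L x = d + size t"
  by (cases t) auto

lemma postorder_labelled_shift:
  "postorder_labelled t d L' \<Longrightarrow> (\<And>v. v \<in> set_tree t \<Longrightarrow> L v = c + L' v) \<Longrightarrow> postorder_labelled t (c +
      d) L"
proof (induction t arbitrary: d)
  case (Node l x r)
  have "L x = c + L' x" using Node.prems(2) by simp
  moreover have "postorder_labelled l (c + d') L" if "postorder_labelled l d' L'" for d'
    using Node.IH(1)[OF that] Node.prems(2) by simp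
  moreover have "postorder_labelled r (c + d') L" if "postorder_labelled r d' L'" for d'
    using Node.IH(2)[OF that] Node.prems(2) by simp
  ultimately show ?case using Node.prems(1) by (auto simp: add.assoc)
qed simp

text \<open>Read backwards, \<open>p\<close> descends from the root \<open>f\<close> to the
  childless node \<open>e\<close>. Going up again, a node of \<open>p\<close> is labelled after the
  subtree containing the earlier part of \<open>p\<close> and after the sibling subtree, if present,
  which is exactly the rooted subquiver at the complementary vertex.\<close>

lemma walk_postorder_labelled:
  assumes d: "distinct_tree T" and p: "string_from_to (tree_quiver T) e f p" and f: "f \<in> roots T"
    and e: "\<And>a b. \<langle>a, e, b\<rangle> \<in> subtrees T \<Longrightarrow> a = Leaf \<and> b = Leaf" and Le: "L e = 1"
    and step1: "\<And>i. Suc i < length p \<Longrightarrow> \<nexists>y z. primary_rel (tree_quiver T) p (p ! i) y z \<Longrightarrow>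
        L (p ! Suc i) = L (p ! i) + 1"
    and step2: "\<And>i y z s. Suc i < length p \<Longrightarrow> primary_rel (tree_quiver T) p (p ! i) y z \<Longrightarrow>
        s \<in> subtrees T \<Longrightarrow> z \<in> roots s \<Longrightarrow> rooted_subquiver (tree_quiver T) z (p ! i) y = tree_quiver
            s \<Longrightarrow>
        postorder_labelled s (L (p ! i)) L \<and> L (p ! Suc i) = L (p ! i) + size s + 1"
  shows "postorder_labelled T 0 L"
proof -
  have pe: "p \<noteq> []" "hd p = e" "last p = f" "is_string (tree_quiver T) p"
    using p by (auto simp: string_from_to_def is_string_def)
  have "tl (rev p) \<noteq> [] \<Longrightarrow> hd (tl (rev p)) \<in> set_tree T"
    using pe(4) by (metis is_string_def hd_in_set list.set_sel(2) rev_is_Nil_conv set_rev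
        subset_iff tl_Nil verts_quiver_of)
  then have desc: "descends T (rev p)"
    using string_descends[OF d is_string_rev[OF pe(4)] subtrees_self] pe f by (simp add: hd_rev)
  then have dp: "distinct p" using descends_distinct d by force
  \<comment> \<open>\<open>us\<close> is the part of the reversed string above \<open>t\<close>; as
    it is disjoint from \<open>t\<close>, the vertices of \<open>p\<close> inside \<open>t\<close>
    all belong to \<open>ps\<close>. The offset stays \<open>0\<close> because the labelling starts
    at the bottom of this path.\<close>
  have "postorder_labelled t 0 L"
    if "descends t ps" "t \<in> subtrees T" "rev p = us @ ps" "set us \<inter> set_tree t = {}" for t ps us
    using that
  proof (induction t ps arbitrary: us rule: descends.induct)
    case (descends_root x t)
    then have "x = e" using pe by (metis last_snoc last_rev)
    moreover obtain a b where "t = \<langle>a, x, b\<rangle>" using descends_root(1) by (cases t) auto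
    ultimately show ?case using e Le descends_root(2) by force
  next
    case (descends_child x s s' t ps)
    note n = descends_child(1) and t = descends_child(4)
    have dt: "distinct_tree t" using distinct_subtree t d by blast
    have sT: "s \<in> subtrees T" "s' \<in> subtrees T"
      using node_of_simps(3)[OF n] node_of_simps(3)[OF node_of_swap[OF n]] subtrees_trans t
          by blast+
    have us: "set (us @ [x]) \<inter> set_tree s = {}"
      using descends_child(6) node_of_simps(1)[OF n] node_of_distinct(1)[OF n dt] by auto
    then have post: "postorder_labelled s 0 L"
      using descends_child(3)[OF sT(1), of "us @ [x]"] descends_child(5) by simp
    obtain y ps' where ps: "ps = y # ps'" and y: "y \<in> roots s"
      using descends_props[OF descends_child(2)] by (cases ps) auto
    have pss: "set ps \<subseteq> set_tree s" using descends_props[OF descends_child(2)] by blast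
    have pp: "p = rev ps' @ y # x # rev us" using descends_child(5) ps by (simp add: rev_swap)
    define i where "i = length ps'"
    have i: "Suc i < length p" "p ! i = y" "p ! Suc i = x"
      by (simp_all add: pp i_def nth_append)
    have Ly: "L y = size s" using postorder_labelled_root[OF post y] by simp
    show ?case
    proof (cases s')
      case Leaf
      \<comment> \<open>Without a sibling, \<open>y\<close> is not primary: a later vertex of
        \<open>p\<close> joined to \<open>y\<close> can only be the parent \<open>x\<close>, and a
        third vertex joined to both would lie in \<open>s\<close> and, being joined to
        \<open>x\<close>, equal the root \<open>y\<close> of \<open>s\<close>.\<close>
      have "\<nexists>y' z'. primary_rel (tree_quiver T) p y y' z'"
      proof
        assume "\<exists>y' z'. primary_rel (tree_quiver T) p y y' z'"
        then obtain y' z' j k where tc: "three_cycle (tree_quiver T) y y' z'" and z': "z' \<notin> set p"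
          and jk: "j < k" "k < length p" "p ! j = y" "p ! k = y'" unfolding primary_rel_def by blast
        have "j = i" using jk(1-3) i dp nth_eq_iff_index_eq[of p j i] by simp
        then have "y' = drop (Suc i) p ! (k - Suc i)" "k - Suc i < length (drop (Suc i) p)"
            using jk by simp_all
        moreover have "drop (Suc i) p = x # rev us" by (simp add: pp i_def)
        ultimately have "y' \<in> set (x # rev us)" by (metis nth_mem)
        then have y': "y' \<notin> set_tree s" using us by auto
        have ys: "y \<in> set_tree s" using y by (rule roots_in)
        note ed = three_cycle_edges[OF tc]
        have y'x: "y' = x" using node_of_leave_child(2)[OF n t d ys y'] ed Leaf by auto
        have "z' \<noteq> x" "z' \<noteq> y" using z' by (auto simp: pp)
        then have zs: "z' \<in> set_tree s" using node_of_leave_child(2)[OF n t d ys, of z'] ed Leaf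
            by auto
        have "z' \<in> roots s"
          using node_of_leave_child(1)[OF n t d zs y'] ed edges_commute[of _ z' y'] by simp
        then show False using y roots_unique \<open>z' \<noteq> y\<close> by metis
      qed
      then have "L x = L y + 1" using step1[OF i(1)] i by simp
      then show ?thesis using postorder_labelled_node_of[OF n post] Ly Leaf by simp
    next
      \<comment> \<open>The root \<open>z\<close> of the sibling is the complementary vertex, so the
        sibling subtree is labelled with offset \<open>L y = size s\<close>.\<close>
      case (Node a z b)
      then have z: "z \<in> roots s'" by simp
      have zs: "z \<in> set_tree s'" "z \<in> set_tree t" using Node node_of_simps(1)[OF n] by auto
      have "z \<notin> set_tree s" "z \<noteq> x"
        using node_of_distinct[OF n dt] node_of_distinct[OF node_of_swap[OF n] dt] zs by auto
      then have "z \<notin> set p" using descends_child(6) pss ps zs by (auto simp: pp)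
      then have pr: "primary_rel (tree_quiver T) p (p ! i) x z"
        using node_of_triangle(2)[OF n t d y z] i by (auto simp: primary_rel_def)
      show ?thesis
        using step2[OF i(1) pr sT(2) z] rooted_subquiver_sibling[OF n t d y z] i Ly
          postorder_labelled_node_of[OF n post] by simp
    qed
  qed
  from this[OF desc subtrees_self, of "[]"] show ?thesis by simp
qed

text \<open>The second vertex of the input pair receives the largest label and so is taken as the
  root. The recursive calls respect this: their pair is \<open>(z', z)\<close>, with
  \<open>z\<close> the root of the sibling subtree. The tree is arbitrary in the induction because
  each call works with its own subtree.\<close>

lemma type_A_labelling_postorder:
  "type_A_labelling Q e f L \<Longrightarrow> distinct_tree T \<Longrightarrow> Q = tree_quiver T \<Longrightarrow> f \<in> roots T
      \<Longrightarrow> postorder_labelled T 0 L"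
proof (induction arbitrary: T rule: type_A_labelling.induct)
  case (single Q e L)
  then obtain l r where T: "T = \<langle>l, e, r\<rangle>" by (cases T) auto
  have "insert e (set_tree l \<union> set_tree r) = {e}" using single(2,5) T by simp
  moreover have "e \<notin> set_tree l" "e \<notin> set_tree r" using single(4) T by auto
  ultimately have "set_tree l = {}" "set_tree r = {}" by blast+
  then show ?case using T single(3) by simp
next
  case (walk k Q e f p L)
  note Q = walk.prems(2)
  show ?case
  proof (rule walk_postorder_labelled[where e = e and f = f and p = p and L = L])
    show "distinct_tree T" "f \<in> roots T" by (fact walk.prems)+
    show "string_from_to (tree_quiver T) e f p" using walk.hyps(6) Q by simp
    show "L e = 1" by (fact walk.hyps(7))
  next
    fix a b assume ab: "\<langle>a, e, b\<rangle> \<in> subtrees T"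
    have "roots T \<noteq> {e}" using walk.prems(3) walk.hyps(5) by auto
    then show "a = Leaf \<and> b = Leaf"
      using end_vertex_tree_quiver[OF walk.prems(1) ab] walk.hyps(3) Q by simp
  next
    fix i assume "Suc i < length p" "\<nexists>y z. primary_rel (tree_quiver T) p (p ! i) y z"
    then show "L (p ! Suc i) = L (p ! i) + 1" using walk.hyps(8) Q by blast
  next
    fix i y z s
    assume i: "Suc i < length p" "primary_rel (tree_quiver T) p (p ! i) y z"
      and s: "s \<in> subtrees T" "z \<in> roots s" "rooted_subquiver (tree_quiver T) z (p ! i) y =
          tree_quiver s"
    have ds: "distinct_tree s" using distinct_subtree s(1) walk.prems(1) by blast
    obtain L' where L': "\<And>T. distinct_tree T \<Longrightarrow> tree_quiver s = tree_quiver T \<Longrightarrow> z \<in> roots T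
        \<Longrightarrow> postorder_labelled T 0 L'"
      and LL': "\<And>v. v \<in> set_tree s \<Longrightarrow> L v = L (p ! i) + L' v"
      and Lx: "L (p ! Suc i) = L (p ! i) + card (set_tree s) + 1"
      using walk.IH[rule_format, of i y z "tree_quiver s"] i s Q by (metis verts_quiver_of)
    have "postorder_labelled s 0 L'" using L'[OF ds refl s(2)] .
    then have "postorder_labelled s (L (p ! i)) L" using postorder_labelled_shift[OF _ LL']
        by fastforce
    moreover have "card (set_tree s) = size s"
      using ds by (metis distinct_card length_inorder set_inorder)
    ultimately show "postorder_labelled s (L (p ! i)) L \<and> L (p ! Suc i) = L (p ! i) + size s + 1"
        using Lx by simp
  qed
qed

section \<open>Adjacency and 3-cycles in terms of labels\<close>

text \<open>Pairs are ordered as child, parent. A relation rather than a function, since the root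
  has no parent.\<close>

fun tree_parents :: "'a tree \<Rightarrow> ('a \<times> 'a) set" where
  "tree_parents Leaf = {}"
| "tree_parents (Node l x r) = roots l \<times> {x} \<union> roots r \<times> {x} \<union> tree_parents l \<union> tree_parents r"

lemma tree_parents_in: "(u, v) \<in> tree_parents t \<Longrightarrow> u \<in> set_tree t \<and> v \<in> set_tree t"
proof (induction t)
  case (Node l x r)
  then show ?case using roots_in[of u l] roots_in[of u r] by auto
qed simp

lemma tree_parents_notin:
  "u \<notin> set_tree t \<Longrightarrow> (u, v) \<notin> tree_parents t" "v \<notin> set_tree t \<Longrightarrow> (u, v) \<notin> tree_parents t"
  using tree_parents_in[of u v t] by blast+

lemma tree_parents_subtree: "s \<in> subtrees t \<Longrightarrow> tree_parents s \<subseteq> tree_parents t"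
  by (induction t) auto

lemma tree_parents_child:
  assumes n: "node_of x s s' t" and d: "distinct_tree t" and u: "u \<in> set_tree s"
  shows "(u, y) \<in> tree_parents t \<longleftrightarrow> u \<in> roots s \<and> y = x \<or> (u, y) \<in> tree_parents s"
proof -
  have "u \<notin> set_tree s'" using node_of_distinct(2)[OF n d] u by blast
  then show ?thesis using n unfolding node_of_def
    by (elim disjE) (simp_all add: tree_parents_notin roots_notin)
qed

lemma tree_parents_root:
  assumes n: "node_of x s s' t" and d: "distinct_tree t"
  shows "(x, y) \<notin> tree_parents t" "(y, x) \<in> tree_parents t \<longleftrightarrow> y \<in> roots s \<union> roots s'"
  using n node_of_distinct(1)[OF n d] node_of_distinct(1)[OF node_of_swap[OF n] d]
      unfolding node_of_def
  by (auto simp: tree_parents_notin roots_notin)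

text \<open>Together with induction on \<open>size\<close>, this replaces structural induction by
  one that treats both children alike.\<close>

lemma node_of_cases:
  assumes "u \<in> set_tree t"
  obtains x s s' where "node_of x s s' t" "u = x" | x s s' where "node_of x s s' t" "u \<in> set_tree s"
proof (cases t)
  case (Node l x r)
  have n: "node_of x l r t" "node_of x r l t" using Node by (auto simp: node_of_def)
  from assms Node consider "u = x" | "u \<in> set_tree l" | "u \<in> set_tree r" by auto
  then show thesis using n that by cases blast+
qed (use assms in simp)

lemma node_of_size:
  assumes "node_of x s s' t" shows "size s < size t"
  using node_of_simps(4)[OF assms] by simp

lemma tree_parent_exists:
  "distinct_tree t \<Longrightarrow> u \<in> set_tree t \<Longrightarrow> u \<notin> roots t \<Longrightarrow> \<exists>y. (u, y) \<in> tree_parents t"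
proof (induction t)
  case (Node l x r)
  then show ?case by (cases "u \<in> roots l \<or> u \<in> roots r") auto
qed simp

lemma tree_parent_unique:
  assumes "distinct_tree t" "(u, y) \<in> tree_parents t" "(u, z) \<in> tree_parents t"
  shows "y = z"
  using assms
proof (induction "size t" arbitrary: t rule: less_induct)
  case less
  have "u \<in> set_tree t" using tree_parents_in[OF less.prems(2)] by blast
  then show ?case
  proof (cases rule: node_of_cases)
    case (1 x s s')
    then show ?thesis using tree_parents_root(1)[OF 1(1) less.prems(1)] less.prems(2) by blast
  next
    case (2 x s s')
    have ds: "distinct_tree s" by (rule node_of_distinct(3)[OF 2(1) less.prems(1)])
    have "(u, v) \<notin> tree_parents s" if "u \<in> roots s" for v
    proof (cases s)
      case (Node l r k)
      have "node_of r l k s" using Node by (simp add: node_of_def)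
      then show ?thesis using tree_parents_root(1)[of r l k s] ds that Node by auto
    qed simp
    then show ?thesis
      using less.hyps[OF node_of_size[OF 2(1)] ds] less.prems tree_parents_child[OF 2(1)
          less.prems(1) 2(2)] by metis
  qed
qed

text \<open>Forgetting directions, the arrows created at a node join each child to it and the two
  children to one another. In this form adjacency can be compared with common indices of root
  vectors.\<close>

lemma tree_edge_iff:
  assumes "distinct_tree t" "u \<in> set_tree t" "v \<in> set_tree t" "u \<noteq> v"
  shows "(u, v) \<in> tree_arrows t \<or> (v, u) \<in> tree_arrows t \<longleftrightarrow>
    (u, v) \<in> tree_parents t \<or> (v, u) \<in> tree_parents t \<or>
    (\<exists>y. (u, y) \<in> tree_parents t \<and> (v, y) \<in> tree_parents t)"
  using assms
proof (induction t)
  case (Node l x r)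
  let ?t = "\<langle>l, x, r\<rangle>"
  note d = Node.prems(1)
  have n: "node_of x l r ?t" "node_of x r l ?t" by (simp_all add: node_of_def)
  have nx: "x \<notin> set_tree l" "x \<notin> set_tree r" and lr: "set_tree l \<inter> set_tree r = {}" using d by auto
  note notin = tree_arrows_notin roots_notin tree_parents_notin
  have root: "(x, v) \<in> tree_arrows ?t \<or> (v, x) \<in> tree_arrows ?t \<longleftrightarrow> (v, x) \<in> tree_parents ?t" for v
    using nx by (auto simp: notin)
  have same: ?case if n: "node_of x s s' ?t" and uv: "u \<in> set_tree s" "v \<in> set_tree s"
     and IH: "(u, v) \<in> tree_arrows s \<or> (v, u) \<in> tree_arrows s \<longleftrightarrow>
       (u, v) \<in> tree_parents s \<or> (v, u) \<in> tree_parents s \<or>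
       (\<exists>y. (u, y) \<in> tree_parents s \<and> (v, y) \<in> tree_parents s)" for s s'
  proof -
    have ss: "s \<in> subtrees ?t" by (rule node_of_simps(3)[OF n])
    have xs: "x \<notin> set_tree s" by (rule node_of_distinct(1)[OF n d])
    then have "u \<noteq> x" "v \<noteq> x" using uv by auto
    have "\<not> (u \<in> roots s \<and> v \<in> roots s)" using roots_unique Node.prems(4) by metis
    moreover have "(u, x) \<notin> tree_parents s" "(v, x) \<notin> tree_parents s" using xs
        by (simp_all add: notin)
    ultimately show ?thesis
      using IH tree_arrows_subtree[OF ss d] uv tree_parents_child[OF n d uv(1)]
          tree_parents_child[OF n d uv(2)]
        \<open>u \<noteq> x\<close> \<open>v \<noteq> x\<close> by metis
  qed
  \<comment> \<open>Between the two child subtrees the only edge joins their roots, which have the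
    common parent \<open>x\<close>.\<close>
  have diff: ?case if n: "node_of x s s' ?t" and uv: "u \<in> set_tree s" "v \<in> set_tree s'" for s s'
  proof -
    note n' = node_of_swap[OF n]
    have dj: "u \<notin> set_tree s'" "v \<notin> set_tree s" "u \<noteq> x" "v \<noteq> x"
      using node_of_distinct[OF n d] node_of_distinct[OF n' d] uv by auto
    have xs: "x \<notin> set_tree s" "x \<notin> set_tree s'" using node_of_distinct(1)[OF n d]
        node_of_distinct(1)[OF n' d] by blast+
    have "(u, v) \<in> tree_arrows ?t \<or> (v, u) \<in> tree_arrows ?t \<longleftrightarrow> u \<in> roots s \<and> v \<in> roots s'"
      using n dj unfolding node_of_def by (elim disjE) (auto simp: notin)
    moreover have "(\<exists>y. (u, y) \<in> tree_parents s \<and> (v, y) \<in> tree_parents s') \<longleftrightarrow> False"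
      using tree_parents_in[of _ _ s] tree_parents_in[of _ _ s'] node_of_distinct(2)[OF n d]
          by blast
    ultimately show ?thesis
      using tree_parents_child[OF n d uv(1)] tree_parents_child[OF n' d uv(2)] dj xs notin(4,5)
      by metis
  qed
  from Node.prems consider "u = x" | "v = x" | "u \<in> set_tree l" "v \<in> set_tree l" |
      "u \<in> set_tree r" "v \<in> set_tree r"
    | "u \<in> set_tree l" "v \<in> set_tree r" | "u \<in> set_tree r" "v \<in> set_tree l" by auto
  then show ?case
  proof cases
    case 1 then show ?thesis using root[of v] tree_parents_root(1)[OF n(1) d] by blast
  next
    case 2 then show ?thesis using root[of u] tree_parents_root(1)[OF n(1) d] by blast
  next
    case 3 then show ?thesis using same[OF n(1)] Node.IH(1) Node.prems d by simp
  next
    case 4 then show ?thesis using same[OF n(2)] Node.IH(2) Node.prems d by simp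
  next
    case 5 then show ?thesis by (rule diff[OF n(1)])
  next
    case 6 then show ?thesis by (rule diff[OF n(2)])
  qed
qed simp

section \<open>Labels of parents and of 3-cycles\<close>

lemma postorder_labelled_bounds:
  "postorder_labelled t d L \<Longrightarrow> x \<in> set_tree t \<Longrightarrow> d < L x \<and> L x \<le> d + size t"
  by (induction t arbitrary: d) fastforce+

lemma postorder_labelled_inj: "postorder_labelled t d L \<Longrightarrow> inj_on L (set_tree t)"
proof (induction t arbitrary: d)
  case (Node l x r)
  have key: "inj_on L (insert x (set_tree s \<union> set_tree s'))"
    if s: "postorder_labelled s d L" "postorder_labelled s' (d + size s) L"
        "L x = d + size s + size s' + 1"
      "inj_on L (set_tree s)" "inj_on L (set_tree s')" for s s'
  proof -
    have b: "L y \<le> d + size s" if "y \<in> set_tree s" for y using postorder_labelled_bounds[OF s(1)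
        that] by simp
    have b': "d + size s < L y \<and> L y \<le> d + size s + size s'" if "y \<in> set_tree s'" for y
      using postorder_labelled_bounds[OF s(2) that] by simp
    have "inj_on L (set_tree s \<union> set_tree s')"
      unfolding inj_on_Un using s(4,5) b b' by (fastforce simp: image_iff)
    moreover have "L x \<notin> L ` (set_tree s \<union> set_tree s')" using b b' s(3) by fastforce
    ultimately show ?thesis by (simp add: inj_on_insert) blast
  qed
  have "inj_on L (insert x (set_tree l \<union> set_tree r))"
    using Node key[of l r] key[of r l] by (auto simp: Un_commute)
  then show ?case by simp
qed simp

lemma postorder_labelled_child:
  assumes "postorder_labelled t d L" "node_of x s s' t"
  shows "\<exists>d'. postorder_labelled s d' L"
  using assms by (auto simp: node_of_def)

lemma postorder_labelled_node:
  assumes "postorder_labelled t d L" "node_of x s s' t"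
  shows "L x = d + size t \<and> (postorder_labelled s d L \<and> postorder_labelled s' (d + size s) L \<or>
     postorder_labelled s' d L \<and> postorder_labelled s (d + size s') L)"
  using assms by (auto simp: node_of_def)

lemma tree_parents_less:
  assumes "postorder_labelled t d L" "(u, v) \<in> tree_parents t"
  shows "L u < L v"
  using assms
proof (induction t arbitrary: d)
  case (Node l x r)
  have "L u < L x" if "u \<in> roots l \<or> u \<in> roots r"
    using Node.prems(1) that postorder_labelled_root[of l _ L u] postorder_labelled_root[of r _ L
        u] by fastforce
  then show ?case using Node by auto
qed simp

text \<open>A 3-cycle of a tree quiver is a node with its two children. In postorder the node comes
  last, immediately preceded by the child visited second; thus primary and complementary vertex are
  siblings, and the secondary vertex is their parent.\<close>

lemma three_cycle_labels:
  assumes "distinct_tree t" "postorder_labelled t d L" "three_cycle (tree_quiver t) x y z"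
      "L x < L y" "L y < L z"
  shows "(x, z) \<in> tree_parents t \<and> (y, z) \<in> tree_parents t \<and> L z = L y + 1"
  using assms
proof (induction "size t" arbitrary: t d rule: less_induct)
  case less
  note dt = less.prems(1) and post = less.prems(2) and tc = less.prems(3)
  note ed = three_cycle_edges[OF tc]
  then have mem: "x \<in> set_tree t" "y \<in> set_tree t" "z \<in> set_tree t"
    using tree_arrows_in[of _ _ t] unfolding edges_quiver_of by blast+
  have xyz: "x \<noteq> y" "y \<noteq> z" "x \<noteq> z" using less.prems by auto
  have top: "L v \<le> L a" if "node_of a s s' t" "v \<in> set_tree t" for a s s' v
    using postorder_labelled_node[OF post that(1)] postorder_labelled_bounds[OF post that(2)]
        by simp
  from mem(1) show ?case
  proof (cases rule: node_of_cases)
    case (1 a s s')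
    then show ?thesis using top[OF 1(1) mem(3)] less.prems by simp
  next
    case (2 a s s')
    note n = 2(1) and n' = node_of_swap[OF 2(1)]
    have ya: "y \<noteq> a" using top[OF n mem(3)] less.prems by auto
    show ?thesis
    proof (cases "z = a")
      case True
      have x: "x \<in> roots s"
        using node_of_leave_child(1)[OF n subtrees_self dt 2(2), of z] ed True
            node_of_distinct(1)[OF n dt] by simp
      have "y \<in> roots s \<union> roots s'"
        using node_of_root_edge[OF n subtrees_self dt mem(2)] ed True edges_commute[of _ y] by simp
      then have y: "y \<in> roots s'" using x xyz roots_unique[of x s y] by blast
      have s: "size s > 0" "size s' > 0" using x y by (cases s; cases s'; simp)+
      have "L y = d + size s + size s'" "L z = d + size t"
        using postorder_labelled_node[OF post n] postorder_labelled_root[OF _ x]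
            postorder_labelled_root[OF _ y] less.prems(4) True s
        by fastforce+
      moreover have "size t = size s + size s' + 1" by (rule node_of_simps(4)[OF n])
      ultimately show ?thesis using tree_parents_root(2)[OF n dt] x y True by simp
    next
      \<comment> \<open>If \<open>z\<close> is not the root either, none of the three vertices is,
        and the 3-cycle lies inside the subtree \<open>s\<close>.\<close>
      case False
      have xs: "x \<in> set_tree s" by (rule 2(2))
      have ys: "y \<in> set_tree s"
      proof (rule ccontr)
        assume y: "y \<notin> set_tree s"
        have x: "x \<in> roots s" and y': "y \<in> roots s'"
          using node_of_leave_child[OF n subtrees_self dt xs y] ed ya by auto
        show False
        proof (cases "z \<in> set_tree s")
          case True
          then have "z \<in> roots s"
            using node_of_leave_child(1)[OF n subtrees_self dt True y] ed edges_commute[of _ z y]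
                by simp
          then show False using x xyz roots_unique by metis
        next
          case z: False
          then have "z \<in> roots s'" using node_of_leave_child(2)[OF n subtrees_self dt xs z] ed
              False by auto
          then show False using y' xyz roots_unique by metis
        qed
      qed
      have zs: "z \<in> set_tree s"
      proof (rule ccontr)
        assume z: "z \<notin> set_tree s"
        have "x \<in> roots s" "y \<in> roots s"
          using node_of_leave_child(1)[OF n subtrees_self dt xs z] node_of_leave_child(1)[OF n
              subtrees_self dt ys z] ed by simp_all
        then show False using xyz roots_unique by metis
      qed
      have ss: "s \<in> subtrees t" by (rule node_of_simps(3)[OF n])
      have tcs: "three_cycle (tree_quiver s) x y z"
        using tc tree_arrows_subtree[OF ss dt] xs ys zs by (simp add: three_cycle_def
            oriented_3cycle_def)
      obtain d' where d': "postorder_labelled s d' L" using postorder_labelled_child[OF post n]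
          by blast
      show ?thesis
        using less.hyps[OF node_of_size[OF n] node_of_distinct(3)[OF n dt] d' tcs less.prems(4,5)]
          tree_parents_subtree[OF ss] by blast
    qed
  qed
qed

text \<open>The child visited last is labelled immediately before its parent. A child visited first
  that has a sibling is primary, with the sibling as its complementary vertex.\<close>

lemma tree_parent_label:
  assumes "distinct_tree t" "postorder_labelled t d L" "(x, z) \<in> tree_parents t"
  shows "L z = L x + 1 \<or> (\<exists>y. three_cycle (tree_quiver t) x y z \<and> L x < L y \<and> L y < L z)"
  using assms
proof (induction "size t" arbitrary: t d rule: less_induct)
  case less
  note dt = less.prems(1) and post = less.prems(2)
  have "x \<in> set_tree t" using tree_parents_in[OF less.prems(3)] by blast
  then show ?case
  proof (cases rule: node_of_cases)
    case (1 a s s')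
    then show ?thesis using tree_parents_root(1)[OF 1(1) dt] less.prems(3) by blast
  next
    case (2 a s s')
    note n = 2(1)
    from less.prems(3) consider "(x, z) \<in> tree_parents s" | "x \<in> roots s" "z = a"
      using tree_parents_child[OF n dt 2(2)] by blast
    then show ?thesis
    proof cases
      case 1
      have ss: "s \<in> subtrees t" by (rule node_of_simps(3)[OF n])
      obtain d' where d': "postorder_labelled s d' L" using postorder_labelled_child[OF post n]
          by blast
      have "three_cycle (tree_quiver t) x y z" if "three_cycle (tree_quiver s) x y z" for y
        using that tree_arrows_subtree[OF ss dt] tree_arrows_in[of _ _ s]
        by (auto simp: three_cycle_def oriented_3cycle_def)
      then show ?thesis
        using less.hyps[OF node_of_size[OF n] node_of_distinct(3)[OF n dt] d' 1] by blast
    next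
      case 2
      have sz: "size t = size s + size s' + 1" by (rule node_of_simps(4)[OF n])
      have Lz: "L z = d + size t" using postorder_labelled_node[OF post n] 2(2) by simp
      from postorder_labelled_node[OF post n] consider
        (first) "postorder_labelled s d L" "postorder_labelled s' (d + size s) L" | (last)
            "postorder_labelled s (d + size s') L" by blast
      then show ?thesis
      proof cases
        case last
        then show ?thesis using postorder_labelled_root[OF last 2(1)] Lz sz by simp
      next
        case first
        show ?thesis
        proof (cases s')
          case Leaf
          then show ?thesis using postorder_labelled_root[OF first(1) 2(1)] Lz sz by simp
        next
          case (Node l y r)
          then have y: "y \<in> roots s'" by simp
          have "L x < L y \<and> L y < L z"
            using postorder_labelled_root[OF first(1) 2(1)] postorder_labelled_root[OF first(2) y]
                Lz sz Node by simp
          moreover have "three_cycle (tree_quiver t) x z y"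
            using node_of_triangle(2)[OF n subtrees_self dt 2(1) y] 2(2) by simp
          then have "three_cycle (tree_quiver t) x y z" by (auto simp: three_cycle_def)
          ultimately show ?thesis by blast
        qed
      qed
    qed
  qed
qed

section \<open>Root vectors of type \<open>D\<close>\<close>

text \<open>Common shape of \<open>root_lattice\<close> and of the spanning condition in
  \<open>int_basis\<close>, so that the two can be compared as sets of integer combinations.\<close>

definition int_span :: "'a set \<Rightarrow> ('a \<Rightarrow> 'v::real_inner) \<Rightarrow> 'v set" where
  "int_span X \<gamma> = {v. \<exists>k::'a \<Rightarrow> int. v = (\<Sum>x\<in>X. real_of_int (k x) *\<^sub>R \<gamma> x)}"

lemma int_spanI: "v = (\<Sum>x\<in>X. real_of_int (k x) *\<^sub>R \<gamma> x) \<Longrightarrow> v \<in> int_span X \<gamma>"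
  by (auto simp: int_span_def)

lemma int_span_zero: "0 \<in> int_span X \<gamma>"
  by (rule int_spanI[where k = "\<lambda>_. 0"]) simp

lemma int_span_add:
  fixes \<gamma> :: "'a \<Rightarrow> 'v::real_inner"
  assumes "u \<in> int_span X \<gamma>" "v \<in> int_span X \<gamma>"
  shows "u + v \<in> int_span X \<gamma>"
proof -
  obtain k l :: "'a \<Rightarrow> int" where "u = (\<Sum>x\<in>X. real_of_int (k x) *\<^sub>R \<gamma> x)"
      "v = (\<Sum>x\<in>X. real_of_int (l x) *\<^sub>R \<gamma> x)"
    using assms unfolding int_span_def by blast
  then have "u + v = (\<Sum>x\<in>X. real_of_int (k x + l x) *\<^sub>R \<gamma> x)"
    by (simp add: sum.distrib scaleR_add_left)
  then show ?thesis by (rule int_spanI)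
qed

lemma int_span_scale:
  fixes \<gamma> :: "'a \<Rightarrow> 'v::real_inner"
  assumes "u \<in> int_span X \<gamma>"
  shows "real_of_int c *\<^sub>R u \<in> int_span X \<gamma>"
proof -
  obtain k :: "'a \<Rightarrow> int" where "u = (\<Sum>x\<in>X. real_of_int (k x) *\<^sub>R \<gamma> x)"
    using assms unfolding int_span_def by blast
  then have "real_of_int c *\<^sub>R u = (\<Sum>x\<in>X. real_of_int (c * k x) *\<^sub>R \<gamma> x)"
    by (simp add: scaleR_sum_right)
  then show ?thesis by (rule int_spanI)
qed

lemma int_span_minus: "u \<in> int_span X \<gamma> \<Longrightarrow> - u \<in> int_span X \<gamma>"
  using int_span_scale[of u X \<gamma> "-1"] by simp

lemma int_span_diff: "u \<in> int_span X \<gamma> \<Longrightarrow> v \<in> int_span X \<gamma> \<Longrightarrow> u - v \<in> int_span X \<gamma>"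
  using int_span_add[of u X \<gamma> "- v"] int_span_minus[of v X \<gamma>] by simp

lemma int_span_base:
  fixes \<gamma> :: "'a \<Rightarrow> 'v::real_inner"
  assumes "finite X" "x \<in> X"
  shows "\<gamma> x \<in> int_span X \<gamma>"
proof -
  have "\<gamma> x = (\<Sum>y\<in>X. if y = x then \<gamma> y else 0)" using assms by simp
  also have "\<dots> = (\<Sum>y\<in>X. real_of_int (if y = x then 1 else 0) *\<^sub>R \<gamma> y)"
    by (rule sum.cong) auto
  finally show ?thesis by (rule int_spanI)
qed

lemma int_span_sum: "(\<And>i. i \<in> I \<Longrightarrow> f i \<in> int_span X \<gamma>) \<Longrightarrow> sum f I \<in> int_span X \<gamma>"
  by (induction I rule: infinite_finite_induct) (auto intro: int_span_zero int_span_add)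

lemma int_span_subset:
  fixes \<gamma> :: "'a \<Rightarrow> 'v::real_inner" and \<delta> :: "'b \<Rightarrow> 'v"
  assumes "\<And>y. y \<in> Y \<Longrightarrow> \<delta> y \<in> int_span X \<gamma>"
  shows "int_span Y \<delta> \<subseteq> int_span X \<gamma>"
proof
  fix v assume "v \<in> int_span Y \<delta>"
  then obtain k :: "'b \<Rightarrow> int" where v: "v = (\<Sum>y\<in>Y. real_of_int (k y) *\<^sub>R \<delta> y)"
    unfolding int_span_def by blast
  show "v \<in> int_span X \<gamma>"
    unfolding v by (intro int_span_sum int_span_scale assms)
qed

lemma root_lattice_int_span: "root_lattice \<Phi> = int_span \<Phi> (\<lambda>a. a)"
  by (simp add: root_lattice_def int_span_def)

lemma root_lattice_simple_system:
  assumes "simple_system \<Phi> n \<alpha>"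
  shows "root_lattice \<Phi> \<subseteq> int_span {1..n} \<alpha>"
  unfolding root_lattice_int_span
proof (rule int_span_subset)
  fix b assume "b \<in> \<Phi>"
  then obtain k :: "nat \<Rightarrow> nat" where "b = (\<Sum>i=1..n. real (k i) *\<^sub>R \<alpha> i) \<or> b = - (\<Sum>i=1..n. real (k
      i) *\<^sub>R \<alpha> i)"
    using assms unfolding simple_system_def by blast
  moreover have "(\<Sum>i=1..n. real (k i) *\<^sub>R \<alpha> i) \<in> int_span {1..n} \<alpha>"
    by (rule int_spanI[where k = "\<lambda>i. int (k i)"]) simp
  ultimately show "b \<in> int_span {1..n} \<alpha>" by (elim disjE) (simp_all only: int_span_minus)
qed

text \<open>Reflecting \<open>b\<close> in \<open>a\<close> subtracts \<open>a\<close> with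
  coefficient \<open>2 * (-1) / 2 = -1\<close>.\<close>

lemma root_sum:
  assumes "root_system \<Phi>" "\<forall>a\<in>\<Phi>. a \<bullet> a = 2" "a \<in> \<Phi>" "b \<in> \<Phi>" "a \<bullet> b = -1"
  shows "a + b \<in> \<Phi>"
proof -
  have "b - (2 * (a \<bullet> b) / (a \<bullet> a)) *\<^sub>R a \<in> \<Phi>"
    using assms(1,3,4) unfolding root_system_def by blast
  moreover have "a \<bullet> a = 2" using assms by blast
  ultimately show ?thesis using assms(5) by (simp add: add.commute)
qed

section \<open>Orthonormal coordinates for type D\<close>

text \<open>The orthonormal vectors in terms of which \<open>\<alpha> k = \<epsilon> k - \<epsilon> (k + 1)\<close> for \<open>k < n\<close> and
  \<open>\<alpha> n = \<epsilon> (n - 1) + \<epsilon> n\<close>.\<close>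

definition eps :: "nat \<Rightarrow> (nat \<Rightarrow> 'v::real_inner) \<Rightarrow> nat \<Rightarrow> 'v" where
  "eps n \<alpha> i = (\<Sum>k = i..<n. \<alpha> k) + (1 / 2) *\<^sub>R (\<alpha> n - \<alpha> (n - 1))"

lemma eps_Suc: "i < n \<Longrightarrow> eps n \<alpha> i = \<alpha> i + eps n \<alpha> (Suc i)"
  by (simp add: eps_def sum.atLeast_Suc_lessThan add.assoc)

lemma sum_alpha_eps:
  assumes "i \<le> j" "j \<le> n"
  shows "(\<Sum>k = i..<j. \<alpha> k) = eps n \<alpha> i - eps n \<alpha> j"
proof -
  have "(\<Sum>k = i..<n. \<alpha> k) = (\<Sum>k = i..<j. \<alpha> k) + (\<Sum>k = j..<n. \<alpha> k)"
    using assms by (simp add: sum.atLeastLessThan_concat)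
  then show ?thesis by (simp add: eps_def)
qed

text \<open>The two halved terms add up to \<open>\<alpha> n - \<alpha> (n - 1)\<close>, and the
  summand \<open>\<alpha> (n - 1)\<close> of \<open>eps n \<alpha> (n - 1)\<close> cancels the
  rest.\<close>

lemma alpha_last_eps:
  assumes "n \<ge> 1"
  shows "\<alpha> n = eps n \<alpha> (n - 1) + eps n \<alpha> n"
proof -
  have "{n - 1..<n} = {n - 1}" using assms by auto
  then have "eps n \<alpha> (n - 1) + eps n \<alpha> n =
      \<alpha> (n - 1) + (1 / 2) *\<^sub>R ((\<alpha> n - \<alpha> (n - 1)) + (\<alpha> n - \<alpha> (n - 1)))"
    by (simp only: eps_def scaleR_add_right) simp
  then show ?thesis by (simp only: scaleR_half_double) simp
qed

context
  fixes n :: nat and \<Phi> :: "'v::real_inner set" and \<alpha> :: "nat \<Rightarrow> 'v"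
  assumes n: "n \<ge> 4" and D: "root_system_D n \<Phi> \<alpha>"
begin

lemma alpha_in: "i \<in> {1..n} \<Longrightarrow> \<alpha> i \<in> \<Phi>"
  using D by (auto simp: root_system_D_def simple_system_def)

lemma alpha_norm: "i \<in> {1..n} \<Longrightarrow> \<alpha> i \<bullet> \<alpha> i = 2"
  using D alpha_in by (auto simp: root_system_D_def)

lemma alpha_inner: "i \<in> {1..n} \<Longrightarrow> j \<in> {1..n} \<Longrightarrow> i \<noteq> j \<Longrightarrow> \<alpha> i \<bullet> \<alpha> j = (if dynkin_D n i j then -1 else
    0)"
  using D by (auto simp: root_system_D_def)

text \<open>Downward induction on \<open>j\<close> from \<open>n\<close>, peeling off
  \<open>\<alpha> j\<close>. At \<open>j = n\<close> the nodes \<open>n - 1\<close> and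
  \<open>n\<close> are both joined to \<open>n - 2\<close>, so their contributions cancel there and
  only \<open>k = n - 1\<close> gives a nonzero product.\<close>

lemma eps_inner_alpha:
  assumes j: "1 \<le> j" "j \<le> n" and k: "1 \<le> k" "k < n"
  shows "eps n \<alpha> j \<bullet> \<alpha> k = of_bool (j = k) - of_bool (j = Suc k)"
  using j(2,1)
proof (induction rule: inc_induct)
  case base
  have "\<alpha> n \<bullet> \<alpha> k = (if k = n - 2 then -1 else 0)"
    using alpha_inner[of n k] k n by (auto simp: dynkin_D_def)
  moreover have "\<alpha> (n - 1) \<bullet> \<alpha> k = (if k = n - 2 then -1 else if k = n - 1 then 2 else 0)"
    using alpha_inner[of "n - 1" k] alpha_norm[of k] k n by (auto simp: dynkin_D_def)
  ultimately show ?case using k n by (auto simp: eps_def inner_diff_left)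
next
  case (step i)
  have "\<alpha> i \<bullet> \<alpha> k = (if i = k then 2 else if i = Suc k \<or> k = Suc i then -1 else 0)"
    using alpha_inner[of i k] alpha_norm[of k] k step by (auto simp: dynkin_D_def)
  then show ?case using step k by (auto simp: eps_Suc inner_add_left)
qed

text \<open>Start of the induction for orthonormality, in which the second factor is peeled down to
  \<open>eps n \<alpha> n\<close>.\<close>

lemma eps_inner_last:
  assumes j: "1 \<le> j" "j \<le> n"
  shows "eps n \<alpha> j \<bullet> eps n \<alpha> n = of_bool (j = n)"
  using j(2,1)
proof (induction rule: inc_induct)
  case base
  have "\<alpha> n \<bullet> \<alpha> (n - 1) = 0" "\<alpha> n \<bullet> \<alpha> n = 2" "\<alpha> (n - 1) \<bullet> \<alpha> (n - 1) = 2"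
    using alpha_inner[of n "n - 1"] alpha_norm n by (auto simp: dynkin_D_def)
  then show ?case by (simp add: eps_def inner_diff_left inner_diff_right inner_commute)
next
  case (step i)
  have "eps n \<alpha> i \<bullet> eps n \<alpha> n = eps n \<alpha> n \<bullet> \<alpha> i + eps n \<alpha> (Suc i) \<bullet> eps n \<alpha> n"
    using step by (simp add: eps_Suc[of i n \<alpha>] inner_add_left inner_commute[of "\<alpha> i"])
  then show ?case using eps_inner_alpha[of n i] step n by simp
qed

lemma eps_orthonormal:
  assumes j: "1 \<le> j" "j \<le> n" and i: "1 \<le> i" "i \<le> n"
  shows "eps n \<alpha> j \<bullet> eps n \<alpha> i = of_bool (j = i)"
  using i(2,1)
proof (induction rule: inc_induct)
  case base
  then show ?case using eps_inner_last j by blast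
next
  case (step i)
  have "eps n \<alpha> j \<bullet> eps n \<alpha> i = eps n \<alpha> j \<bullet> \<alpha> i + eps n \<alpha> j \<bullet> eps n \<alpha> (Suc i)"
    using step by (simp add: eps_Suc[of i] inner_add_right)
  then show ?case using step eps_inner_alpha[of j i] j by auto
qed

text \<open>Starting from \<open>\<alpha> i\<close>, each further \<open>\<alpha> j\<close> has
  inner product -1 with the partial sum, so adding it stays inside the root system.\<close>

lemma eps_diff_root:
  assumes "1 \<le> i" "i < j" "j \<le> n"
  shows "eps n \<alpha> i - eps n \<alpha> j \<in> \<Phi>"
proof -
  from assms(2) have "Suc i \<le> j" by simp
  then show ?thesis using assms(3)
  proof (induction j rule: dec_induct)
    case base
    then show ?case using alpha_in[of i] assms by (simp add: eps_Suc[of i])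
  next
    case (step j)
    have a: "\<alpha> j = eps n \<alpha> j - eps n \<alpha> (Suc j)" using step by (simp add: eps_Suc[of j])
    have "(eps n \<alpha> i - eps n \<alpha> j) \<bullet> \<alpha> j = -1"
      using step assms eps_inner_alpha[of i j] eps_inner_alpha[of j j]
          by (simp add: inner_diff_left)
    then have "(eps n \<alpha> i - eps n \<alpha> j) + \<alpha> j \<in> \<Phi>"
      using root_sum[of \<Phi> "eps n \<alpha> i - eps n \<alpha> j" "\<alpha> j"] D alpha_in[of j] step
          by (simp add: root_system_D_def)
    then show ?case unfolding a by simp
  qed
qed

lemma beta_root_eps: "(\<Sum>k = 1..n - 2. \<alpha> k) + \<alpha> n = eps n \<alpha> 1 + eps n \<alpha> n"
proof -
  have "{1..n - 2} = {1..<n - 1}" using n by auto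
  then have "(\<Sum>k = 1..n - 2. \<alpha> k) = eps n \<alpha> 1 - eps n \<alpha> (n - 1)"
    using sum_alpha_eps[of 1 "n - 1" n \<alpha>] n by simp
  then show ?thesis using alpha_last_eps[of n \<alpha>] n by simp
qed

lemma eps_sum_root: "eps n \<alpha> 1 + eps n \<alpha> n \<in> \<Phi>"
proof -
  have a: "\<alpha> n = eps n \<alpha> (n - 1) + eps n \<alpha> n" by (rule alpha_last_eps) (use n in simp)
  have "(eps n \<alpha> 1 - eps n \<alpha> (n - 1)) \<bullet> \<alpha> n = -1"
    using n unfolding a by (auto simp: inner_diff_left inner_add_right eps_orthonormal)
  then have "(eps n \<alpha> 1 - eps n \<alpha> (n - 1)) + \<alpha> n \<in> \<Phi>"
    using root_sum[of \<Phi> "eps n \<alpha> 1 - eps n \<alpha> (n - 1)" "\<alpha> n"] D alpha_in[of n] eps_diff_root[of 1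
        "n - 1"] n
    by (simp add: root_system_D_def)
  then show ?thesis unfolding a by simp
qed

text \<open>Everything reduces to labels: \<open>P x\<close> stands for the label of the parent, and
  \<open>\<beta> x\<close> is \<open>eps (L x) - eps (P x)\<close>, or \<open>eps 1 + eps n\<close>
  for the label \<open>n\<close>. Inner products are read off from common indices; independence and
  spanning follow from the triangularity \<open>L x < P x\<close>.\<close>

lemma companion_basis_D:
  fixes \<Gamma> :: "'a quiver" and L P :: "'a \<Rightarrow> nat"
  assumes L: "bij_betw L (verts \<Gamma>) {1..n}"
    and P: "\<And>x. x \<in> verts \<Gamma> \<Longrightarrow> L x < n \<Longrightarrow> L x < P x \<and> P x \<le> n"
    and \<beta>: "\<And>x. x \<in> verts \<Gamma> \<Longrightarrow> L x < n \<Longrightarrow> \<beta> x = (\<Sum>k = L x..<P x. \<alpha> k)"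
    and \<beta>n: "\<And>x. x \<in> verts \<Gamma> \<Longrightarrow> L x = n \<Longrightarrow> \<beta> x = (\<Sum>k = 1..n - 2. \<alpha> k) + \<alpha> n"
    and edge: "\<And>x y. x \<in> verts \<Gamma> \<Longrightarrow> y \<in> verts \<Gamma> \<Longrightarrow> x \<noteq> y \<Longrightarrow> L x < n \<Longrightarrow> L y < n \<Longrightarrow>
      edges \<Gamma> x y = of_bool (P x = L y \<or> P y = L x \<or> P x = P y)"
    and edgen: "\<And>x y. x \<in> verts \<Gamma> \<Longrightarrow> y \<in> verts \<Gamma> \<Longrightarrow> L x < n \<Longrightarrow> L y = n \<Longrightarrow>
      edges \<Gamma> x y = of_bool (L x = 1 \<or> P x = n) \<and> \<not> (L x = 1 \<and> P x = n)"
  shows "companion_basis \<Phi> \<Gamma> \<beta>"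
proof -
  let ?V = "verts \<Gamma>" and ?e = "eps n \<alpha>"
  have fin: "finite ?V" using bij_betw_finite[OF L] by simp
  have Lr: "1 \<le> L x \<and> L x \<le> n" if "x \<in> ?V" for x using bij_betwE[OF L] that by auto
  have Linj: "L x = L y \<longleftrightarrow> x = y" if "x \<in> ?V" "y \<in> ?V" for x y
    using L that by (auto simp: bij_betw_def inj_on_def)
  have b: "\<beta> x = ?e (L x) - ?e (P x)" if "x \<in> ?V" "L x < n" for x
    using \<beta>[OF that] P[OF that] sum_alpha_eps[of "L x" "P x" n \<alpha>] by simp
  have bn: "\<beta> x = ?e 1 + ?e n" if "x \<in> ?V" "L x = n" for x
    using \<beta>n[OF that] beta_root_eps by simp
  have cases: "L x < n \<or> L x = n" if "x \<in> ?V" for x using Lr[OF that] by auto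
  note ortho = eps_orthonormal

  have root: "\<beta> x \<in> \<Phi>" if x: "x \<in> ?V" for x
    using cases[OF x] b[OF x] bn[OF x] eps_diff_root[of "L x" "P x"] eps_sum_root P[OF x] Lr[OF x]
        by auto

  \<comment> \<open>Since \<open>L x < P x\<close> and \<open>L y < P y\<close>, at most one of the
    three coincidences of indices can occur, so the absolute value is the indicator of their
    disjunction.\<close>
  have inner1: "\<bar>\<beta> x \<bullet> \<beta> y\<bar> = real (edges \<Gamma> x y)"
    if x: "x \<in> ?V" "L x < n" and y: "y \<in> ?V" "L y < n" "x \<noteq> y" for x y
  proof -
    have "L x \<noteq> L y" using Linj[OF x(1) y(1)] y by blast
    then have "\<beta> x \<bullet> \<beta> y = of_bool (P x = P y) - of_bool (L x = P y) - of_bool (P x = L y)"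
      unfolding b[OF x] b[OF y(1,2)] using Lr[OF x(1)] Lr[OF y(1)] P[OF x] P[OF y(1,2)]
      by (simp add: inner_diff_left inner_diff_right ortho)
    then show ?thesis unfolding edge[OF x(1) y(1,3) x(2) y(2)]
      using P[OF x] P[OF y(1,2)] by (auto simp: of_bool_def)
  qed
  \<comment> \<open>The indices \<open>1\<close> and \<open>n\<close> contribute with opposite
    signs. The second part of \<open>edgen\<close> excludes that both occur and cancel.\<close>
  have inner2: "\<bar>\<beta> x \<bullet> \<beta> y\<bar> = real (edges \<Gamma> x y)"
    if x: "x \<in> ?V" "L x < n" and y: "y \<in> ?V" "L y = n" for x y
  proof -
    have "\<beta> x \<bullet> \<beta> y = of_bool (L x = 1) - of_bool (P x = n)"
      unfolding b[OF x] bn[OF y] using Lr[OF x(1)] P[OF x] n x(2)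
      by (simp add: inner_diff_left inner_add_right ortho)
    then show ?thesis using edgen[OF x(1) y(1) x(2) y(2)] by auto
  qed
  have inner: "\<bar>\<beta> x \<bullet> \<beta> y\<bar> = real (edges \<Gamma> x y)" if xy: "x \<in> ?V" "y \<in> ?V" "x \<noteq> y" for x y
  proof -
    have "edges \<Gamma> x y = edges \<Gamma> y x" by (simp add: edges_def)
    then show ?thesis
      using cases[OF xy(1)] cases[OF xy(2)] inner1[of x y] inner2[of x y] inner2[of y x] Linj[OF
          xy(1,2)] xy
      by (auto simp: inner_commute)
  qed

  have indep: "\<forall>x\<in>?V. k x = 0" if sum0: "(\<Sum>x\<in>?V. real_of_int (k x) *\<^sub>R \<beta> x) = 0" for k :: "'a \<Rightarrow> int"
  proof -
    have dot: "(\<Sum>x\<in>?V. real_of_int (k x) * (\<beta> x \<bullet> u)) = 0" for u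
      using arg_cong[OF sum0, of "\<lambda>v. v \<bullet> u"] by (simp add: inner_sum_left)
    have top: "k x = 0" if x: "x \<in> ?V" "L x = n" for x
    proof -
      \<comment> \<open>The sum of all \<open>eps i\<close> is orthogonal to every difference of two
        of them and has product 2 with \<open>eps 1 + eps n\<close>, so it isolates the coefficient
        at label \<open>n\<close>.\<close>
      let ?u = "\<Sum>i=1..n. ?e i"
      have eu: "?e j \<bullet> ?u = 1" if "1 \<le> j" "j \<le> n" for j
      proof -
        have "?e j \<bullet> ?u = (\<Sum>i=1..n. if i = j then 1 else 0)"
          unfolding inner_sum_right by (rule sum.cong) (use that in \<open>auto simp: ortho\<close>)
        then show ?thesis using that by simp
      qed
      have "\<beta> y \<bullet> ?u = (if y = x then 2 else 0)" if y: "y \<in> ?V" for y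
      proof (cases "y = x")
        case True
        then show ?thesis using bn[OF x] eu n by (simp add: inner_add_left)
      next
        case False
        then have "L y < n" using cases[OF y] Linj[OF y x(1)] x by auto
        then show ?thesis using False b[OF y] eu P[OF y] Lr[OF y] by (simp add: inner_diff_left)
      qed
      then have "(\<Sum>y\<in>?V. real_of_int (k y) * (\<beta> y \<bullet> ?u)) = (\<Sum>y\<in>?V. if y = x then 2 * real_of_int
          (k y) else 0)"
        by (intro sum.cong) auto
      then have "2 * real_of_int (k x) = 0" using dot[of ?u] fin x by simp
      then show ?thesis by simp
    qed
    have "k x = 0" if "x \<in> ?V" for x
      using that
    proof (induction "L x" arbitrary: x rule: less_induct)
      case less
      show ?case
      proof (cases "L x = n")
        case True
        then show ?thesis using top less.prems by blast
      next
        case False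
        then have x: "x \<in> ?V" "L x < n" using less.prems cases by auto
        \<comment> \<open>Pairing with \<open>eps (L x)\<close> isolates \<open>k x\<close>: smaller
          labels have coefficient 0 by induction, label \<open>n\<close> by the previous step, and
          for the others \<open>L x \<le> L y < P y\<close> leaves only the index
          \<open>L y\<close>.\<close>
        have "real_of_int (k y) * (\<beta> y \<bullet> ?e (L x)) = (if y = x then real_of_int (k x) else 0)"
            if y: "y \<in> ?V" for y
        proof (cases "L y < L x \<or> L y = n")
          case True
          then have "k y = 0" using less.hyps[OF _ y] top[OF y] by blast
          moreover have "y \<noteq> x" using True x by auto
          ultimately show ?thesis by simp
        next
          case F: False
          then have "L y < n" "L x \<le> L y" using cases[OF y] by auto
          then have "\<beta> y \<bullet> ?e (L x) = of_bool (L y = L x)"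
            using b[OF y] P[OF y] Lr[OF y] Lr[OF x(1)] by (simp add: inner_diff_left ortho)
          then show ?thesis using Linj[OF y x(1)] by auto
        qed
        then have "(\<Sum>y\<in>?V. real_of_int (k y) * (\<beta> y \<bullet> ?e (L x))) = (\<Sum>y\<in>?V.
            if y = x then real_of_int (k x) else 0)"
          by (intro sum.cong) auto
        then show ?thesis using dot[of "?e (L x)"] fin x by simp
      qed
    qed
    then show ?thesis by blast
  qed

  let ?Z = "int_span ?V \<beta>"
  have base: "\<beta> x \<in> ?Z" if "x \<in> ?V" for x using int_span_base[OF fin that] .
  have vert: "\<exists>x\<in>?V. L x = i" if "1 \<le> i" "i \<le> n" for i
    using L that by (metis atLeastAtMost_iff bij_betw_def imageE)
  have diff: "?e i - ?e n \<in> ?Z" if "1 \<le> i" "i \<le> n" for i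
    using that
  proof (induction "n - i" arbitrary: i rule: less_induct)
    case less
    show ?case
    proof (cases "i = n")
      case True
      then show ?thesis by (simp add: int_span_zero)
    next
      case False
      obtain x where x: "x \<in> ?V" "L x = i" using vert less.prems by blast
      have Px: "i < P x" "P x \<le> n" using P[OF x(1)] x less.prems False by auto
      have "\<beta> x + (?e (P x) - ?e n) \<in> ?Z"
        using less.hyps[of "P x"] Px less.prems by (intro int_span_add base x) auto
      then show ?thesis using b[OF x(1)] x less.prems False by simp
    qed
  qed
  have alpha: "\<alpha> i \<in> ?Z" if i: "i \<in> {1..n}" for i
  proof (cases "i = n")
    case True
    obtain x where x: "x \<in> ?V" "L x = n" using vert[of n] n by auto
    \<comment> \<open>Subtracting \<open>eps 1 - eps n\<close> from the vector at label
      \<open>n\<close> leaves \<open>2 eps n\<close>, so the whole is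
      \<open>eps (n - 1) + eps n\<close>.\<close>
    have "(?e (n - 1) - ?e n) + (\<beta> x - (?e 1 - ?e n)) \<in> ?Z"
      using n by (intro int_span_add int_span_diff diff base x) auto
    moreover have "(?e (n - 1) - ?e n) + (\<beta> x - (?e 1 - ?e n)) = \<alpha> n"
      using bn[OF x] alpha_last_eps[of n \<alpha>] n by simp
    ultimately show ?thesis using True by simp
  next
    case False
    have "(?e i - ?e n) - (?e (Suc i) - ?e n) \<in> ?Z" using i False by (intro int_span_diff diff) auto
    then show ?thesis using eps_Suc[of i n \<alpha>] i False by simp
  qed
  have simple: "simple_system \<Phi> n \<alpha>" and finPhi: "finite \<Phi>"
    using D by (auto simp: root_system_D_def root_system_def)
  have "root_lattice \<Phi> = ?Z"
  proof
    show "root_lattice \<Phi> \<subseteq> ?Z"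
      using root_lattice_simple_system[OF simple] int_span_subset[of "{1..n}" \<alpha> ?V \<beta>] alpha by blast
    show "?Z \<subseteq> root_lattice \<Phi>"
      unfolding root_lattice_int_span by (rule int_span_subset) (rule int_span_base[OF finPhi root])
  qed
  then have "int_basis (root_lattice \<Phi>) ?V \<beta>"
    using indep unfolding int_basis_def int_span_def by blast
  then show ?thesis using root inner unfolding companion_basis_def by blast
qed

end

section \<open>Type IV quivers\<close>

text \<open>The central cycle without its closing arrow is the left spine, from \<open>w 0\<close>
  at the bottom up to the root. A branch \<open>U j\<close> is the sibling of \<open>w j\<close>
  below \<open>w (Suc j)\<close>, so that the arrows of this node are those of the spike on
  \<open>w j -> w (Suc j)\<close>.\<close>

fun spine :: "(nat \<Rightarrow> 'a) \<Rightarrow> (nat \<Rightarrow> 'a tree) \<Rightarrow> nat \<Rightarrow> 'a tree" where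
  "spine w U 0 = \<langle>Leaf, w 0, Leaf\<rangle>"
| "spine w U (Suc j) = \<langle>spine w U j, w (Suc j), U j\<rangle>"

lemma roots_spine: "roots (spine w U j) = {w j}"
  by (cases j) simp_all

lemma set_tree_spine: "set_tree (spine w U j) = w ` {..j} \<union> (\<Union>i<j. set_tree (U i))"
  by (induction j) (simp_all add: atMost_Suc lessThan_Suc Un_ac)

lemma tree_arrows_spine:
  "(u, v) \<in> tree_arrows (spine w U j) \<longleftrightarrow>
     (\<exists>i<j. u = w i \<and> v = w (Suc i) \<or> u = w (Suc i) \<and> v \<in> roots (U i) \<or>
       u \<in> roots (U i) \<and> v = w i \<or> (u, v) \<in> tree_arrows (U i))"
  by (induction j) (simp, simp add: roots_spine less_Suc_eq, blast)

lemma distinct_spine: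
  assumes "inj_on w {..j}" "\<And>i. i < j \<Longrightarrow> distinct_tree (U i)"
    and "\<And>i. i < j \<Longrightarrow> w ` {..j} \<inter> set_tree (U i) = {}"
    and "\<And>i k. i < j \<Longrightarrow> k < j \<Longrightarrow> i \<noteq> k \<Longrightarrow> set_tree (U i) \<inter> set_tree (U k) = {}"
  shows "distinct_tree (spine w U j)"
  using assms
proof (induction j)
  case (Suc j)
  have a: "{..Suc j} = insert (Suc j) {..j}" by auto
  have sub: "w ` {..j} \<subseteq> w ` {..Suc j}" by auto
  have "distinct_tree (spine w U j)"
  proof (rule Suc.IH)
    show "inj_on w {..j}" using Suc.prems(1) by (rule inj_on_subset) auto
    show "w ` {..j} \<inter> set_tree (U i) = {}" if "i < j" for i
      using Suc.prems(3)[of i] that sub by fastforce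
  qed (use Suc.prems(2,4) in simp_all)
  moreover have "w (Suc j) \<notin> set_tree (spine w U j)"
  proof
    assume "w (Suc j) \<in> set_tree (spine w U j)"
    then consider i where "i \<le> j" "w (Suc j) = w i" | i where "i < j" "w (Suc j) \<in> set_tree (U i)"
      unfolding set_tree_spine by blast
    then show False
    proof cases
      case 1
      then show False using inj_onD[OF Suc.prems(1), of "Suc j" i] by simp
    next
      case 2
      then show False using Suc.prems(3)[of i] by auto
    qed
  qed
  moreover have "w (Suc j) \<notin> set_tree (U j)" using Suc.prems(3)[of j] by auto
  moreover have "set_tree (spine w U j) \<inter> set_tree (U j) = {}"
  proof -
    have "w ` {..j} \<inter> set_tree (U j) = {}" using Suc.prems(3)[of j] sub by blast
    moreover have "set_tree (U i) \<inter> set_tree (U j) = {}" if "i < j" for i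
        using Suc.prems(4)[of i j] that by simp
    ultimately show ?thesis unfolding set_tree_spine by blast
  qed
  ultimately show ?case using Suc.prems(2)[of j] by auto
qed simp

lemma subtree_spine: "i < j \<Longrightarrow> U i \<in> subtrees (spine w U j)"
  by (induction j) (auto simp: less_Suc_eq subtrees_self)

lemma tree_parents_spine:
  "i < j \<Longrightarrow> (w i, w (Suc i)) \<in> tree_parents (spine w U j)"
  "i < j \<Longrightarrow> x \<in> roots (U i) \<Longrightarrow> (x, w (Suc i)) \<in> tree_parents (spine w U j)"
  by (induction j) (auto simp: less_Suc_eq roots_spine)

text \<open>The spine below \<open>w (Suc j)\<close> is visited before the branch
  \<open>U j\<close>. Its size is the label of its root \<open>w j\<close>, which is therefore the
  offset of the branch.\<close>

lemma postorder_labelled_spine: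
  assumes "L (w 0) = 1" "\<And>i. i < j \<Longrightarrow> L (w (Suc i)) = L (w i) + size (U i) + 1"
    and "\<And>i. i < j \<Longrightarrow> postorder_labelled (U i) (L (w i)) L"
  shows "postorder_labelled (spine w U j) 0 L"
  using assms
proof (induction j)
  case (Suc j)
  then have "postorder_labelled (spine w U j) 0 L" by simp
  moreover from this have "L (w j) = size (spine w U j)"
    using postorder_labelled_root[of "spine w U j" 0 L "w j"] by (simp add: roots_spine)
  ultimately show ?case using Suc.prems(2)[of j] Suc.prems(3)[of j] by simp
qed simp

lemma tree_parents_not_root: "distinct_tree t \<Longrightarrow> (u, v) \<in> tree_parents t \<Longrightarrow> u \<notin> roots t"
proof (cases t)
  case (Node l x r)
  assume "distinct_tree t" "(u, v) \<in> tree_parents t"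
  moreover have "node_of x l r t" using Node by (simp add: node_of_def)
  ultimately show ?thesis using tree_parents_root(1)[of x l r t] Node by auto
qed simp

lemma size_eq_card: "distinct_tree t \<Longrightarrow> card (set_tree t) = size t"
  by (metis distinct_card length_inorder set_inorder)

text \<open>Mutation leaves the vertex set alone. This identifies \<open>n\<close> with the number
  of vertices.\<close>

lemma card_verts_mutation_type:
  assumes "has_mutation_type Q n adj"
  shows "card (verts Q) = n"
proof -
  obtain Q0 where Q0: "has_underlying_graph Q0 n adj" "mutation_reachable Q0 Q"
    using assms unfolding has_mutation_type_def by blast
  have "verts Q = verts Q0" using Q0(2) by induction (simp_all add: mutate_def)
  then show ?thesis using Q0(1) bij_betw_same_card unfolding has_underlying_graph_def by fastforce
qed

section \<open>A labelled type IV quiver as a tree with one extra arrow\<close>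

context
  fixes \<Gamma> :: "'a quiver" and m r :: nat and w :: "nat \<Rightarrow> 'a" and q :: "nat \<Rightarrow> nat"
    and c :: "nat \<Rightarrow> 'a" and G :: "nat \<Rightarrow> 'a quiver" and lab :: "'a \<Rightarrow> nat"
  assumes IV: "type_IV \<Gamma> m r w q c G" and labelling: "type_IV_labelling m r w q c G lab"
begin

lemma type_IV_skeleton:
  "m \<ge> 3" "inj_on w {..<m}" "\<And>i j. i < m \<Longrightarrow> j \<in> {1..r} \<Longrightarrow> w i \<noteq> c j" "inj_on q {1..r}"
  using IV strict_mono_on_imp_inj_on[of "{1..r}" q] by (auto simp: type_IV_def skeleton_data_def)

lemmas type_IV_branch = IV[unfolded type_IV_def, THEN conjunct2, THEN conjunct1, THEN bspec]
  and type_IV_disjoint = IV[unfolded type_IV_def, THEN conjunct2, THEN conjunct2, THEN conjunct1,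
      THEN bspec, THEN bspec, THEN mp]
  and type_IV_verts = IV[unfolded type_IV_def, THEN conjunct2, THEN conjunct2, THEN conjunct2,
      THEN conjunct1]
  and type_IV_arrs = IV[unfolded type_IV_def, THEN conjunct2, THEN conjunct2, THEN conjunct2, THEN
      conjunct2, THEN spec, THEN spec]
  and lab_first = labelling[unfolded type_IV_labelling_def, THEN conjunct2, THEN conjunct1]
  and step_labelling = labelling[unfolded type_IV_labelling_def, THEN conjunct2, THEN conjunct2,
      THEN conjunct1, THEN spec, THEN mp]
  and spike_labelling = labelling[unfolded type_IV_labelling_def, THEN conjunct2, THEN conjunct2,
      THEN conjunct2, THEN conjunct1, THEN bspec]
  and branch_labelling = labelling[unfolded type_IV_labelling_def, THEN conjunct2, THEN conjunct2,
      THEN conjunct2, THEN conjunct2, THEN bspec]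

lemma type_IV_w_eq: "i < m \<Longrightarrow> j < m \<Longrightarrow> w i = w j \<longleftrightarrow> i = j"
  using type_IV_skeleton(2) by (auto simp: inj_on_def)

text \<open>The first spike starts at \<open>w 0\<close>, and the condition that the last one does
  not end there keeps all spikes off the closing arrow \<open>w (m - 1) -> w 0\<close>. Hence
  \<open>Suc (q i) mod m\<close> is \<open>Suc (q i)\<close>, and cutting that arrow destroys no
  spike.\<close>

lemma spike_before_last:
  assumes i: "i \<in> {1..r}"
  shows "q i < m - 1"
proof -
  have sd: "skeleton_data m r w q c" using IV by (simp add: type_IV_def)
  have r: "r \<in> {1..r}" using i by simp
  have "q i \<le> q r" using sd i r strict_mono_on_leD[of "{1..r}" q i r]
      by (simp add: skeleton_data_def)
  moreover have "q r < m" using sd r unfolding skeleton_data_def by blast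
  moreover have "Suc (q r) \<noteq> m"
  proof
    assume "Suc (q r) = m"
    then have "spike_s m w q r = w 0" by (simp add: spike_s_def)
    moreover have "spike_p w q 1 = w 0" "spike_p w q 1 \<noteq> spike_s m w q r"
      using labelling r unfolding type_IV_labelling_def spike_p_def by auto
    ultimately show False by simp
  qed
  ultimately show ?thesis by simp
qed

lemma type_IV_branch_trees:
  "\<exists>S. \<forall>i\<in>{1..r}. distinct_tree (S i) \<and> roots (S i) = {c i} \<and> G i = tree_quiver (S i) \<and>
     postorder_labelled (S i) (lab (w (q i))) lab"
proof (rule bchoice)
  show "\<forall>i\<in>{1..r}. \<exists>t. distinct_tree t \<and> roots t = {c i} \<and> G i = tree_quiver t \<and>
      postorder_labelled t (lab (w (q i))) lab"
  proof
    fix i assume i: "i \<in> {1..r}"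
    have A: "mutation_type_A (card (verts (G i))) (G i)" "end_vertex (G i) (c i)"
      using type_IV_branch[OF i] by simp_all
    obtain t where t: "distinct_tree t" "roots t = {c i}" "G i = tree_quiver t"
      using mutation_type_A_end_vertex[OF A] by blast
    obtain e L where L: "type_A_labelling (G i) e (c i) L" "\<And>x. x \<in> verts (G i)
        \<Longrightarrow> lab x = lab (w (q i)) + L x"
      using branch_labelling[OF i] unfolding spike_p_def by (elim exE conjE) simp
    have "postorder_labelled t 0 L" using type_A_labelling_postorder[OF L(1) t(1,3)] t(2) by simp
    then have "postorder_labelled t (lab (w (q i)) + 0) lab"
      by (rule postorder_labelled_shift) (use L(2) t(3) in simp)
    then show "\<exists>t. distinct_tree t \<and> roots t = {c i} \<and> G i = tree_quiver t \<and>
        postorder_labelled t (lab (w (q i))) lab" using t by auto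
  qed
qed


text \<open>Without the closing arrow, the quiver is the spine whose branches are the trees of the
  \<open>G i\<close>. The labelling rules for the central cycle and for the branches combine to one
  postorder labelling.\<close>

lemma type_IV_spine:
  "\<exists>U. distinct_tree (spine w U (m - 1)) \<and> postorder_labelled (spine w U (m - 1)) 0 lab \<and>
    \<Gamma> = quiver_of (set_tree (spine w U (m - 1))) (insert (w (m - 1), w 0) (tree_arrows (spine w U
        (m - 1)))) \<and>
    (\<forall>i\<in>{1..r}. G i = tree_quiver (U (q i)) \<and> roots (U (q i)) = {c i} \<and>
       lab (w (Suc (q i))) = lab (w (q i)) + size (U (q i)) + 1 \<and>
       postorder_labelled (U (q i)) (lab (w (q i))) lab) \<and>
    (\<forall>j<m - 1. j \<notin> q ` {1..r} \<longrightarrow> U j = Leaf \<and> lab (w (Suc j)) = lab (w j) + 1)"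
proof -
  obtain S where S_all: "\<forall>i\<in>{1..r}. distinct_tree (S i) \<and> roots (S i) = {c i}
      \<and> G i = tree_quiver (S i) \<and>
     postorder_labelled (S i) (lab (w (q i))) lab"
    using type_IV_branch_trees by (elim exE)
  have S: "distinct_tree (S i)" "roots (S i) = {c i}" "G i = tree_quiver (S i)"
    "postorder_labelled (S i) (lab (w (q i))) lab" if "i \<in> {1..r}" for i
    using bspec[OF S_all that] by simp_all
  \<comment> \<open>A cycle arrow without a spike gets the empty tree; the spine then treats all
    positions alike.\<close>
  define U where "U j = (if j \<in> q ` {1..r} then S (the_inv_into {1..r} q j) else Leaf)" for j
  have Uq: "U (q i) = S i" if "i \<in> {1..r}" for i
    using that the_inv_into_f_f[OF type_IV_skeleton(4) that] by (simp add: U_def)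
  have Un: "U j = Leaf" if "j \<notin> q ` {1..r}" for j using that by (simp add: U_def)
  let ?M = "m - 1" and ?T = "spine w U (m - 1)"
  have m: "{..<m} = {..?M}" using type_IV_skeleton(1) by auto
  have skel: "verts (skeleton m r w q c) = w ` {..?M} \<union> c ` {1..r}" by (simp add: skeleton_def m)
  have Gs: "verts (G i) \<inter> (w ` {..?M} \<union> c ` {1..r}) = {c i}" if "i \<in> {1..r}" for i
    using type_IV_branch[OF that] by (simp only: skel)
  have Gd: "verts (G i) \<inter> verts (G j) = {}" if "i \<in> {1..r}" "j \<in> {1..r}" "i \<noteq> j" for i j
    by (rule type_IV_disjoint[OF that])
  have Sv: "set_tree (S i) = verts (G i)" if "i \<in> {1..r}" for i using S(3)[OF that] by simp
  have wc: "w i \<noteq> c j" if "i \<le> ?M" "j \<in> {1..r}" for i j using type_IV_skeleton(1,3) that by simp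
  have Sw: "w ` {..?M} \<inter> set_tree (S i) = {}" if "i \<in> {1..r}" for i
    using Gs[OF that] Sv[OF that] wc[OF _ that] by blast
  have Ucases: "U j = Leaf \<or> (\<exists>i\<in>{1..r}. j = q i \<and> U j = S i)" for j
  proof (cases "j \<in> q ` {1..r}")
    case True
    then obtain i where "i \<in> {1..r}" "j = q i" by (elim imageE)
    then show ?thesis by (intro disjI2 bexI[of _ i]) (simp_all only: Uq simp_thms)
  qed (simp add: Un)
  have Uelim: "P (U j)" if "P Leaf" "\<And>i. i \<in> {1..r} \<Longrightarrow> j = q i \<Longrightarrow> P (S i)" for P j
    using Ucases[of j] by (elim disjE bexE conjE) (simp_all only: that)

  have lab_spike: "lab (w (Suc (q i))) = lab (w (q i)) + size (S i) + 1" if i: "i \<in> {1..r}" for i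
  proof -
    have "spike_s m w q i = w (Suc (q i))" using spike_before_last[OF i] by (simp add: spike_s_def)
    then show ?thesis
      using spike_labelling[OF i] size_eq_card[OF S(1)[OF i]] Sv[OF i] by (simp add: spike_p_def)
  qed
  have lab_step: "lab (w (Suc j)) = lab (w j) + 1" if "j < ?M" "j \<notin> q ` {1..r}" for j
    using that by (intro step_labelling) simp

  have dist: "distinct_tree ?T"
  proof (rule distinct_spine)
    show "inj_on w {..?M}" using type_IV_skeleton(2) by (simp only: m)
    show "distinct_tree (U i)" for i by (rule Uelim) (simp_all only: S inorder.simps distinct.simps)
    show "w ` {..?M} \<inter> set_tree (U i) = {}" for i
      by (rule Uelim[where P = "\<lambda>t. w ` {..?M} \<inter> set_tree t = {}"]) (simp, rule Sw)
    show "set_tree (U i) \<inter> set_tree (U k) = {}" if ik: "i \<noteq> k" for i k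
    proof (rule Uelim[where P = "\<lambda>t. set_tree t \<inter> set_tree (U k) = {}"])
      fix a assume a: "a \<in> {1..r}" "i = q a"
      show "set_tree (S a) \<inter> set_tree (U k) = {}"
      proof (rule Uelim[where P = "\<lambda>t. set_tree (S a) \<inter> set_tree t = {}"])
        fix b assume b: "b \<in> {1..r}" "k = q b"
        then have "a \<noteq> b" using a ik by blast
        then show "set_tree (S a) \<inter> set_tree (S b) = {}" unfolding Sv[OF a(1)] Sv[OF b(1)]
            by (rule Gd[OF a(1) b(1)])
      qed simp
    qed simp
  qed
  have post: "postorder_labelled ?T 0 lab"
  proof (rule postorder_labelled_spine)
    show "lab (w 0) = 1" by (rule lab_first)
    show "lab (w (Suc i)) = lab (w i) + size (U i) + 1" if "i < ?M" for i
    proof (cases "i \<in> q ` {1..r}")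
      case True
      then obtain k where "k \<in> {1..r}" "i = q k" by (elim imageE)
      then show ?thesis by (simp only: Uq lab_spike)
    qed (use that in \<open>simp add: Un lab_step\<close>)
    show "postorder_labelled (U i) (lab (w i)) lab" for i
      by (rule Uelim) (simp_all only: S postorder_labelled.simps)
  qed
  have UN: "(\<Union>j<?M. set_tree (U j)) = (\<Union>i\<in>{1..r}. verts (G i))"
  proof (intro equalityI subsetI)
    fix x assume "x \<in> (\<Union>j<?M. set_tree (U j))"
    then obtain j where "x \<in> set_tree (U j)" by blast
    moreover have "x \<in> set_tree (U j) \<longrightarrow> x \<in> (\<Union>i\<in>{1..r}. verts (G i))"
      by (rule Uelim) (simp, blast dest: Sv)
    ultimately show "x \<in> (\<Union>i\<in>{1..r}. verts (G i))" by blast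
  next
    fix x assume "x \<in> (\<Union>i\<in>{1..r}. verts (G i))"
    then obtain i where "i \<in> {1..r}" "x \<in> verts (G i)" by blast
    then show "x \<in> (\<Union>j<?M. set_tree (U j))" by (intro UN_I[of
        "q i"]) (simp_all only: spike_before_last lessThan_iff Uq Sv)
  qed
  have "c ` {1..r} \<subseteq> (\<Union>i\<in>{1..r}. verts (G i))" using Gs by blast
  then have V: "verts \<Gamma> = set_tree ?T"
    unfolding type_IV_verts skel set_tree_spine UN by blast

  \<comment> \<open>The \<open>G i\<close> are disjoint, so at most one summand is nonzero.\<close>
  have sum_arrs: "(\<Sum>i\<in>{1..r}. arrs (G i) u v) = of_bool (\<exists>i\<in>{1..r}. (u, v) \<in> tree_arrows (S i))"
      for u v
  proof (cases "\<exists>i\<in>{1..r}. (u, v) \<in> tree_arrows (S i)")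
    case True
    then obtain i where i: "i \<in> {1..r}" "(u, v) \<in> tree_arrows (S i)" by blast
    have "arrs (G j) u v = (if j = i then 1 else 0)" if j: "j \<in> {1..r}" for j
    proof (cases "j = i")
      case False
      have "u \<in> verts (G i)" using tree_arrows_in[OF i(2)] Sv[OF i(1)] by blast
      then have "u \<notin> set_tree (S j)" using Gd[OF i(1) j] Sv[OF j] False by blast
      then show ?thesis using False S(3)[OF j] by (simp add: tree_arrows_notin)
    qed (use i S(3) in simp)
    then have "(\<Sum>j\<in>{1..r}. arrs (G j) u v) = (\<Sum>j\<in>{1..r}. if j = i then 1 else 0)"
        by (rule sum.cong[OF refl])
    then show ?thesis using True i by simp
  next
    case False
    then have "arrs (G i) u v = 0" if "i \<in> {1..r}" for i using S(3)[OF that] that by simp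
    then show ?thesis using False by simp
  qed
  have skel_arrs: "arrs (skeleton m r w q c) u v = of_bool (u = w ?M \<and> v = w 0 \<or>
     (\<exists>j<?M. u = w j \<and> v = w (Suc j)) \<or>
     (\<exists>i\<in>{1..r}. u = w (Suc (q i)) \<and> v = c i \<or> u = c i \<and> v = w (q i)))" for u v
  proof -
    \<comment> \<open>The index \<open>j = m - 1\<close> is the wrap-around that gives the closing
      arrow.\<close>
    have "(\<exists>j<m. u = w j \<and> v = w (Suc j mod m)) \<longleftrightarrow> u = w ?M \<and> v = w 0 \<or> (\<exists>j<?M. u = w j
        \<and> v = w (Suc j))"
    proof -
      have "{..<m} = insert ?M {..<?M}" using type_IV_skeleton(1) by auto
      then have split: "(\<exists>j<m. P j) \<longleftrightarrow> P ?M \<or> (\<exists>j<?M. P j)" for P by (metis insert_iff lessThan_iff)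
      have last: "Suc ?M mod m = 0" using type_IV_skeleton(1) by simp
      have "(\<exists>j<?M. u = w j \<and> v = w (Suc j mod m)) \<longleftrightarrow> (\<exists>j<?M. u = w j \<and> v = w (Suc j))"
        by (intro ex_cong conj_cong refl) simp
      then show ?thesis by (simp only: split last)
    qed
    moreover have "spike_s m w q i = w (Suc (q i))" if "i \<in> {1..r}" for i
      using spike_before_last[OF that] by (simp add: spike_s_def)
    then have "(\<exists>i\<in>{1..r}. u = spike_s m w q i \<and> v = c i \<or> u = c i \<and> v = spike_p w q i) \<longleftrightarrow>
       (\<exists>i\<in>{1..r}. u = w (Suc (q i)) \<and> v = c i \<or> u = c i \<and> v = w (q i))"
      by (simp add: spike_p_def)
    ultimately show ?thesis by (simp add: skeleton_def of_bool_def disj_assoc)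
  qed
  have tree_arrs: "(u, v) \<in> tree_arrows ?T \<longleftrightarrow> (\<exists>j<?M. u = w j \<and> v = w (Suc j)) \<or>
     (\<exists>i\<in>{1..r}. u = w (Suc (q i)) \<and> v = c i \<or> u = c i \<and> v = w (q i)) \<or>
     (\<exists>i\<in>{1..r}. (u, v) \<in> tree_arrows (S i))" for u v
  proof -
    \<comment> \<open>Positions without a spike carry \<open>Leaf\<close> and contribute nothing, so
      quantification over positions turns into quantification over spikes.\<close>
    have "(\<exists>j<?M. P j (U j)) \<longleftrightarrow> (\<exists>i\<in>{1..r}. P (q i) (S i))" if "\<And>j. \<not> P j Leaf" for P
      using that Ucases Uq spike_before_last by metis
    note U_iff = this
    have "(u, v) \<in> tree_arrows ?T \<longleftrightarrow> (\<exists>j<?M. u = w j \<and> v = w (Suc j)) \<or>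
       (\<exists>j<?M. u = w (Suc j) \<and> v \<in> roots (U j) \<or> u \<in> roots (U j) \<and> v = w j
           \<or> (u, v) \<in> tree_arrows (U j))"
      unfolding tree_arrows_spine by blast
    also have "(\<exists>j<?M. u = w (Suc j) \<and> v \<in> roots (U j) \<or> u \<in> roots (U j) \<and> v = w j
        \<or> (u, v) \<in> tree_arrows (U j))
      \<longleftrightarrow> (\<exists>i\<in>{1..r}. u = w (Suc (q i)) \<and> v \<in> roots (S i) \<or> u \<in> roots (S i) \<and> v = w (q i)
          \<or> (u, v) \<in> tree_arrows (S i))"
      by (rule U_iff) simp
    also have "\<dots> \<longleftrightarrow> (\<exists>i\<in>{1..r}. u = w (Suc (q i)) \<and> v = c i \<or> u = c i \<and> v = w (q i)) \<or>
       (\<exists>i\<in>{1..r}. (u, v) \<in> tree_arrows (S i))"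
      using S(2) by auto
    finally show ?thesis .
  qed
  \<comment> \<open>An arrow common to the skeleton and a branch would have both ends at
    \<open>c i\<close>, the only shared vertex, and be a loop. Hence no arrow is counted
    twice.\<close>
  have disj: "\<not> (arrs (skeleton m r w q c) u v > 0 \<and> (u, v) \<in> tree_arrows (S i))" if i:
      "i \<in> {1..r}" for u v i
  proof
    assume a: "arrs (skeleton m r w q c) u v > 0 \<and> (u, v) \<in> tree_arrows (S i)"
    let ?A = "w ` {..?M} \<union> c ` {1..r}"
    have wA: "w j \<in> ?A" if "j \<le> ?M" for j using that by blast
    have cA: "c k \<in> ?A" and qA: "w (Suc (q k)) \<in> ?A" "w (q k) \<in> ?A" if "k \<in> {1..r}" for k
      using that spike_before_last[OF that] by (blast, auto intro!: wA)
    have "u = w ?M \<and> v = w 0 \<or> (\<exists>j<?M. u = w j \<and> v = w (Suc j)) \<or>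
       (\<exists>i\<in>{1..r}. u = w (Suc (q i)) \<and> v = c i \<or> u = c i \<and> v = w (q i))"
      using a by (simp only: skel_arrs zero_less_of_bool_iff)
    then have "u \<in> ?A \<and> v \<in> ?A"
      by (elim disjE exE bexE conjE) (simp_all only: wA cA qA le0 le_refl Suc_leI less_imp_le
          simp_thms)
    moreover have "u \<in> verts (G i)" "v \<in> verts (G i)" using a tree_arrows_in[of u v
        "S i"] Sv[OF i] by auto
    ultimately have "u = c i" "v = c i" using Gs[OF i] by blast+
    then show False using a tree_arrows_irrefl[OF S(1)[OF i]] by simp
  qed
  have "\<Gamma> = quiver_of (set_tree ?T) (insert (w ?M, w 0) (tree_arrows ?T))"
  proof (rule quiver_eqI)
    fix u v
    have "arrs \<Gamma> u v = arrs (skeleton m r w q c) u v + of_bool (\<exists>i\<in>{1..r}. (u, v) \<in> tree_arrows (S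
        i))"
      by (simp only: type_IV_arrs sum_arrs)
    also have "\<dots> = of_bool (arrs (skeleton m r w q c) u v > 0 \<or> (\<exists>i\<in>{1..r}. (u, v) \<in> tree_arrows
        (S i)))"
    proof (cases "\<exists>i\<in>{1..r}. (u, v) \<in> tree_arrows (S i)")
      case True
      then obtain i where "i \<in> {1..r}" "(u, v) \<in> tree_arrows (S i)" by (elim bexE)
      then have "arrs (skeleton m r w q c) u v = 0" using disj[of i u v] by (metis gr0I)
      with True show ?thesis by simp
    next
      case False
      have "arrs (skeleton m r w q c) u v \<le> 1" unfolding skeleton_def by simp
      with False show ?thesis by (cases "arrs (skeleton m r w q c) u v = 0") simp_all
    qed
    also have "\<dots> = of_bool ((u, v) \<in> insert (w ?M, w 0) (tree_arrows ?T))"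
      by (simp only: skel_arrs tree_arrs insert_iff prod.inject zero_less_of_bool_iff disj_assoc)
    finally show "arrs \<Gamma> u v = arrs (quiver_of (set_tree ?T) (insert (w ?M, w 0) (tree_arrows
        ?T))) u v" by simp
  qed (simp add: V)
  with dist post show ?thesis
    using S lab_spike lab_step Un by (intro exI[of _ U] conjI ballI allI impI) (simp_all add: Uq)
qed

end

section \<open>Parents and root vectors in a labelled type IV quiver\<close>

theorem theorem4p5:
  fixes \<Gamma> :: "'a quiver" and n m r :: nat
    and w :: "nat \<Rightarrow> 'a" and q :: "nat \<Rightarrow> nat" and c :: "nat \<Rightarrow> 'a"
    and G :: "nat \<Rightarrow> 'a quiver" and lab :: "'a \<Rightarrow> nat"
    and \<Phi> :: "'v::real_inner set" and \<alpha> :: "nat \<Rightarrow> 'v"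
  assumes "n \<ge> 4"
    and "mutation_type_D n \<Gamma>"
    and "type_IV \<Gamma> m r w q c G"
    and "r < m"
    and "type_IV_labelling m r w q c G lab"
    and "root_system_D n \<Phi> \<alpha>"
  shows "companion_basis \<Phi> \<Gamma> (beta_IV n r w q G lab \<alpha>)"
proof -
  note IV = assms(3) and lbl = assms(5)
  let ?M = "m - 1"
  obtain U where dist: "distinct_tree (spine w U ?M)" and post: "postorder_labelled (spine w U ?M)
      0 lab"
    and \<Gamma>: "\<Gamma> = quiver_of (set_tree (spine w U ?M)) (insert (w ?M, w 0) (tree_arrows (spine w U
        ?M)))"
    and spikes: "\<forall>i\<in>{1..r}. G i = tree_quiver (U (q i)) \<and> roots (U (q i)) = {c i} \<and>
       lab (w (Suc (q i))) = lab (w (q i)) + size (U (q i)) + 1 \<and>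
       postorder_labelled (U (q i)) (lab (w (q i))) lab"
    and rest: "\<forall>j<?M. j \<notin> q ` {1..r} \<longrightarrow> U j = Leaf \<and> lab (w (Suc j)) = lab (w j) + 1"
    using type_IV_spine[OF IV lbl] by (elim exE conjE)
  define T where "T = spine w U ?M"
  note dist = dist[folded T_def] and post = post[folded T_def] and \<Gamma> = \<Gamma>[folded T_def]
  have m3: "?M \<ge> 2" using type_IV_skeleton(1)[OF IV lbl] by simp
  have weq: "w i = w j \<longleftrightarrow> i = j" if "i \<le> ?M" "j \<le> ?M" for i j
    using type_IV_w_eq[OF IV lbl, of i j] that m3 by simp
  have V: "verts \<Gamma> = set_tree T" by (simp add: \<Gamma>)
  have TV: "set_tree T = w ` {..?M} \<union> (\<Union>i<?M. set_tree (U i))" by (simp add: T_def set_tree_spine)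
  have rootT: "roots T = {w ?M}" by (simp add: T_def roots_spine)
  have wT: "w j \<in> set_tree T" if "j \<le> ?M" for j using that by (auto simp: TV)
  have qM: "q i < ?M" if "i \<in> {1..r}" for i by (rule spike_before_last[OF IV lbl that])

  have nT: "size T = n"
    using card_verts_mutation_type[of \<Gamma> n "dynkin_D n"] assms(2) size_eq_card[OF dist] V
    by (simp add: mutation_type_D_def)
  have inj: "inj_on lab (set_tree T)" by (rule postorder_labelled_inj[OF post])
  have labeq: "lab x = lab y \<longleftrightarrow> x = y" if "x \<in> set_tree T" "y \<in> set_tree T" for x y
    using inj_on_eq_iff[OF inj that] .
  have range: "0 < lab x \<and> lab x \<le> n" if "x \<in> set_tree T" for x
    using postorder_labelled_bounds[OF post that] nT by simp
  have bij: "bij_betw lab (verts \<Gamma>) {1..n}"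
    unfolding V bij_betw_def
  proof
    have "lab ` set_tree T \<subseteq> {1..n}" using range by (fastforce simp: Suc_le_eq)
    moreover have "card (lab ` set_tree T) = card {1..n}"
      using card_image[OF inj] size_eq_card[OF dist] nT by simp
    ultimately show "lab ` set_tree T = {1..n}" by (intro card_subset_eq) simp_all
  qed (rule inj)
  have lab_root: "lab (w ?M) = n" using postorder_labelled_root[OF post, of "w ?M"] rootT nT by simp
  have lab_first: "lab (w 0) = 1" using lbl by (simp add: type_IV_labelling_def)
  have lab_n: "lab x = n \<longleftrightarrow> x = w ?M" if "x \<in> set_tree T" for x
    using labeq[OF that wT[OF le_refl]] lab_root by simp
  have lab_1: "lab x = 1 \<longleftrightarrow> x = w 0" if "x \<in> set_tree T" for x
    using labeq[OF that wT[OF le0]] lab_first by simp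

  \<comment> \<open>Meaningful only away from the root \<open>w ?M\<close>, which has no parent and
    is treated separately.\<close>
  define par where "par x = (THE y. (x, y) \<in> tree_parents T)" for x
  have par: "(x, y) \<in> tree_parents T \<longleftrightarrow> y = par x" if x: "x \<in> set_tree T" "x \<noteq> w ?M" for x y
  proof -
    obtain z where z: "(x, z) \<in> tree_parents T"
      using tree_parent_exists[OF dist x(1)] x(2) rootT by auto
    have "par x = z" unfolding par_def
      by (rule the_equality, rule z, rule tree_parent_unique[OF dist _ z])
    then show ?thesis using z tree_parent_unique[OF dist _ z] by blast
  qed
  have par_in: "par x \<in> set_tree T" if "x \<in> set_tree T" "x \<noteq> w ?M" for x
    using par[OF that, of "par x"] tree_parents_in[of x "par x" T] by simp
  have par_less: "lab x < lab (par x)" if "x \<in> set_tree T" "x \<noteq> w ?M" for x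
    using par[OF that, of "par x"] tree_parents_less[OF post, of x "par x"] by simp
  have root_par: "(w ?M, y) \<notin> tree_parents T" for y
    using tree_parents_not_root[OF dist] rootT by blast
  have par_w: "par (w j) = w (Suc j)" if "j < ?M" for j
    using par[of "w j" "w (Suc j)"] wT[of j] tree_parents_spine(1)[OF that, of w U] that weq[of j
        ?M]
    by (simp add: T_def)

  have in_branch: "x \<notin> verts (G t)" if "x \<in> w ` {..?M}" "t \<in> {1..r}" for x t
  proof
    assume x: "x \<in> verts (G t)"
    have "w ` {..<m} = w ` {..?M}" using m3 by (intro arg_cong[where f = "\<lambda>A. w ` A"]) auto
    then have "x \<in> verts (skeleton m r w q c)" using that by (simp add: skeleton_def)
    then have "x = c t" using type_IV_branch[OF IV lbl that(2)] x by blast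
    moreover from that(1) obtain j where "j \<le> ?M" "x = w j" by auto
    ultimately show False using type_IV_skeleton(3)[OF IV lbl _ that(2), of j] m3 by simp
  qed
  have branch_G: "G i = tree_quiver (U (q i))" and branch_root: "roots (U (q i)) = {c i}"
    and branch_lab: "lab (w (Suc (q i))) = lab (w (q i)) + size (U (q i)) + 1"
    and branch_post: "postorder_labelled (U (q i)) (lab (w (q i))) lab" if "i \<in> {1..r}" for i
    using bspec[OF spikes that] by simp_all
  have branch_sub: "U (q i) \<in> subtrees T" if "i \<in> {1..r}" for i
    unfolding T_def by (rule subtree_spine[OF qM[OF that]])
  have branch_dist: "distinct_tree (U (q i))" if "i \<in> {1..r}" for i
    by (rule distinct_subtree[OF branch_sub[OF that] dist])
  have branch_in: "x \<in> set_tree T" if "i \<in> {1..r}" "x \<in> set_tree (U (q i))" for i x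
    using set_tree_subtree[OF branch_sub[OF that(1)]] that(2) by blast
  have branch_not_root: "x \<noteq> w ?M" if "i \<in> {1..r}" "x \<in> set_tree (U (q i))" for i x
    using in_branch[OF _ that(1), of x] branch_G[OF that(1)] that(2) by auto

  \<comment> \<open>A complementary vertex is the sibling labelled immediately before the parent, so
    the parent of a primary vertex \<open>x\<close> has label \<open>lab y + 1\<close>.\<close>
  have pc_branch: "\<exists>t\<in>{1..r}. x \<in> set_tree (U (q t)) \<and> lab x < lab y \<and> lab (par x) = lab y + 1
      \<and> y \<in> set_tree T"
    if pc: "primary_complementary r G lab x y" for x y
  proof -
    obtain t z where t: "t \<in> {1..r}" and tc: "three_cycle (G t) x y z" and l: "lab x < lab y"
        "lab y < lab z"
      using pc unfolding primary_complementary_def by blast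
    have *: "(x, z) \<in> tree_parents (U (q t)) \<and> (y, z) \<in> tree_parents (U (q t)) \<and> lab z = lab y + 1"
      using three_cycle_labels[OF branch_dist[OF t] branch_post[OF t] _ l] tc branch_G[OF t] by simp
    then have x: "x \<in> set_tree (U (q t))" and y: "y \<in> set_tree (U (q t))"
      using tree_parents_in[of _ z "U (q t)"] by blast+
    have "(x, z) \<in> tree_parents T" using * tree_parents_subtree[OF branch_sub[OF t]] by blast
    then have "z = par x" using par[OF branch_in[OF t x] branch_not_root[OF t x]] by simp
    then show ?thesis using t x branch_in[OF t y] l * by blast
  qed
  have pc_lab: "lab (par x) = lab y + 1 \<and> y \<in> set_tree T" if "primary_complementary r G lab x y"
      for x y
    using pc_branch[OF that] by (elim bexE) simp
  \<comment> \<open>A branch vertex that is not primary is the child visited last. This includes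
    \<open>c i\<close>, whose parent \<open>w (Suc (q i))\<close> lies outside the branch.\<close>
  have pc_exists: "lab (par x) = lab x + 1 \<or> (\<exists>y. primary_complementary r G lab x y)"
    if i: "i \<in> {1..r}" and x: "x \<in> set_tree (U (q i))" for i x
  proof (cases "x = c i")
    case True
    then have "(x, w (Suc (q i))) \<in> tree_parents T"
      using tree_parents_spine(2)[OF qM[OF i], of x U w] branch_root[OF i] unfolding T_def by simp
    then have "par x = w (Suc (q i))" using par[OF branch_in[OF i x] branch_not_root[OF i x]]
        by simp
    moreover have "lab x = lab (w (q i)) + size (U (q i))"
      using postorder_labelled_root[OF branch_post[OF i]] branch_root[OF i] True by simp
    ultimately show ?thesis using branch_lab[OF i] by simp
  next
    case False
    then obtain z where z: "(x, z) \<in> tree_parents (U (q i))"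
      using tree_parent_exists[OF branch_dist[OF i] x] branch_root[OF i] by auto
    then have "(x, z) \<in> tree_parents T" using tree_parents_subtree[OF branch_sub[OF i]] by blast
    then have "z = par x" using par[OF branch_in[OF i x] branch_not_root[OF i x]] by simp
    then show ?thesis
      using tree_parent_label[OF branch_dist[OF i] branch_post[OF i] z] branch_G[OF i] i
      unfolding primary_complementary_def by auto
  qed

  let ?\<beta> = "beta_IV n r w q G lab \<alpha>"
  have no_pc: "\<nexists>y. primary_complementary r G lab x y" if x: "x \<in> w ` {..?M}" for x
  proof
    assume "\<exists>y. primary_complementary r G lab x y"
    then obtain t where "t \<in> {1..r}" "x \<in> set_tree (U (q t))" using pc_branch by blast
    then show False using in_branch[OF x] branch_G by simp
  qed
  \<comment> \<open>Away from the root, every case of the definition sums the simple roots from the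
    own label up to just before the label of the parent. For \<open>w (q i)\<close> the branch is
    visited in between, which accounts for the number of its vertices in the upper limit.\<close>
  have beta: "?\<beta> x = (\<Sum>k = lab x..<lab (par x). \<alpha> k)" if x: "x \<in> set_tree T" "x \<noteq> w ?M" for x
  proof -
    consider (cyc) j where "j < ?M" "x = w j" | (br) j where "j < ?M" "x \<in> set_tree (U j)"
      using x TV by (fastforce simp: le_less)
    then show ?thesis
    proof cases
      case cyc
      have npc: "\<nexists>y. primary_complementary r G lab x y" using no_pc[of x] cyc by simp
      show ?thesis
      proof (cases "j \<in> q ` {1..r}")
        case True
        then obtain i where i: "i \<in> {1..r}" "j = q i" by (elim imageE)
        \<comment> \<open>Injectivity of \<open>w\<close> and \<open>q\<close> makes the definite
          description in \<open>beta_IV\<close> pick \<open>i\<close>.\<close>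
        have iff: "i' \<in> {1..r} \<and> x = spike_p w q i' \<longleftrightarrow> i' = i" for i'
        proof
          assume i': "i' \<in> {1..r} \<and> x = spike_p w q i'"
          then have "q i' = q i" using cyc i qM[of i'] weq[of "q i'" j] by (simp add: spike_p_def)
          then show "i' = i" using inj_onD[OF type_IV_skeleton(4)[OF IV lbl]] i i' by blast
        qed (use i cyc in \<open>simp add: spike_p_def\<close>)
        then have sp: "\<exists>j\<in>{1..r}. x = spike_p w q j" "(THE j. j \<in> {1..r} \<and> x = spike_p w q j) = i"
          by (blast, simp)
        have "card (verts (G i)) = size (U (q i))"
          using size_eq_card[OF branch_dist[OF i(1)]] branch_G[OF i(1)] by simp
        then have "lab (par x) = Suc (lab x + card (verts (G i)))"
          using par_w[OF cyc(1)] cyc i branch_lab[OF i(1)] by simp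
        then have "{lab x..lab x + card (verts (G i))} = {lab x..<lab (par x)}"
          by (simp only: atLeastLessThanSuc_atLeastAtMost)
        then show ?thesis unfolding beta_IV_def if_not_P[OF npc] if_P[OF sp(1)] sp(2) by simp
      next
        case False
        have nsp: "\<not> (\<exists>i\<in>{1..r}. x = spike_p w q i)"
        proof
          assume "\<exists>i\<in>{1..r}. x = spike_p w q i"
          then obtain i where "i \<in> {1..r}" "w j = w (q i)" using cyc by (auto simp: spike_p_def)
          then show False using weq[of j "q i"] qM[of i] cyc(1) False by auto
        qed
        have "lab (par x) = Suc (lab x)" using par_w[OF cyc(1)] cyc rest False by simp
        moreover have "lab x \<noteq> n" using lab_n x by blast
        ultimately show ?thesis unfolding beta_IV_def if_not_P[OF npc] if_not_P[OF nsp] by simp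
      qed
    next
      case br
      have "j \<in> q ` {1..r}"
      proof (rule ccontr)
        assume "j \<notin> q ` {1..r}"
        then have "U j = Leaf" using rest br(1) by blast
        then show False using br(2) by simp
      qed
      then obtain i where i: "i \<in> {1..r}" "j = q i" by (elim imageE)
      have xi: "x \<in> set_tree (U (q i))" using br i by simp
      show ?thesis
      proof (cases "\<exists>y. primary_complementary r G lab x y")
        case True
        then obtain y where y: "primary_complementary r G lab x y" by blast
        \<comment> \<open>Every candidate carries the label just before that of the parent, and
          labels are injective.\<close>
        have the: "(THE y. primary_complementary r G lab x y) = y"
        proof (rule the_equality)
          show "primary_complementary r G lab x y" by (rule y)
        next
          fix y' assume "primary_complementary r G lab x y'"
          from pc_lab[OF this] pc_lab[OF y] show "y' = y" using labeq[of y' y] by simp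
        qed
        have "lab (par x) = Suc (lab y)" using pc_lab[OF y] by simp
        then have "{lab x..lab y} = {lab x..<lab (par x)}"
            by (simp only: atLeastLessThanSuc_atLeastAtMost)
        then show ?thesis unfolding beta_IV_def if_P[OF True] the by simp
      next
        case False
        then have "lab (par x) = Suc (lab x)" using pc_exists[OF i(1) xi] by simp
        moreover have nsp: "\<not> (\<exists>i\<in>{1..r}. x = spike_p w q i)"
        proof
          assume "\<exists>k\<in>{1..r}. x = spike_p w q k"
          then obtain k where "k \<in> {1..r}" "x = w (q k)" by (auto simp: spike_p_def)
          then have "x \<in> w ` {..?M}" using qM[of k] by auto
          then show False using in_branch[OF _ i(1)] branch_G[OF i(1)] xi by simp
        qed
        moreover have "lab x \<noteq> n" using lab_n x by blast
        ultimately show ?thesis unfolding beta_IV_def if_not_P[OF False] if_not_P[OF nsp] by simp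
      qed
    qed
  qed
  have beta_root: "?\<beta> (w ?M) = (\<Sum>k = 1..n - 2. \<alpha> k) + \<alpha> n"
  proof -
    have nsp: "\<not> (\<exists>i\<in>{1..r}. w ?M = spike_p w q i)"
    proof
      assume "\<exists>i\<in>{1..r}. w ?M = spike_p w q i"
      then obtain i where "i \<in> {1..r}" "w ?M = w (q i)" by (auto simp: spike_p_def)
      then show False using weq[of ?M "q i"] qM[of i] by simp
    qed
    have npc: "\<nexists>y. primary_complementary r G lab (w ?M) y" by (rule no_pc) simp
    show ?thesis using lab_root unfolding beta_IV_def if_not_P[OF npc] if_not_P[OF nsp] by simp
  qed

  \<comment> \<open>As the cycle has length at least 3, the parent \<open>w 1\<close> of
    \<open>w 0\<close> is not the root \<open>w ?M\<close>. Hence the closing arrow neither doubles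
    nor opposes an arrow of the tree.\<close>
  have first_last: "\<not> ((w 0, w ?M) \<in> tree_arrows T \<or> (w ?M, w 0) \<in> tree_arrows T)"
  proof -
    have "par (w 0) \<noteq> w ?M" using par_w[of 0] weq[of 1 ?M] m3 by simp
    moreover have "w 0 \<noteq> w ?M" using weq[of 0 ?M] m3 by simp
    ultimately show ?thesis
      using tree_edge_iff[OF dist wT[OF le0] wT[OF le_refl]] root_par par[OF wT[OF le0], of
          "w ?M"] by auto
  qed
  have edge: "edges \<Gamma> x y = of_bool ((x, y) \<in> tree_arrows T \<or> (y, x) \<in> tree_arrows T \<or>
      x = w 0 \<and> y = w ?M \<or> x = w ?M \<and> y = w 0)" for x y
  proof -
    let ?E = "insert (w ?M, w 0) (tree_arrows T)"
    have "w 0 \<noteq> w ?M" using weq[of 0 ?M] m3 by simp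
    then have "\<not> ((x, y) \<in> ?E \<and> (y, x) \<in> ?E)"
      using tree_arrows_asym[OF dist, of x y] first_last unfolding insert_iff prod.inject by metis
    then have "edges \<Gamma> x y = of_bool ((x, y) \<in> ?E \<or> (y, x) \<in> ?E)"
      by (cases "(x, y) \<in> ?E"; cases "(y, x) \<in> ?E") (simp_all add: \<Gamma> edges_def del: insert_iff)
    also have "(x, y) \<in> ?E \<or> (y, x) \<in> ?E \<longleftrightarrow> (x, y) \<in> tree_arrows T \<or> (y, x) \<in> tree_arrows T \<or>
        x = w 0 \<and> y = w ?M \<or> x = w ?M \<and> y = w 0"
      unfolding insert_iff prod.inject by metis
    finally show ?thesis .
  qed

  show ?thesis
  proof (rule companion_basis_D[OF assms(1,6) bij, where P = "\<lambda>x. lab (par x)"], unfold V)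
    fix x assume x: "x \<in> set_tree T" "lab x < n"
    then have xM: "x \<noteq> w ?M" using lab_root by auto
    show "lab x < lab (par x) \<and> lab (par x) \<le> n" using par_less[OF x(1) xM] range[OF par_in[OF
        x(1) xM]] by simp
    show "?\<beta> x = (\<Sum>k = lab x..<lab (par x). \<alpha> k)" by (rule beta[OF x(1) xM])
  next
    fix x assume "x \<in> set_tree T" "lab x = n"
    then show "?\<beta> x = (\<Sum>k = 1..n - 2. \<alpha> k) + \<alpha> n" using lab_n beta_root by simp
  next
    fix x y assume xy: "x \<in> set_tree T" "y \<in> set_tree T" "x \<noteq> y" "lab x < n" "lab y < n"
    then have x: "x \<noteq> w ?M" and y: "y \<noteq> w ?M" using lab_root by auto
    \<comment> \<open>Neither vertex is the root, so the closing arrow does not intervene.\<close>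
    have "(x, y) \<in> tree_arrows T \<or> (y, x) \<in> tree_arrows T \<longleftrightarrow> par x = y \<or> par y = x \<or> par x = par y"
      using tree_edge_iff[OF dist xy(1-3)] par[OF xy(1) x] par[OF xy(2) y] by auto
    then show "edges \<Gamma> x y = of_bool (lab (par x) = lab y \<or> lab (par y) = lab x
        \<or> lab (par x) = lab (par y))"
      unfolding edge using x y labeq par_in[OF xy(1) x] par_in[OF xy(2) y] xy(1,2) by simp
  next
    fix x y assume xy: "x \<in> set_tree T" "y \<in> set_tree T" "lab x < n" "lab y = n"
    then have x: "x \<noteq> w ?M" and y: "y = w ?M" using lab_root lab_n by auto
    \<comment> \<open>The neighbours of the root are its children and, through the closing arrow,
      the vertex \<open>w 0\<close> labelled 1; the two cases exclude each other.\<close>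
    have "(x, y) \<in> tree_arrows T \<or> (y, x) \<in> tree_arrows T \<longleftrightarrow> par x = y"
      using tree_edge_iff[OF dist xy(1,2)] x y par[OF xy(1) x] root_par by auto
    moreover have "lab (par x) = n \<longleftrightarrow> par x = w ?M" by (rule lab_n[OF par_in[OF xy(1) x]])
    moreover have "\<not> (x = w 0 \<and> par x = w ?M)" using par_w[of 0] weq[of 1 ?M] m3 by auto
    ultimately show "edges \<Gamma> x y = of_bool (lab x = 1 \<or> lab (par x) = n) \<and> \<not> (lab x = 1
        \<and> lab (par x) = n)"
      unfolding edge lab_1[OF xy(1)] using x y by auto
  qed
qed

end
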